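(* Suppose that $G$ is an affine algebraic group and $F$ is a finitely generated group whose commutator subgroup $[F,F]$ is of infinite index in $F$. Then the dimension of each irreducible component of the variety $\mathrm{Hom}(F,G)$ of homomorphisms $F\to G$ is at least $\dim G$.
   Context: Algebraic groups and varieties are over an algebraically closed field (of arbitrary characteristic); varieties are not necessarily irreducible, and the topology is the Zariski topology. For a group $F$ generated by $n$ elements $f_1,\dots,f_n$ and an algebraic group $G$, the set $\mathrm{Hom}(F,G)$ of all (abstract) group homomorphisms $F\to G$ is a closed subvariety of $G^n$ via $\phi\mapsto(\phi(f_1),\dots,\phi(f_n))$. *)

theory Defs
  imports
    "HOL-Analysis.Abstract_Topology"
    "HOL-Library.Extended_Nat"
    "HOL-Computational_Algebra.Polynomial"
    "HOL-Algebra.Generated_Groups"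
begin

section \<open>The Zariski topology on affine space\<close>

text \<open>
  Affine space with coordinates indexed by a finite type \<open>'i\<close> is the type \<open>'i \<Rightarrow> 'k\<close>.
  Products are obtained by enlarging the index type: a pair of points is a point with coordinates
  in \<open>'i + 'i\<close>, and an \<open>'n\<close>-tuple of points is a point with coordinates in \<open>'n \<times> 'i\<close>.
\<close>

inductive_set poly_functions :: "(('i \<Rightarrow> 'k::comm_ring_1) \<Rightarrow> 'k) set" where
  const: "(\<lambda>_. c) \<in> poly_functions"
| coord: "(\<lambda>x. x i) \<in> poly_functions"
| add: "p \<in> poly_functions \<Longrightarrow> q \<in> poly_functions \<Longrightarrow> (\<lambda>x. p x + q x) \<in> poly_functions"
| mult: "p \<in> poly_functions \<Longrightarrow> q \<in> poly_functions \<Longrightarrow> (\<lambda>x. p x * q x) \<in> poly_functions"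

definition zero_locus :: "(('i \<Rightarrow> 'k::comm_ring_1) \<Rightarrow> 'k) set \<Rightarrow> ('i \<Rightarrow> 'k) set" where
  "zero_locus P = {x. \<forall>p\<in>P. p x = 0}"

definition zariski :: "('i \<Rightarrow> 'k::field) topology" where
  "zariski = topology (\<lambda>U. \<exists>P\<subseteq>poly_functions. U = - zero_locus P)"

lemma istopology_zariski:
  "istopology (\<lambda>U :: ('i \<Rightarrow> 'k::field) set. \<exists>P\<subseteq>poly_functions. U = - zero_locus P)"
  unfolding istopology_def
proof (intro conjI allI impI)
  fix S T :: "('i \<Rightarrow> 'k) set"
  assume "\<exists>P\<subseteq>poly_functions. S = - zero_locus P" "\<exists>P\<subseteq>poly_functions. T = - zero_locus P"
  then obtain P Q where PQ: "P \<subseteq> poly_functions" "Q \<subseteq> poly_functions"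
    "S = - zero_locus P" "T = - zero_locus Q" by blast
  let ?R = "{\<lambda>x. p x * q x | p q. p \<in> P \<and> q \<in> Q}"
  have "?R \<subseteq> poly_functions"
    using PQ by (auto intro: poly_functions.mult)
  moreover have "S \<inter> T = - zero_locus ?R"
    unfolding PQ zero_locus_def by fastforce
  ultimately show "\<exists>P\<subseteq>poly_functions. S \<inter> T = - zero_locus P" by blast
next
  fix \<K> :: "('i \<Rightarrow> 'k) set set"
  assume "\<forall>K\<in>\<K>. \<exists>P\<subseteq>poly_functions. K = - zero_locus P"
  then obtain P where P: "\<And>K. K \<in> \<K> \<Longrightarrow> P K \<subseteq> poly_functions \<and> K = - zero_locus (P K)"
    by metis
  have "(\<Union>K\<in>\<K>. P K) \<subseteq> poly_functions"
    using P by blast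
  moreover have "\<Union>\<K> = (\<Union>K\<in>\<K>. - zero_locus (P K))"
    using P by auto
  then have "\<Union>\<K> = - zero_locus (\<Union>K\<in>\<K>. P K)"
    by (auto simp: zero_locus_def)
  ultimately show "\<exists>P\<subseteq>poly_functions. \<Union>\<K> = - zero_locus P" by blast
qed

lemma openin_zariski:
  "openin zariski U \<longleftrightarrow> (\<exists>P\<subseteq>poly_functions. U = - zero_locus P)"
  unfolding zariski_def by (simp add: topology_inverse'[OF istopology_zariski])

lemma topspace_zariski [simp]: "topspace zariski = UNIV"
proof -
  have "(UNIV :: ('a \<Rightarrow> 'b) set) = - zero_locus {\<lambda>_. 1}"
    by (auto simp: zero_locus_def)
  then have "openin zariski (UNIV :: ('a \<Rightarrow> 'b) set)"
    unfolding openin_zariski by (intro exI[of _ "{\<lambda>_. 1}"]) (auto intro: poly_functions.const)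
  then show ?thesis
    using openin_subset by blast
qed

lemma closedin_zariski:
  "closedin zariski Z \<longleftrightarrow> (\<exists>P\<subseteq>poly_functions. Z = zero_locus P)"
  unfolding closedin_def openin_zariski by (auto simp: Compl_eq_Diff_UNIV[symmetric])


section \<open>Irreducible components and dimension\<close>

definition irreducible_space :: "'a topology \<Rightarrow> bool" where
  "irreducible_space X \<longleftrightarrow> topspace X \<noteq> {} \<and>
     (\<forall>A B. closedin X A \<longrightarrow> closedin X B \<longrightarrow> A \<union> B = topspace X \<longrightarrow>
        A = topspace X \<or> B = topspace X)"

definition irreducible_subset :: "'a topology \<Rightarrow> 'a set \<Rightarrow> bool" where
  "irreducible_subset X S \<longleftrightarrow> S \<subseteq> topspace X \<and> irreducible_space (subtopology X S)"

definition irreducible_components :: "'a topology \<Rightarrow> 'a set set" where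
  "irreducible_components X =
     {S. irreducible_subset X S \<and> (\<forall>T. irreducible_subset X T \<longrightarrow> S \<subseteq> T \<longrightarrow> T = S)}"

text \<open>
  Krull dimension: the supremum of the lengths of chains of irreducible closed subsets.
  The empty space gets dimension 0.
\<close>

definition krull_dim :: "'a topology \<Rightarrow> enat" where
  "krull_dim X = Sup {enat n | n. \<exists>Z :: nat \<Rightarrow> 'a set.
     (\<forall>j\<le>n. closedin X (Z j) \<and> irreducible_subset X (Z j)) \<and> (\<forall>j<n. Z j \<subset> Z (Suc j))}"


section \<open>Affine algebraic groups and varieties of homomorphisms\<close>

text \<open>
  An affine algebraic group is a group structure on a closed subset of affine space whose
  multiplication and inversion are restrictions of polynomial maps.
\<close>

locale affine_algebraic_group = group G
  for G :: "('i::finite \<Rightarrow> 'k::alg_closed_field, 'b) monoid_scheme" (structure) +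
  assumes closed_carrier: "closedin zariski (carrier G)"
    and mult_regular: "\<And>i. \<exists>p\<in>poly_functions. \<forall>x\<in>carrier G. \<forall>y\<in>carrier G.
           (x \<otimes> y) i = p (case_sum x y)"
    and inv_regular: "\<And>i. \<exists>p\<in>poly_functions. \<forall>x\<in>carrier G. (inv x) i = p x"

text \<open>
  The image of \<open>Hom(F, G)\<close> in the power \<open>G\<^sup>n\<close> under evaluation at the generators
  \<open>f j\<close>. Elements of \<open>hom F G\<close> are arbitrary outside the carrier of \<open>F\<close>, which is
  harmless because the \<open>f j\<close> lie in it; they generate \<open>F\<close>, so evaluation is injective
  on homomorphisms.
\<close>

definition hom_variety ::
    "('f, 'a) monoid_scheme \<Rightarrow> ('i \<Rightarrow> 'k, 'b) monoid_scheme \<Rightarrow> ('n \<Rightarrow> 'f) \<Rightarrow> ('n \<times> 'i \<Rightarrow> 'k) set"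
  where "hom_variety F G f = (\<lambda>\<phi>. \<lambda>(j, i). \<phi> (f j) i) ` hom F G"

end

theory Submission
  imports Defs "HOL-Library.Function_Algebras" "HOL-Algebra.FiniteProduct"
begin

text \<open>
  A homomorphism \<open>\<delta>\<close> from \<open>F\<close> onto the integers, with kernel \<open>N\<close> and \<open>\<delta> t = 1\<close>, exists because
  \<open>[F, F]\<close> has infinite index. Every homomorphism \<open>\<phi>\<close> can be twisted by an element \<open>c\<close> of the
  centralizer \<open>C\<close> of \<open>\<phi>(N)\<close>: keep \<open>\<phi>\<close> on \<open>N\<close> and replace \<open>\<phi>(t)\<close> by \<open>\<phi>(t) c\<close>. Conjugating the twists
  by elements \<open>g\<close> of \<open>G\<close> yields a map from (the product of irreducible pieces through \<open>1\<close> of) \<open>G \<times> C\<close>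
  to \<open>Hom(F, G)\<close>. On a fibre \<open>g\<close> determines \<open>c\<close> and ranges over a coset of \<open>C\<close>, so the image has
  dimension at least \<open>dim G + dim C - dim C\<close>. It is irreducible and contains \<open>\<phi>\<close>; taking \<open>\<phi>\<close> in \<open>Z\<close>
  outside all other components, it lies in \<open>Z\<close>.

  Dimensions are compared through algebraic independence. A chain of irreducible closed sets gives
  independent functions on the top set. Adding the coordinates one at a time and counting
  functions of bounded degree shows that there are at least as many independent coordinates.
  Independent coordinates give chains, since a generic fibre of a projection dominates the
  remaining coordinates.
\<close>

section \<open>Polynomial functions in a set of coordinates\<close>

text \<open>A finitely generated \<open>F\<close> may have infinitely many relations, so counting
  equations for Hom(F, G) gives no bound; the twists supply explicit deformations instead. Every c
  in C is admissible because \<phi>(t) c and \<phi>(t) conjugate \<phi>(N) in the same way.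
  Conjugation alone moves \<phi> in a family of dimension dim G minus that of the centralizer of
  \<phi>(F); this centralizer is a subgroup of C, and twisting by C makes up the loss. The dimension
  of C enters twice, as a factor of the source and as the bound on fibres, and cancels. For this it
  is taken to be the largest dimension of an irreducible subset of C, which exists because the
  number of coordinates bounds it. The commutative algebra rests on one device: eliminating a single
  coordinate by pseudo-division by a relation of least degree modulo a prime ideal. It lifts points
  along projections, produces zeros of prime ideals, cuts out a variety generically by finitely many
  equations, and controls growth.\<close>

inductive pdeg :: "'i set \<Rightarrow> nat \<Rightarrow> (('i \<Rightarrow> 'k::comm_ring_1) \<Rightarrow> 'k) \<Rightarrow> bool" for S where
  const: "pdeg S d (\<lambda>_. c)"
| coord: "i \<in> S \<Longrightarrow> pdeg S (Suc d) (\<lambda>x. x i)"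
| add: "pdeg S d p \<Longrightarrow> pdeg S d q \<Longrightarrow> pdeg S d (\<lambda>x. p x + q x)"
| mult: "pdeg S d p \<Longrightarrow> pdeg S e q \<Longrightarrow> pdeg S (d + e) (\<lambda>x. p x * q x)"

definition pf :: "'i set \<Rightarrow> (('i \<Rightarrow> 'k::comm_ring_1) \<Rightarrow> 'k) set" where
  "pf S = {p. \<exists>d. pdeg S d p}"

text \<open>\<open>pdeg S d p\<close> records a degree bound certified by some expression for the
  function \<open>p\<close>, not a degree. The free parameter \<open>d\<close> in the rules
  \<open>const\<close> and \<open>coord\<close> supplies the slack that makes bounds
  monotone.\<close>

lemma pdeg_mono: "pdeg S d p \<Longrightarrow> d \<le> d' \<Longrightarrow> S \<subseteq> S' \<Longrightarrow> pdeg S' d' p"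
proof (induction arbitrary: d' rule: pdeg.induct)
  case (coord i d)
  then show ?case by (cases d') (auto intro: pdeg.coord)
next
  case (mult d p e q)
  then have "pdeg S' d p" "pdeg S' (d' - d) q" by auto
  from pdeg.mult[OF this] show ?case using mult by simp
qed (auto intro: pdeg.intros)

lemma pdeg_mult_le: "pdeg S d p \<Longrightarrow> pdeg S e q \<Longrightarrow> d + e \<le> m \<Longrightarrow> pdeg S m (\<lambda>x. p x * q x)"
  using pdeg_mono[OF pdeg.mult] by blast

lemma pdeg_diff:
  assumes "pdeg S d p" "pdeg S d q"
  shows "pdeg S d (\<lambda>x. p x - q x)"
proof -
  have "pdeg S d (\<lambda>x. (- 1) * q x)"
    by (rule pdeg_mult_le[OF pdeg.const[of S 0] assms(2)]) simp
  from pdeg.add[OF assms(1) this] show ?thesis by simp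
qed

lemma pdeg_sum:
  assumes "\<And>j. j \<in> A \<Longrightarrow> pdeg S d (f j)"
  shows "pdeg S d (\<lambda>x. \<Sum>j\<in>A. f j x)"
  using assms
proof (induction A rule: infinite_finite_induct)
  case (insert j A)
  have "pdeg S d (\<lambda>x. f j x + (\<Sum>j\<in>A. f j x))"
    by (rule pdeg.add) (simp_all add: insert)
  with insert show ?case by simp
qed (simp_all add: pdeg.const)

lemma pdeg_prod:
  assumes "\<And>j. j \<in> A \<Longrightarrow> pdeg S (d j) (f j)"
  shows "pdeg S (\<Sum>j\<in>A. d j) (\<lambda>x. \<Prod>j\<in>A. f j x)"
  using assms
proof (induction A rule: infinite_finite_induct)
  case (insert j A)
  have "pdeg S (d j + (\<Sum>j\<in>A. d j)) (\<lambda>x. f j x * (\<Prod>j\<in>A. f j x))"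
    by (rule pdeg.mult) (simp_all add: insert)
  with insert show ?case by simp
qed (simp_all add: pdeg.const)

lemma pdeg_power: "pdeg S d p \<Longrightarrow> pdeg S (m * d) (\<lambda>x. p x ^ m)"
  using pdeg_prod[of "{..<m}" S "\<lambda>_. d" "\<lambda>_. p"] by simp

lemma pfI: "pdeg S d p \<Longrightarrow> p \<in> pf S"
  unfolding pf_def by (rule CollectI, rule exI)

lemma pfE:
  assumes "p \<in> pf S"
  obtains d where "pdeg S d p"
  using assms unfolding pf_def by (elim CollectE exE)

lemma pf_const [simp]: "(\<lambda>_. c) \<in> pf S"
  by (rule pfI, rule pdeg.const[where d = 0])

lemma pf_coord: "i \<in> S \<Longrightarrow> (\<lambda>x. x i) \<in> pf S"
  by (rule pfI, rule pdeg.coord[where d = 0])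

lemma pf_mono: "p \<in> pf S \<Longrightarrow> S \<subseteq> S' \<Longrightarrow> p \<in> pf S'"
  by (elim pfE) (rule pfI, rule pdeg_mono[OF _ order_refl])

lemma pf_add:
  assumes "p \<in> pf S" "q \<in> pf S"
  shows "(\<lambda>x. p x + q x) \<in> pf S"
proof -
  obtain d e where d: "pdeg S d p" and e: "pdeg S e q"
    using assms by (elim pfE)
  have "pdeg S (max d e) p" "pdeg S (max d e) q"
    by (rule pdeg_mono[OF d], simp, simp) (rule pdeg_mono[OF e], simp, simp)
  then show ?thesis by (intro pfI pdeg.add)
qed

lemma pf_mult: "p \<in> pf S \<Longrightarrow> q \<in> pf S \<Longrightarrow> (\<lambda>x. p x * q x) \<in> pf S"
  by (elim pfE) (rule pfI, rule pdeg.mult)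

lemma pf_uminus: "q \<in> pf S \<Longrightarrow> (\<lambda>x. - q x) \<in> pf S"
  using pf_mult[of "\<lambda>_. - 1" S q] by simp

lemma pf_diff: "p \<in> pf S \<Longrightarrow> q \<in> pf S \<Longrightarrow> (\<lambda>x. p x - q x) \<in> pf S"
  using pf_add[OF _ pf_uminus, of p S q] by simp

lemma pf_power: "p \<in> pf S \<Longrightarrow> (\<lambda>x. p x ^ m) \<in> pf S"
  by (elim pfE) (rule pfI, rule pdeg_power)

lemma pf_sum:
  assumes "\<And>j. j \<in> A \<Longrightarrow> f j \<in> pf S"
  shows "(\<lambda>x. \<Sum>j\<in>A. f j x) \<in> pf S"
  using assms
proof (induction A rule: infinite_finite_induct)
  case (insert j A)
  have "(\<lambda>x. f j x + (\<Sum>j\<in>A. f j x)) \<in> pf S"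
    by (rule pf_add) (simp_all add: insert)
  with insert show ?case by simp
qed simp_all

lemma pf_prod:
  assumes "\<And>j. j \<in> A \<Longrightarrow> f j \<in> pf S"
  shows "(\<lambda>x. \<Prod>j\<in>A. f j x) \<in> pf S"
  using assms
proof (induction A rule: infinite_finite_induct)
  case (insert j A)
  have "(\<lambda>x. f j x * (\<Prod>j\<in>A. f j x)) \<in> pf S"
    by (rule pf_mult) (simp_all add: insert)
  with insert show ?case by simp
qed simp_all

lemma pf_induct [consumes 1, case_names const coord add mult]:
  assumes "p \<in> pf S"
    and "\<And>c. Q (\<lambda>_. c)" "\<And>i. i \<in> S \<Longrightarrow> Q (\<lambda>x. x i)"
    and "\<And>p q. p \<in> pf S \<Longrightarrow> q \<in> pf S \<Longrightarrow> Q p \<Longrightarrow> Q q \<Longrightarrow> Q (\<lambda>x. p x + q x)"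
    and "\<And>p q. p \<in> pf S \<Longrightarrow> q \<in> pf S \<Longrightarrow> Q p \<Longrightarrow> Q q \<Longrightarrow> Q (\<lambda>x. p x * q x)"
  shows "Q p"
proof -
  obtain d where "pdeg S d p" using assms(1) by (rule pfE)
  then show ?thesis
  proof (induction rule: pdeg.induct)
    case (add d p q)
    then show ?case by (intro assms(4)) (simp_all add: pfI)
  next
    case (mult d p e q)
    then show ?case by (intro assms(5)) (simp_all add: pfI)
  qed (use assms(2,3) in auto)
qed

lemma poly_functions_eq_pf: "poly_functions = pf UNIV"
proof (intro equalityI subsetI)
  fix p :: "('a \<Rightarrow> 'b) \<Rightarrow> 'b" assume "p \<in> poly_functions"
  then show "p \<in> pf UNIV"
  proof induction
    case (const c) show ?case by (rule pf_const)
  next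
    case (coord i) show ?case by (rule pf_coord) simp
  next
    case (add p q) then show ?case by (intro pf_add)
  next
    case (mult p q) then show ?case by (intro pf_mult)
  qed
next
  fix p :: "('a \<Rightarrow> 'b) \<Rightarrow> 'b" assume "p \<in> pf UNIV"
  then show "p \<in> poly_functions"
  proof (induction rule: pf_induct)
    case (const c) show ?case by (rule poly_functions.const)
  next
    case (coord i) show ?case by (rule poly_functions.coord)
  next
    case (add p q) then show ?case by (intro poly_functions.add)
  next
    case (mult p q) then show ?case by (intro poly_functions.mult)
  qed
qed

lemma pf_cong:
  assumes "p \<in> pf S" "\<And>i. i \<in> S \<Longrightarrow> x i = y i"
  shows "p x = p y"
  using assms(1) by (induction rule: pf_induct) (simp_all add: assms(2))

lemma pf_subst:
  assumes "p \<in> pf S" "\<And>i. i \<in> S \<Longrightarrow> f i \<in> pf T"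
  shows "(\<lambda>x. p (\<lambda>i. f i x)) \<in> pf T"
  using assms(1)
proof (induction rule: pf_induct)
  case (const c) show ?case by (rule pf_const)
next
  case (coord i) then show ?case by (rule assms(2))
next
  case (add p q) then show ?case by (intro pf_add)
next
  case (mult p q) then show ?case by (intro pf_mult)
qed

lemma pf_empty: "p \<in> pf {} \<Longrightarrow> p = (\<lambda>_. p (\<lambda>_. 0))"
  by (rule ext, rule pf_cong[of p "{}"]) simp_all

lemma if_mult: "(if b then x else 0) * y = (if b then x * y else (0::'a::mult_zero))"
  by simp

text \<open>The coefficients inherit the bound \<open>d\<close>, on which the counting of functions
  relies. Padding them by zeros above \<open>d\<close> is what the Cauchy product formula asks for
  in the case of a product.\<close>

lemma pdeg_expand:
  fixes F :: "('i \<Rightarrow> 'k::idom) \<Rightarrow> 'k"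
  assumes "pdeg (insert i S) d F"
  shows "\<exists>a. (\<forall>j. pdeg S d (a j)) \<and> (\<forall>j>d. a j = (\<lambda>_. 0)) \<and> F = (\<lambda>x. \<Sum>j\<le>d. a j x * x i ^ j)"
  using assms
proof (induction rule: pdeg.induct)
  case (const d c)
  show ?case
    by (rule exI[of _ "\<lambda>j x. if j = 0 then c else 0"]) (simp add: pdeg.const if_mult)
next
  case (coord l d)
  show ?case
  proof (cases "l = i")
    case True
    then show ?thesis
      by (intro exI[of _ "\<lambda>j x. if j = 1 then 1 else 0"]) (simp add: if_mult pdeg.const del: sum.atMost_Suc)
  next
    case False
    have "pdeg S (Suc d) (\<lambda>x::'i \<Rightarrow> 'k. if j = 0 then x l else 0)" for j :: nat
      using False coord by (cases "j = 0") (simp_all add: pdeg.const pdeg.coord)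
    then show ?thesis
      by (intro exI[of _ "\<lambda>j x. if j = 0 then x l else 0"]) (simp add: if_mult del: sum.atMost_Suc)
  qed
next
  case (add d p q)
  then obtain a b where
    "\<forall>j. pdeg S d (a j)" "\<forall>j>d. a j = (\<lambda>_. 0)" "p = (\<lambda>x. \<Sum>j\<le>d. a j x * x i ^ j)"
    "\<forall>j. pdeg S d (b j)" "\<forall>j>d. b j = (\<lambda>_. 0)" "q = (\<lambda>x. \<Sum>j\<le>d. b j x * x i ^ j)"
    by auto
  then show ?case
    by (intro exI[of _ "\<lambda>j x. a j x + b j x"])
      (simp add: pdeg.add sum.distrib distrib_right)
next
  case (mult d p e q)
  then obtain a b where
    a: "\<forall>j. pdeg S d (a j)" "\<forall>j>d. a j = (\<lambda>_. 0)" "p = (\<lambda>x. \<Sum>j\<le>d. a j x * x i ^ j)" and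
    b: "\<forall>j. pdeg S e (b j)" "\<forall>j>e. b j = (\<lambda>_. 0)" "q = (\<lambda>x. \<Sum>j\<le>e. b j x * x i ^ j)"
    by auto
  let ?c = "\<lambda>m x. \<Sum>j\<le>m. a j x * b (m - j) x"
  have "pdeg S (d + e) (?c m)" for m
    by (rule pdeg_sum, rule pdeg.mult) (simp_all add: a b)
  moreover have "?c m = (\<lambda>_. 0)" if "m > d + e" for m
  proof (intro ext sum.neutral ballI)
    fix x j assume "j \<in> {..m}"
    with that have "j > d \<or> m - j > e" by auto
    with a b show "a j x * b (m - j) x = 0" by auto
  qed
  moreover have "(\<lambda>x. p x * q x) = (\<lambda>x. \<Sum>m\<le>d + e. ?c m x * x i ^ m)"
    unfolding a(3) b(3) by (intro ext polynomial_product) (use a b in auto)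
  ultimately show ?case by (intro exI[of _ ?c]) simp
qed

lemma pf_expand:
  fixes F :: "('i \<Rightarrow> 'k::idom) \<Rightarrow> 'k"
  assumes "F \<in> pf (insert i S)"
  obtains a L where "\<And>j. a j \<in> pf S" "F = (\<lambda>x. \<Sum>j<L. a j x * x i ^ j)"
proof -
  obtain d where "pdeg (insert i S) d F" using assms by (rule pfE)
  from pdeg_expand[OF this] obtain a where a: "\<forall>j. pdeg S d (a j)" "F = (\<lambda>x. \<Sum>j\<le>d. a j x * x i ^ j)"
    by blast
  show ?thesis
  proof (rule that)
    show "a j \<in> pf S" for j using a(1) by (auto intro: pfI)
    show "F = (\<lambda>x. \<Sum>j<Suc d. a j x * x i ^ j)" using a(2) unfolding lessThan_Suc_atMost .
  qed
qed

lemma pf_bounded: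
  assumes "\<And>j. c j \<in> pf S"
  shows "\<exists>e. \<forall>j<m::nat. pdeg S e (c j)"
proof (induction m)
  case (Suc m)
  then obtain e where e: "\<forall>j<m. pdeg S e (c j)" by blast
  obtain e' where e': "pdeg S e' (c m)" using assms by (rule pfE)
  have "pdeg S (max e e') (c j)" if "j < Suc m" for j
    using that e e' by (auto simp: less_Suc_eq intro: pdeg_mono)
  then show ?case by blast
qed simp

section \<open>Univariate polynomials over an algebraically closed field\<close>

lemma infinite_alg_closed: "infinite (UNIV :: 'k::alg_closed_field set)"
proof
  assume fin: "finite (UNIV :: 'k set)"
  \<comment> \<open>Over a finite field this product would vanish at every point, and adding 1 would
    leave a polynomial of positive degree without roots.\<close>
  let ?p = "\<Prod>a\<in>UNIV. [:- a, 1:] :: 'k poly"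
  have "degree ?p = (\<Sum>a\<in>(UNIV :: 'k set). 1)"
    by (subst degree_prod_sum_eq) simp_all
  moreover have "card (UNIV :: 'k set) > 0" using fin by (simp add: card_gt_0_iff)
  ultimately have "degree ?p > 0" by simp
  then have "degree (?p + 1) > 0"
    by (subst degree_add_eq_left) simp_all
  then obtain x where x: "poly (?p + 1) x = 0" using alg_closed_imp_poly_has_root by blast
  have "poly ?p x = (\<Prod>a\<in>UNIV. x - a)" by (simp add: poly_prod)
  also have "\<dots> = 0" by (rule prod_zero[OF fin]) (auto intro: bexI[of _ x])
  finally show False using x by simp
qed

definition upoly :: "nat \<Rightarrow> (nat \<Rightarrow> 'k) \<Rightarrow> 'k::comm_ring_1 poly" where
  "upoly L c = (\<Sum>j<L. monom (c j) j)"

lemma poly_upoly: "poly (upoly L c) t = (\<Sum>j<L. c j * t ^ j)"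
  by (simp add: upoly_def poly_sum poly_monom)

lemma coeff_upoly: "coeff (upoly L c) j = (if j < L then c j else 0)"
  by (simp add: upoly_def coeff_sum)

lemma exists_nonroot:
  fixes c :: "nat \<Rightarrow> 'k::alg_closed_field"
  assumes "j < L" "c j \<noteq> 0"
  obtains t where "(\<Sum>j<L. c j * t ^ j) \<noteq> 0"
proof -
  have "upoly L c \<noteq> 0" using assms coeff_upoly[of L c j] by auto
  then have "finite {t. poly (upoly L c) t = 0}" by (rule poly_roots_finite)
  then have "{t. poly (upoly L c) t = 0} \<noteq> UNIV" using infinite_alg_closed by metis
  then show ?thesis using that by (auto simp: poly_upoly)
qed

text \<open>Splitting off one root \<open>t\<close> of \<open>p\<close> uses up one factor
  \<open>q\<close>, since \<open>[:- t, 1:]\<close> divides \<open>q\<close>; there are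
  \<open>degree p\<close> roots with multiplicity.\<close>

lemma common_roots_dvd_power:
  fixes p q :: "'k::alg_closed_field poly"
  assumes "p \<noteq> 0" "\<And>t. poly p t = 0 \<Longrightarrow> poly q t = 0"
  shows "p dvd q ^ degree p"
  using assms
proof (induction "degree p" arbitrary: p)
  case 0
  then show ?case by (metis is_unit_iff_degree unit_imp_dvd)
next
  case (Suc n)
  then obtain t where t: "poly p t = 0" using alg_closed_imp_poly_has_root[of p] by auto
  then obtain p' where p': "p = [:- t, 1:] * p'" by (metis poly_eq_0_iff_dvd dvdE)
  have "p' \<noteq> 0" using p' Suc by auto
  then have "degree p = Suc (degree p')" unfolding p' by (subst degree_mult_eq) auto
  then have "p' dvd q ^ n" using Suc.hyps(1)[of p'] Suc.hyps(2) \<open>p' \<noteq> 0\<close> Suc.prems(2)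
    by (auto simp: p')
  moreover have "[:- t, 1:] dvd q" using t Suc.prems(2) by (simp add: poly_eq_0_iff_dvd)
  ultimately have "p dvd q * q ^ n" unfolding p' using mult_dvd_mono by blast
  then show ?case using Suc.hyps(2) by (metis power_Suc)
qed

text \<open>The exponent \<open>d\<close> in \<open>eq\<close> matches the degree of
  \<open>p\<close>, so that \<open>common_roots_dvd_power\<close> turns common roots into
  divisibility; \<open>r\<close> would then be a nonzero multiple of \<open>p\<close> of smaller
  degree.\<close>

lemma exists_root_not_common:
  fixes p r :: "nat \<Rightarrow> 'k::alg_closed_field" and g q :: "'k poly"
  assumes p: "p d \<noteq> 0" and r: "j < d" "r j \<noteq> 0"
    and eq: "\<And>t. c * poly g t ^ d = (\<Sum>j<d. r j * t ^ j) + poly q t * (\<Sum>j\<le>d. p j * t ^ j)"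
  shows "\<exists>t. (\<Sum>j\<le>d. p j * t ^ j) = 0 \<and> poly g t \<noteq> 0"
proof (rule ccontr)
  assume contra: "\<not> ?thesis"
  let ?p = "upoly (Suc d) p" and ?r = "upoly d r"
  have p0: "?p \<noteq> 0" using coeff_upoly[of "Suc d" p d] p by auto
  have "degree ?p \<le> d" by (intro degree_le) (auto simp: coeff_upoly)
  moreover have "degree ?p \<ge> d" using p by (intro le_degree) (auto simp: coeff_upoly)
  ultimately have deg: "degree ?p = d" by simp
  have r0: "?r \<noteq> 0" using coeff_upoly[of d r j] r by auto
  have "degree ?r \<le> d - 1" by (intro degree_le) (auto simp: coeff_upoly)
  with r have deg_r: "degree ?r < d" by linarith
  have "?p dvd g ^ d" using common_roots_dvd_power[OF p0, of g] contra
    by (auto simp: poly_upoly deg lessThan_Suc_atMost)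
  \<comment> \<open>The hypothesis is an identity of values; over an infinite field it becomes one
    of polynomials.\<close>
  moreover have "smult c (g ^ d) - (?r + q * ?p) = 0"
  proof (rule ccontr)
    assume "smult c (g ^ d) - (?r + q * ?p) \<noteq> 0"
    from poly_roots_finite[OF this] show False
      using infinite_alg_closed[where 'k = 'k] by (simp add: eq poly_upoly lessThan_Suc_atMost)
  qed
  then have "?r = smult c (g ^ d) - q * ?p" by (simp add: algebra_simps)
  ultimately have "?p dvd ?r" by (metis dvd_diff dvd_smult dvd_triv_right)
  then show False using r0 deg deg_r dvd_imp_degree_le by fastforce
qed

section \<open>Prime ideals of polynomial functions\<close>

text \<open>The leading coefficient \<open>p d\<close> is not invertible, so each reduction step
  costs a factor \<open>p d\<close>. At most \<open>L\<close> steps occur, each adding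
  \<open>e\<close> to the degree bound of the coefficients; this linear dependence on
  \<open>L\<close> keeps the growth exponent unchanged in \<open>grow_relation\<close>.\<close>

lemma pseudo_division:
  fixes a p :: "nat \<Rightarrow> ('i \<Rightarrow> 'k::idom) \<Rightarrow> 'k"
  assumes "\<And>j. pdeg S E (a j)" "\<And>j. pdeg S e (p j)"
  shows "\<exists>b q. (\<forall>j. pdeg S (E + L * e) (b j)) \<and> q \<in> pf (insert i S) \<and>
    (\<forall>x. p d x ^ L * (\<Sum>j<L. a j x * x i ^ j) =
       (\<Sum>j<d. b j x * x i ^ j) + q x * (\<Sum>j\<le>d. p j x * x i ^ j))"
  using assms(1)
proof (induction L arbitrary: a E)
  case 0
  have "pdeg S (E + 0 * e) (\<lambda>_::'i \<Rightarrow> 'k. 0)" by (rule pdeg.const)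
  then show ?case by (intro exI[of _ "\<lambda>_ _. 0"] exI[of _ "\<lambda>_. 0"]) simp
next
  case (Suc L)
  show ?case
  proof (cases "L < d")
    case True
    \<comment> \<open>The dividend is already short enough. The power of \<open>p d\<close> is
      multiplied in all the same, to keep the exponent uniform.\<close>
    define b where "b = (\<lambda>j x. if j < Suc L then p d x ^ Suc L * a j x else 0)"
    have "pdeg S (E + Suc L * e) (b j)" for j
    proof (cases "j < Suc L")
      case True
      have "pdeg S (E + Suc L * e) (\<lambda>x. p d x ^ Suc L * a j x)"
        by (rule pdeg_mult_le[OF pdeg_power[OF assms(2)] Suc.prems]) simp
      with True show ?thesis by (simp add: b_def)
    qed (simp add: b_def pdeg.const)
    moreover have "p d x ^ Suc L * (\<Sum>j<Suc L. a j x * x i ^ j) = (\<Sum>j<d. b j x * x i ^ j)" for x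
    proof -
      have "(\<Sum>j<d. b j x * x i ^ j) = (\<Sum>j<Suc L. b j x * x i ^ j)"
        using True by (intro sum.mono_neutral_right) (auto simp: b_def)
      also have "\<dots> = (\<Sum>j<Suc L. p d x ^ Suc L * (a j x * x i ^ j))"
        by (intro sum.cong) (auto simp: b_def)
      finally show ?thesis by (simp only: sum_distrib_left)
    qed
    ultimately show ?thesis by (intro exI[of _ b] exI[of _ "\<lambda>_. 0"]) simp
  next
    case False
    \<comment> \<open>\<open>c\<close> lists the coefficients of \<open>x i ^ (L - d)\<close> times
      the divisor, and \<open>a'\<close> those of \<open>p d\<close> times the dividend after its
      term of degree \<open>L\<close> has been cancelled.\<close>
    define c where "c = (\<lambda>j x. if L - d \<le> j then p (j - (L - d)) x else 0)"
    define a' where "a' = (\<lambda>j x. p d x * a j x - a L x * c j x)"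
    have c: "pdeg S e (c j)" for j
      by (cases "L - d \<le> j") (simp_all add: c_def assms(2) pdeg.const)
    have "pdeg S (E + e) (a' j)" for j unfolding a'_def
      by (rule pdeg_diff; rule pdeg_mult_le[OF assms(2) Suc.prems] pdeg_mult_le[OF Suc.prems c]) simp_all
    from Suc.IH[of "E + e" a', OF this] obtain b q where b: "\<And>j. pdeg S (E + e + L * e) (b j)"
      and q: "q \<in> pf (insert i S)" and eq: "\<And>x. p d x ^ L * (\<Sum>j<L. a' j x * x i ^ j) =
       (\<Sum>j<d. b j x * x i ^ j) + q x * (\<Sum>j\<le>d. p j x * x i ^ j)" by auto
    have shift: "(\<Sum>j<Suc L. c j x * x i ^ j) = x i ^ (L - d) * (\<Sum>j\<le>d. p j x * x i ^ j)" for x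
    proof -
      have "(\<Sum>j<Suc L. c j x * x i ^ j) = (\<Sum>j\<in>{L - d..L}. c j x * x i ^ j)"
        by (intro sum.mono_neutral_right) (auto simp: c_def)
      also have "\<dots> = (\<Sum>j\<le>d. c (j + (L - d)) x * x i ^ (j + (L - d)))"
        using False by (intro sum.reindex_bij_witness[of _ "\<lambda>j. j + (L - d)" "\<lambda>j. j - (L - d)"]) auto
      also have "\<dots> = x i ^ (L - d) * (\<Sum>j\<le>d. p j x * x i ^ j)"
        unfolding sum_distrib_left by (intro sum.cong) (auto simp: c_def power_add)
      finally show ?thesis .
    qed
    have cL: "c L x = p d x" for x using False by (simp add: c_def)
    have red: "(\<Sum>j<L. a' j x * x i ^ j) =
      p d x * (\<Sum>j<Suc L. a j x * x i ^ j) - a L x * (\<Sum>j<Suc L. c j x * x i ^ j)" for x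
    proof -
      have "(\<Sum>j<L. a' j x * x i ^ j) = (\<Sum>j<Suc L. a' j x * x i ^ j)"
        by (simp add: a'_def cL)
      also have "\<dots> = p d x * (\<Sum>j<Suc L. a j x * x i ^ j) - a L x * (\<Sum>j<Suc L. c j x * x i ^ j)"
        unfolding sum_distrib_left sum_subtractf[symmetric]
        by (intro sum.cong) (auto simp: a'_def algebra_simps)
      finally show ?thesis .
    qed
    define q' where "q' = (\<lambda>x. q x + p d x ^ L * (a L x * x i ^ (L - d)))"
    have "f \<in> pf (insert i S)" if "pdeg S m f" for m and f :: "('i \<Rightarrow> 'k) \<Rightarrow> 'k"
      using pf_mono[OF pfI[OF that]] by blast
    then have "q' \<in> pf (insert i S)" unfolding q'_def
      by (intro pf_add q pf_mult pf_power pf_coord) (auto intro: assms(2) Suc.prems)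
    moreover have "p d x ^ Suc L * (\<Sum>j<Suc L. a j x * x i ^ j) =
       (\<Sum>j<d. b j x * x i ^ j) + q' x * (\<Sum>j\<le>d. p j x * x i ^ j)" for x
      using eq[of x] unfolding red shift q'_def by (simp add: algebra_simps)
    moreover have "pdeg S (E + Suc L * e) (b j)" for j using b[of j] by (simp add: add.assoc)
    ultimately show ?thesis by (intro exI[of _ b] exI[of _ q']) simp
  qed
qed

locale pf_prime =
  fixes P :: "(('i \<Rightarrow> 'k::alg_closed_field) \<Rightarrow> 'k) set"
  assumes sub: "P \<subseteq> pf UNIV"
    and zero: "(\<lambda>_. 0) \<in> P"
    and add: "p \<in> P \<Longrightarrow> q \<in> P \<Longrightarrow> (\<lambda>x. p x + q x) \<in> P"
    and mult: "p \<in> pf UNIV \<Longrightarrow> q \<in> P \<Longrightarrow> (\<lambda>x. p x * q x) \<in> P"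
    and one: "(\<lambda>_. 1) \<notin> P"
    and prime: "p \<in> pf UNIV \<Longrightarrow> q \<in> pf UNIV \<Longrightarrow> (\<lambda>x. p x * q x) \<in> P \<Longrightarrow> p \<in> P \<or> q \<in> P"
begin

lemma pf_UNIV: "p \<in> pf S \<Longrightarrow> p \<in> pf UNIV"
  by (rule pf_mono) simp_all

lemma mult': "p \<in> P \<Longrightarrow> q \<in> pf UNIV \<Longrightarrow> (\<lambda>x. p x * q x) \<in> P"
  using mult[of q p] by (simp add: mult.commute)

lemma diff: "p \<in> P \<Longrightarrow> q \<in> P \<Longrightarrow> (\<lambda>x. p x - q x) \<in> P"
  using add[of p "\<lambda>x. (- 1) * q x"] mult[of "\<lambda>_. - 1" q] by simp

lemma diff_cancel: "(\<lambda>x. p x + q x) \<in> P \<Longrightarrow> q \<in> P \<Longrightarrow> p \<in> P"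
  using diff[of "\<lambda>x. p x + q x" q] by simp

lemma sum_mem:
  assumes "\<And>j. j \<in> A \<Longrightarrow> f j \<in> P"
  shows "(\<lambda>x. \<Sum>j\<in>A. f j x) \<in> P"
  using assms
proof (induction A rule: infinite_finite_induct)
  case (insert j A)
  have "(\<lambda>x. f j x + (\<Sum>j\<in>A. f j x)) \<in> P"
    by (rule add) (simp_all add: insert)
  with insert show ?case by simp
qed (simp_all add: zero)

lemma power_mem: "p \<in> pf UNIV \<Longrightarrow> (\<lambda>x. p x ^ m) \<in> P \<Longrightarrow> p \<in> P"
proof (induction m)
  case 0
  then show ?case using one by simp
next
  case (Suc m)
  have "(\<lambda>x. p x * p x ^ m) \<in> P" using Suc.prems(2) by simp
  with prime[OF Suc.prems(1) pf_power[OF Suc.prems(1)]] Suc show ?case by blast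
qed

lemma not_mem_mult:
  "p \<in> pf UNIV \<Longrightarrow> p \<notin> P \<Longrightarrow> q \<in> pf UNIV \<Longrightarrow> q \<notin> P \<Longrightarrow> (\<lambda>x. p x * q x) \<notin> P"
  using prime by blast

text \<open>Transcendence of the class of \<open>x i\<close> over the fraction field of
  \<open>pf S\<close> modulo \<open>P\<close>, with denominators cleared, so that everything can be
  said inside the ring of polynomial functions.\<close>

definition free :: "'i set \<Rightarrow> 'i \<Rightarrow> bool" where
  "free S i \<longleftrightarrow> (\<forall>L a. (\<forall>j. a j \<in> pf S) \<longrightarrow> (\<lambda>x. \<Sum>j<L. a j x * x i ^ j) \<in> P \<longrightarrow> (\<forall>j<L. a j \<in> P))"

text \<open>An algebraic equation for \<open>x i\<close> whose leading coefficient survives modulo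
  \<open>P\<close>. The functions \<open>p j\<close> with \<open>j > d\<close> are arbitrary
  elements of \<open>pf S\<close>.\<close>

definition relation :: "'i set \<Rightarrow> 'i \<Rightarrow> nat \<Rightarrow> (nat \<Rightarrow> ('i \<Rightarrow> 'k) \<Rightarrow> 'k) \<Rightarrow> bool" where
  "relation S i d p \<longleftrightarrow> (\<forall>j. p j \<in> pf S) \<and> p d \<notin> P \<and> (\<lambda>x. \<Sum>j\<le>d. p j x * x i ^ j) \<in> P"

lemma relationI:
  assumes "\<And>j. a j \<in> pf S" "(\<lambda>x. \<Sum>j<L. a j x * x i ^ j) \<in> P" "j < L" "a j \<notin> P"
  shows "\<exists>d<L. relation S i d a"
  using assms(2-3)
proof (induction L)
  case 0
  then show ?case by simp
next
  case (Suc L)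
  show ?case
  proof (cases "a L \<in> P")
    case True
    have "(\<lambda>x. a L x * x i ^ L) \<in> P"
      by (rule mult'[OF True]) (intro pf_power pf_coord UNIV_I)
    with Suc.prems(1) have "(\<lambda>x. \<Sum>j<L. a j x * x i ^ j) \<in> P"
      by (intro diff_cancel[of "\<lambda>x. \<Sum>j<L. a j x * x i ^ j" "\<lambda>x. a L x * x i ^ L"]) simp_all
    moreover have "j < L" using Suc.prems(2) True assms(4) by (cases "j = L") auto
    ultimately show ?thesis using Suc.IH by (auto simp: less_Suc_eq)
  next
    case False
    have "relation S i L a"
      unfolding relation_def using assms(1) False Suc.prems(1) by (simp add: lessThan_Suc_atMost)
    then show ?thesis by blast
  qed
qed

text \<open>A relation of least degree acts as a minimal polynomial: a remainder of smaller degree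
  that lies in \<open>P\<close> is zero modulo \<open>P\<close> coefficient by coefficient.\<close>

lemma minimal_relation:
  assumes "\<not> free S i"
  obtains d p where "relation S i d p" "0 < d"
    "\<And>b. (\<And>j. b j \<in> pf S) \<Longrightarrow> (\<lambda>x. \<Sum>j<d. b j x * x i ^ j) \<in> P \<Longrightarrow> \<forall>j<d. b j \<in> P"
proof -
  from assms obtain L a j where "\<And>j. a j \<in> pf S" "(\<lambda>x. \<Sum>j<L. a j x * x i ^ j) \<in> P" "j < L" "a j \<notin> P"
    unfolding free_def by blast
  from relationI[OF this] have ex: "\<exists>d. \<exists>p. relation S i d p" by blast
  define d where "d = (LEAST d. \<exists>p. relation S i d p)"
  obtain p where p: "relation S i d p" using LeastI_ex[OF ex] unfolding d_def by blast
  have "d \<noteq> 0"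
  \<comment> \<open>A relation of degree 0 would put its own leading coefficient into
    \<open>P\<close>.\<close>
  proof
    assume "d = 0"
    with p have "p 0 \<notin> P" "(\<lambda>x. p 0 x) \<in> P" unfolding relation_def by simp_all
    then show False by simp
  qed
  moreover have "\<forall>j<d. b j \<in> P"
    if b: "\<And>j. b j \<in> pf S" "(\<lambda>x. \<Sum>j<d. b j x * x i ^ j) \<in> P" for b
  proof (intro allI impI, rule ccontr)
    fix j assume "j < d" "b j \<notin> P"
    from relationI[OF b this] obtain d' where "d' < d" "relation S i d' b" by blast
    then show False using not_less_Least[of d' "\<lambda>d. \<exists>p. relation S i d p"] unfolding d_def by blast
  qed
  ultimately show ?thesis using that p by blast
qed

lemma pseudo_division':
  fixes F :: "('i \<Rightarrow> 'k) \<Rightarrow> 'k"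
  assumes F: "F \<in> pf (insert i S)" and p: "\<And>j. p j \<in> pf S"
  obtains L b q where "\<And>j. b j \<in> pf S" "q \<in> pf (insert i S)"
    "\<And>x. p d x ^ L * F x = (\<Sum>j<d. b j x * x i ^ j) + q x * (\<Sum>j\<le>d. p j x * x i ^ j)"
proof -
  obtain a L where a: "\<And>j. a j \<in> pf S" and Feq: "F = (\<lambda>x. \<Sum>j<L. a j x * x i ^ j)"
    by (rule pf_expand[OF F]) (rule that)
  obtain E where E: "\<And>j. j < L \<Longrightarrow> pdeg S E (a j)" using pf_bounded[where c = a and m = L, OF a] by blast
  obtain e where e: "\<And>j. j < Suc d \<Longrightarrow> pdeg S e (p j)" using pf_bounded[where c = p and m = "Suc d", OF p] by blast
  \<comment> \<open>Uniform degree bounds are available only for finitely many coefficients, so both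
    sequences are cut off beyond the indices that occur.\<close>
  define a' where "a' = (\<lambda>j x. if j < L then a j x else 0)"
  define p' where "p' = (\<lambda>j x. if j < Suc d then p j x else 0)"
  have a': "pdeg S E (a' j)" for j unfolding a'_def by (cases "j < L") (simp_all add: E pdeg.const)
  have p': "pdeg S e (p' j)" for j unfolding p'_def by (cases "j < Suc d") (simp_all add: e pdeg.const)
  from pseudo_division[of S E a' e p' L i d, OF a' p']
  obtain b q where b: "\<forall>j. pdeg S (E + L * e) (b j)" and q: "q \<in> pf (insert i S)"
    and eq: "\<forall>x. p' d x ^ L * (\<Sum>j<L. a' j x * x i ^ j) =
       (\<Sum>j<d. b j x * x i ^ j) + q x * (\<Sum>j\<le>d. p' j x * x i ^ j)"
    by (elim exE conjE) (rule that)
  have "p d x ^ L * F x = (\<Sum>j<d. b j x * x i ^ j) + q x * (\<Sum>j\<le>d. p j x * x i ^ j)" for x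
  proof -
    have "(\<Sum>j<L. a' j x * x i ^ j) = F x" unfolding Feq by (intro sum.cong) (auto simp: a'_def)
    moreover have "(\<Sum>j\<le>d. p' j x * x i ^ j) = (\<Sum>j\<le>d. p j x * x i ^ j)"
      by (intro sum.cong) (auto simp: p'_def)
    moreover have "p' d x = p d x" by (simp add: p'_def)
    ultimately show ?thesis using spec[OF eq, of x] by simp
  qed
  from that[OF pfI[OF spec[OF b]] q this] show ?thesis .
qed

lemma upd_pf: "f \<in> pf S \<Longrightarrow> i \<notin> S \<Longrightarrow> f (x(i := t)) = f x"
  by (erule pf_cong) auto

text \<open>A transcendental coordinate may take any value: the coefficients of \<open>f\<close>
  with respect to \<open>x i\<close> already lie in \<open>P\<close> and vanish at
  \<open>x\<close>.\<close>

lemma extend_free: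
  assumes free: "free S i" and i: "i \<notin> S"
    and van: "\<And>f. f \<in> P \<Longrightarrow> f \<in> pf S \<Longrightarrow> f x = 0"
    and f: "f \<in> P" "f \<in> pf (insert i S)"
  shows "f (x(i := t)) = 0"
proof -
  obtain a L where a: "\<And>j. a j \<in> pf S" and feq: "f = (\<lambda>x. \<Sum>j<L. a j x * x i ^ j)"
    by (rule pf_expand[OF f(2)]) (rule that)
  have "\<forall>j<L. a j \<in> P" using free a f(1) unfolding free_def feq by blast
  then have "\<forall>j<L. a j (x(i := t)) = 0" using van a upd_pf[OF a i] by metis
  then show ?thesis by (simp add: feq)
qed

text \<open>Where its leading coefficient is nonzero, a minimal relation implies all equations of
  \<open>P\<close> in the coordinates \<open>insert i S\<close>: the pseudo-remainder of
  \<open>f\<close> lies in \<open>P\<close>, so by minimality its coefficients do too, and they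
  vanish at \<open>x\<close>.\<close>

lemma relation_eliminates:
  assumes rel: "relation S i d p"
    and min: "\<And>b. (\<And>j. b j \<in> pf S) \<Longrightarrow> (\<lambda>x. \<Sum>j<d. b j x * x i ^ j) \<in> P \<Longrightarrow> \<forall>j<d. b j \<in> P"
    and f: "f \<in> P" "f \<in> pf (insert i S)"
    and van: "\<And>f. f \<in> P \<Longrightarrow> f \<in> pf S \<Longrightarrow> f x = 0"
    and x: "p d x \<noteq> 0" "(\<Sum>j\<le>d. p j x * x i ^ j) = 0"
  shows "f x = 0"
proof -
  have p: "\<And>j. p j \<in> pf S" and R: "(\<lambda>x. \<Sum>j\<le>d. p j x * x i ^ j) \<in> P" using rel unfolding relation_def by auto
  obtain L b q where b: "\<And>j. b j \<in> pf S" and q: "q \<in> pf (insert i S)"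
    and eq: "\<And>x. p d x ^ L * f x = (\<Sum>j<d. b j x * x i ^ j) + q x * (\<Sum>j\<le>d. p j x * x i ^ j)"
    by (rule pseudo_division'[OF f(2) p, where d = d]) (rule that)
  have "(\<lambda>x. p d x ^ L * f x) \<in> P" by (rule mult[OF pf_power[OF pf_UNIV[OF p]] f(1)])
  moreover have "(\<lambda>x. q x * (\<Sum>j\<le>d. p j x * x i ^ j)) \<in> P" by (rule mult[OF pf_UNIV[OF q] R])
  ultimately have "(\<lambda>x. \<Sum>j<d. b j x * x i ^ j) \<in> P"
    unfolding eq by (rule diff_cancel)
  from min[OF b this] have "\<forall>j<d. b j x = 0" using van b by blast
  then have "p d x ^ L * f x = 0" using eq[of x] x(2) by simp
  then show ?thesis using x(1) by simp
qed

text \<open>The points \<open>x\<close> in question form the cylinder over the closure of the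
  projection to the coordinates in \<open>S\<close>; away from \<open>h = 0\<close> they lift by one
  coordinate, with \<open>g\<close> kept nonzero. If \<open>x i\<close> is transcendental,
  \<open>h\<close> is a coefficient of \<open>g\<close>; otherwise it is the leading coefficient of
  a minimal relation times a coefficient of the remainder of \<open>g ^ d\<close>.\<close>

lemma extend_one:
  assumes i: "i \<notin> S" and g: "g \<in> pf (insert i S)" "g \<notin> P"
  shows "\<exists>h\<in>pf S - P. \<forall>x. (\<forall>f\<in>P \<inter> pf S. f x = 0) \<longrightarrow> h x \<noteq> 0 \<longrightarrow>
    (\<exists>t. g (x(i := t)) \<noteq> 0 \<and> (\<forall>f\<in>P \<inter> pf (insert i S). f (x(i := t)) = 0))"
proof (cases "free S i")
  case True
  obtain a L where a: "\<And>j. a j \<in> pf S" and geq: "g = (\<lambda>x. \<Sum>j<L. a j x * x i ^ j)"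
    by (rule pf_expand[OF g(1)]) (rule that)
  have "\<exists>j<L. a j \<notin> P"
  proof (rule ccontr)
    assume contra: "\<not> ?thesis"
    then have "g \<in> P" unfolding geq
      by (intro sum_mem mult' pf_power pf_coord) auto
    with g show False by simp
  qed
  then obtain j where j: "j < L" "a j \<notin> P" by blast
  show ?thesis
  proof (rule bexI[of _ "a j"], intro allI impI)
    fix x assume x: "\<forall>f\<in>P \<inter> pf S. f x = 0" "a j x \<noteq> 0"
    obtain t where "(\<Sum>j<L. a j x * t ^ j) \<noteq> 0" using exists_nonroot[of j L "\<lambda>j. a j x"] j x by blast
    then have "g (x(i := t)) \<noteq> 0" by (simp add: geq upd_pf[OF a i])
    then show "\<exists>t. g (x(i := t)) \<noteq> 0 \<and> (\<forall>f\<in>P \<inter> pf (insert i S). f (x(i := t)) = 0)"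
      using extend_free[OF True i, of x] x(1) by blast
  qed (use a j in simp)
next
  case False
  then obtain d p where rel: "relation S i d p" and d: "0 < d" and
    min: "\<And>b. (\<And>j. b j \<in> pf S) \<Longrightarrow> (\<lambda>x. \<Sum>j<d. b j x * x i ^ j) \<in> P \<Longrightarrow> \<forall>j<d. b j \<in> P"
    by (rule minimal_relation) blast
  have p: "\<And>j. p j \<in> pf S" and pd: "p d \<notin> P" and R: "(\<lambda>x. \<Sum>j\<le>d. p j x * x i ^ j) \<in> P"
    using rel unfolding relation_def by auto
  \<comment> \<open>Dividing the power \<open>g ^ d\<close> rather than \<open>g\<close> prepares
    for \<open>exists_root_not_common\<close>. The remainder is nonzero modulo \<open>P\<close>
    because neither \<open>p d\<close> nor \<open>g\<close> lies in the prime
    \<open>P\<close>.\<close>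
  obtain L b q where b: "\<And>j. b j \<in> pf S" and q: "q \<in> pf (insert i S)"
    and eq: "\<And>x. p d x ^ L * g x ^ d = (\<Sum>j<d. b j x * x i ^ j) + q x * (\<Sum>j\<le>d. p j x * x i ^ j)"
    by (rule pseudo_division'[OF pf_power[OF g(1)] p, where d = d]) (rule that)
  have "\<exists>j<d. b j \<notin> P"
  proof (rule ccontr)
    assume "\<not> ?thesis"
    then have "(\<lambda>x. \<Sum>j<d. b j x * x i ^ j) \<in> P"
      by (intro sum_mem mult' pf_power pf_coord) auto
    then have "(\<lambda>x. p d x ^ L * g x ^ d) \<in> P"
      unfolding eq by (intro add mult[OF pf_UNIV[OF q] R])
    from prime[OF _ _ this] have "p d \<in> P \<or> g \<in> P"
      using power_mem pf_UNIV[OF p] pf_UNIV[OF g(1)] pf_power by metis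
    with pd g show False by blast
  qed
  then obtain j where j: "j < d" "b j \<notin> P" by blast
  show ?thesis
  \<comment> \<open>Nonvanishing of this product at a point means that the relation keeps its degree
    \<open>d\<close> there and the remainder stays nonzero.\<close>
  proof (rule bexI[of _ "\<lambda>x. p d x * b j x"], intro allI impI)
    fix x assume x: "\<forall>f\<in>P \<inter> pf S. f x = 0" "p d x * b j x \<noteq> 0"
    obtain G where G: "\<And>t. g (x(i := t)) = poly G t"
    proof -
      obtain a L where a: "\<And>j. a j \<in> pf S" and geq: "g = (\<lambda>x. \<Sum>j<L. a j x * x i ^ j)"
        by (rule pf_expand[OF g(1)]) (rule that)
      show ?thesis by (rule that[of "upoly L (\<lambda>j. a j x)"]) (simp add: geq upd_pf[OF a i] poly_upoly)
    qed
    obtain Q where Q: "\<And>t. q (x(i := t)) = poly Q t"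
    proof -
      obtain a L where a: "\<And>j. a j \<in> pf S" and qeq: "q = (\<lambda>x. \<Sum>j<L. a j x * x i ^ j)"
        by (rule pf_expand[OF q(1)]) (rule that)
      show ?thesis by (rule that[of "upoly L (\<lambda>j. a j x)"]) (simp add: qeq upd_pf[OF a i] poly_upoly)
    qed
    \<comment> \<open>If all roots of the relation were roots of \<open>G\<close>, it would divide \<open>G ^ d\<close> and hence the
      nonzero remainder, whose degree is less than \<open>d\<close>.\<close>
    have "p d x ^ L * poly G t ^ d = (\<Sum>j<d. b j x * t ^ j) + poly Q t * (\<Sum>j\<le>d. p j x * t ^ j)" for t
      using eq[of "x(i := t)"] by (simp add: G Q upd_pf[OF p i] upd_pf[OF b i])
    from exists_root_not_common[of "\<lambda>j. p j x" d j "\<lambda>j. b j x", OF _ j(1) _ this]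
    obtain t where t: "(\<Sum>j\<le>d. p j x * t ^ j) = 0" "poly G t \<noteq> 0" using x(2) by auto
    have "f (x(i := t)) = 0" if "f \<in> P" "f \<in> pf (insert i S)" for f
      using relation_eliminates[OF rel min that, of "x(i := t)"] x t
      by (auto simp: upd_pf[OF p i] upd_pf[OF _ i])
    with t show "\<exists>t. g (x(i := t)) \<noteq> 0 \<and> (\<forall>f\<in>P \<inter> pf (insert i S). f (x(i := t)) = 0)"
      using G by auto
  next
    show "(\<lambda>x. p d x * b j x) \<in> pf S - P"
      using not_mem_mult[of "p d" "b j"] pf_mult[OF p b] pf_UNIV p b pd j by blast
  qed
qed

end

section \<open>Growth of coordinate rings and algebraic independence\<close>

interpretation fvs: vector_space "\<lambda>(c::'k::field) (f::'x \<Rightarrow> 'k) x. c * f x"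
  by unfold_locales (auto simp: algebra_simps)

lemma span_sum_fun:
  fixes f :: "'a \<Rightarrow> 'x \<Rightarrow> 'k::field"
  assumes "\<And>j. j \<in> A \<Longrightarrow> f j \<in> fvs.span M"
  shows "(\<lambda>x. \<Sum>j\<in>A. f j x) \<in> fvs.span M"
  using assms
proof (induction A rule: infinite_finite_induct)
  case (insert j A)
  then have "f j + (\<lambda>x. \<Sum>j\<in>A. f j x) \<in> fvs.span M"
    by (intro fvs.span_add) simp_all
  with insert show ?case by (simp add: plus_fun_def)
qed (use fvs.span_zero[of M] in \<open>simp_all add: zero_fun_def\<close>)

lemma span_times:
  fixes g :: "'x \<Rightarrow> 'k::field"
  assumes "f \<in> fvs.span M" "\<And>m. m \<in> M \<Longrightarrow> (\<lambda>x. m x * g x) \<in> M'"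
  shows "(\<lambda>x. f x * g x) \<in> fvs.span M'"
  using assms(1)
proof (induction rule: fvs.span_induct_alt)
  case base
  then show ?case using fvs.span_zero[of M'] by (simp add: zero_fun_def)
next
  case (step c m f)
  have "(\<lambda>x. c * (m x * g x)) + (\<lambda>x. f x * g x) \<in> fvs.span M'"
    by (rule fvs.span_add[OF fvs.span_scale[OF fvs.span_base[OF assms(2)[OF step(1)]]] step(2)])
  then show ?case by (simp add: plus_fun_def algebra_simps)
qed

text \<open>Independence is stated for an indexed family, so that it also rules out equal functions
  at different indices.\<close>

lemma family_card_le:
  fixes s :: "'a \<Rightarrow> 'x \<Rightarrow> 'k::field"
  assumes fin: "finite A" "finite M" and span: "\<And>a. a \<in> A \<Longrightarrow> s a \<in> fvs.span M"
    and ind: "\<And>c. (\<And>x. (\<Sum>a\<in>A. c a * s a x) = 0) \<Longrightarrow> \<forall>a\<in>A. c a = 0"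
  shows "card A \<le> card M"
proof -
  have inj: "inj_on s A"
  proof (rule inj_onI, rule ccontr)
    fix a b assume ab: "a \<in> A" "b \<in> A" "s a = s b" "a \<noteq> b"
    let ?c = "\<lambda>z. (if z = a then 1 else 0) - (if z = b then 1 else 0) :: 'k"
    have "(\<Sum>z\<in>A. ?c z * s z x) = 0" for x
      using ab fin by (simp add: left_diff_distrib sum_subtractf if_mult)
    then have "?c a = 0" using ind[of ?c] ab(1) by blast
    then show False using ab(4) by simp
  qed
  have "fvs.independent (s ` A)"
  proof
    assume "fvs.dependent (s ` A)"
    then obtain c where c: "\<exists>v\<in>s ` A. c v \<noteq> 0" "(\<Sum>v\<in>s ` A. (\<lambda>x. c v * v x)) = 0"
      using fin fvs.dependent_finite[of "s ` A"] by auto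
    have "(\<Sum>a\<in>A. c (s a) * s a x) = 0" for x
    proof -
      have "(\<Sum>v\<in>s ` A. (\<lambda>x. c v * v x)) x = (\<Sum>v\<in>s ` A. c v * v x)"
        using fin(1)[THEN finite_imageI, of s] by (induction rule: finite_induct) (simp_all)
      then show ?thesis using c(2) inj by (simp add: sum.reindex)
    qed
    from ind[OF this] c(1) show False by blast
  qed
  then have "card (s ` A) \<le> card M"
    using fvs.independent_span_bound[OF fin(2)] span by blast
  then show ?thesis using inj by (simp add: card_image)
qed

text \<open>For fixed values of the other variables the sum is a polynomial in the last one that
  vanishes on an infinite field, so the induction hypothesis applies to its coefficients.\<close>

lemma box_monomials_independent:
  fixes c :: "(nat \<Rightarrow> nat) \<Rightarrow> 'k::alg_closed_field"
  assumes "\<And>x :: nat \<Rightarrow> 'k. (\<Sum>\<alpha>\<in>PiE {..<n} (\<lambda>_. {..<m}). c \<alpha> * (\<Prod>j<n. x j ^ \<alpha> j)) = 0"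
    and "\<alpha> \<in> PiE {..<n} (\<lambda>_. {..<m})"
  shows "c \<alpha> = 0"
  using assms
proof (induction n arbitrary: c \<alpha>)
  case 0
  then show ?case by simp
next
  case (Suc n)
  let ?B = "PiE {..<n} (\<lambda>_. {..<m})"
  have split: "PiE {..<Suc n} (\<lambda>_. {..<m}) = (\<lambda>(j, \<alpha>). \<alpha>(n := j)) ` ({..<m} \<times> ?B)"
    unfolding lessThan_Suc by (rule PiE_insert_eq)
  have inj: "inj_on (\<lambda>(j, \<alpha>). \<alpha>(n := j)) ({..<m} \<times> ?B)"
    by (rule inj_combinator) simp
  have eq: "(\<Sum>j<m. (\<Sum>\<alpha>\<in>?B. c (\<alpha>(n := j)) * (\<Prod>l<n. x l ^ \<alpha> l)) * t ^ j) = 0" for x :: "nat \<Rightarrow> 'k" and t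
  proof -
    have "0 = (\<Sum>\<alpha>\<in>PiE {..<Suc n} (\<lambda>_. {..<m}). c \<alpha> * (\<Prod>j<Suc n. (x(n := t)) j ^ \<alpha> j))"
      using Suc.prems(1)[of "x(n := t)"] by simp
    also have "\<dots> = (\<Sum>(j, \<alpha>)\<in>{..<m} \<times> ?B. c (\<alpha>(n := j)) * (\<Prod>l<Suc n. (x(n := t)) l ^ (\<alpha>(n := j)) l))"
      unfolding split sum.reindex[OF inj] by (simp add: case_prod_unfold)
    also have "\<dots> = (\<Sum>j<m. \<Sum>\<alpha>\<in>?B. c (\<alpha>(n := j)) * (\<Prod>l<n. x l ^ \<alpha> l) * t ^ j)"
      by (subst sum.cartesian_product[symmetric]) (simp add: mult.assoc)
    finally show ?thesis by (simp add: sum_distrib_right)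
  qed
  from Suc.prems(2) obtain j \<beta> where j: "j < m" "\<beta> \<in> ?B" "\<alpha> = \<beta>(n := j)" unfolding split by auto
  have "(\<Sum>\<alpha>\<in>?B. c (\<alpha>(n := j)) * (\<Prod>l<n. x l ^ \<alpha> l)) = 0" for x :: "nat \<Rightarrow> 'k"
  proof (rule ccontr)
    let ?d = "\<lambda>j. \<Sum>\<alpha>\<in>?B. c (\<alpha>(n := j)) * (\<Prod>l<n. x l ^ \<alpha> l)"
    assume "?d j \<noteq> 0"
    from exists_nonroot[of j m ?d, OF j(1) this] obtain t where "(\<Sum>j<m. ?d j * t ^ j) \<noteq> 0" .
    then show False using eq by blast
  qed
  from Suc.IH[of "\<lambda>\<alpha>. c (\<alpha>(n := j))", OF this j(2)] show ?case unfolding j(3) .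
qed

definition alg_ind :: "(('i \<Rightarrow> 'k::comm_ring_1) \<Rightarrow> 'k) set \<Rightarrow> nat \<Rightarrow> (nat \<Rightarrow> ('i \<Rightarrow> 'k) \<Rightarrow> 'k) \<Rightarrow> bool" where
  "alg_ind P n y \<longleftrightarrow> (\<forall>j<n. y j \<in> pf UNIV) \<and>
     (\<forall>q\<in>pf {..<n}. (\<lambda>x. q (\<lambda>j. y j x)) \<in> P \<longrightarrow> q = (\<lambda>_. 0))"

context pf_prime
begin

text \<open>\<open>u\<close> is a common denominator: once it is inverted, all functions of degree
  at most \<open>D\<close> in the coordinates \<open>S\<close> lie in the span of \<open>M\<close>
  modulo \<open>P\<close>.\<close>

definition spans :: "'i set \<Rightarrow> nat \<Rightarrow> (('i \<Rightarrow> 'k) \<Rightarrow> 'k) set \<Rightarrow> (('i \<Rightarrow> 'k) \<Rightarrow> 'k) \<Rightarrow> bool" where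
  "spans S D M u \<longleftrightarrow> finite M \<and> u \<in> pf UNIV - P \<and>
     (\<forall>F. pdeg S D F \<longrightarrow> (\<exists>v\<in>fvs.span M. (\<lambda>x. u x * F x - v x) \<in> P))"

text \<open>A Hilbert function estimate up to denominators, so \<open>r\<close> bounds the
  transcendence degree of the coordinates in \<open>S\<close> from above. Writing
  \<open>D + 1\<close> keeps the bound meaningful for \<open>D = 0\<close>.\<close>

definition grow :: "'i set \<Rightarrow> nat \<Rightarrow> bool" where
  "grow S r \<longleftrightarrow> (\<exists>K. \<forall>D. \<exists>M u. spans S D M u \<and> card M \<le> K * (D + 1) ^ r)"

lemma grow_empty: "grow {} 0"
  unfolding grow_def spans_def
proof (intro exI[of _ "1::nat"] allI exI[of _ "{\<lambda>_. 1}"] exI[of _ "\<lambda>_. 1"] conjI impI)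
  fix D and F :: "('i \<Rightarrow> 'k) \<Rightarrow> 'k" assume "pdeg {} D F"
  then have F: "F = (\<lambda>_. F (\<lambda>_. 0))" by (intro pf_empty pfI)
  have "(\<lambda>x. F (\<lambda>_. 0) * (\<lambda>_. 1) x) \<in> fvs.span {\<lambda>_::'i \<Rightarrow> 'k. 1}"
    by (rule fvs.span_scale, rule fvs.span_base) simp
  moreover have "1 * F x - F (\<lambda>_. 0) * 1 = 0" for x using fun_cong[OF F, of x] by simp
  then have "(\<lambda>x. 1 * F x - F (\<lambda>_. 0) * (\<lambda>_. 1) x) \<in> P" using zero by (simp only:)
  ultimately show "\<exists>v\<in>fvs.span {\<lambda>_. 1}. (\<lambda>x. 1 * F x - v x) \<in> P"
    by (intro bexI[of _ "\<lambda>x. F (\<lambda>_. 0) * 1"])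
qed (use one in auto)

text \<open>Each spanning function is multiplied by the \<open>D + 1\<close> powers of
  \<open>x i\<close>, which raises the exponent by one.\<close>

lemma grow_insert: 
  assumes "grow S r"
  shows "grow (insert i S) (Suc r)"
proof -
  from assms obtain K where K: "\<forall>D. \<exists>M u. spans S D M u \<and> card M \<le> K * (D + 1) ^ r" unfolding grow_def by (elim exE)
  show ?thesis unfolding grow_def
  proof (rule exI[of _ K], rule allI)
    fix D
    from spec[OF K, of D] obtain M u where fin: "finite M" and u: "u \<in> pf UNIV - P" and
      red: "\<forall>F. pdeg S D F \<longrightarrow> (\<exists>v\<in>fvs.span M. (\<lambda>x. u x * F x - v x) \<in> P)" and
      cardM: "card M \<le> K * (D + 1) ^ r" unfolding spans_def by (elim exE conjE) (rule that)
    let ?M = "(\<lambda>(m, j) x. m x * x i ^ j) ` (M \<times> {..D})"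
    have "card ?M \<le> card (M \<times> {..D})" using fin by (intro card_image_le) simp
    also have "\<dots> = card M * (D + 1)" by (simp add: card_cartesian_product)
    also have "\<dots> \<le> K * (D + 1) ^ r * (D + 1)" by (rule mult_right_mono[OF cardM]) simp
    also have "\<dots> = K * (D + 1) ^ Suc r" by (simp only: power_Suc mult_ac)
    finally have card: "card ?M \<le> K * (D + 1) ^ Suc r" .
    have "\<exists>v\<in>fvs.span ?M. (\<lambda>x. u x * F x - v x) \<in> P" if F: "pdeg (insert i S) D F" for F
    proof -
      obtain a where a: "\<forall>j. pdeg S D (a j)" "F = (\<lambda>x. \<Sum>j\<le>D. a j x * x i ^ j)"
        using pdeg_expand[OF F] by (elim exE conjE) (rule that)
      have "\<forall>j. \<exists>v. v \<in> fvs.span M \<and> (\<lambda>x. u x * a j x - v x) \<in> P" using red a(1) by blast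
      from choice[OF this] obtain v where v: "\<forall>j. v j \<in> fvs.span M \<and> (\<lambda>x. u x * a j x - v j x) \<in> P" ..
      let ?v = "\<lambda>x. \<Sum>j\<le>D. v j x * x i ^ j"
      have "?v \<in> fvs.span ?M"
      proof (rule span_sum_fun)
        fix j assume "j \<in> {..D}"
        then show "(\<lambda>x. v j x * x i ^ j) \<in> fvs.span ?M"
          by (intro span_times[of "v j" M]) (use v in auto)
      qed
      moreover have "(\<lambda>x. u x * F x - ?v x) \<in> P"
      proof -
        have "(\<lambda>x. \<Sum>j\<le>D. (u x * a j x - v j x) * x i ^ j) \<in> P"
          by (intro sum_mem mult' pf_power pf_coord) (use v in auto)
        then show ?thesis unfolding a(2) by (simp add: sum_distrib_left sum_subtractf algebra_simps)
      qed
      ultimately show ?thesis by (intro bexI[of _ ?v])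
    qed
    with fin u card show "\<exists>M u. spans (insert i S) D M u \<and> card M \<le> K * (D + 1) ^ Suc r"
      unfolding spans_def
      by (intro exI[of _ ?M] exI[of _ u]) simp
  qed
qed

text \<open>Modulo the relation only the powers of \<open>x i\<close> below \<open>d\<close> remain,
  a number independent of \<open>D\<close>. The reduction costs the denominator
  \<open>p d ^ (D + 1)\<close> and raises the degree of the coefficients only linearly in
  \<open>D\<close>, so the exponent \<open>r\<close> stays.\<close>

lemma grow_relation: 
  assumes "grow S r" and rel: "relation S i d p"
  shows "grow (insert i S) r"
proof -
  from assms(1) obtain K where K: "\<forall>D. \<exists>M u. spans S D M u \<and> card M \<le> K * (D + 1) ^ r" unfolding grow_def by (elim exE)
  have p: "\<And>j. p j \<in> pf S" and pd: "p d \<notin> P" and R: "(\<lambda>x. \<Sum>j\<le>d. p j x * x i ^ j) \<in> P"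
    using rel unfolding relation_def by auto
  obtain e where e: "\<forall>j<Suc d. pdeg S e (p j)" using pf_bounded[of p, OF p] by blast
  define p' where "p' = (\<lambda>j x. if j \<le> d then p j x else 0)"
  have p': "pdeg S e (p' j)" for j unfolding p'_def by (cases "j \<le> d") (simp_all add: e pdeg.const)
  have R': "(\<lambda>x. \<Sum>j\<le>d. p' j x * x i ^ j) \<in> P"
  proof -
    have "(\<Sum>j\<le>d. p' j x * x i ^ j) = (\<Sum>j\<le>d. p j x * x i ^ j)" for x
      by (intro sum.cong) (auto simp: p'_def)
    with R show ?thesis by simp
  qed
  have pd': "p' d \<in> pf UNIV" "p' d \<notin> P" using pd pf_UNIV[OF p] by (simp_all add: p'_def)
  show ?thesis unfolding grow_def
  \<comment> \<open>The coefficients after division have degree at most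
    \<open>D + Suc D * e\<close>, and adding 1 gives \<open>(e + 1) * (D + 1)\<close>; the factor
    \<open>d\<close> counts the remaining powers of \<open>x i\<close>.\<close>
  proof (rule exI[of _ "d * K * (e + 1) ^ r"], rule allI)
    fix D
    from spec[OF K, of "D + Suc D * e"] obtain M u where fin: "finite M" and u: "u \<in> pf UNIV - P" and
      red: "\<forall>F. pdeg S (D + Suc D * e) F \<longrightarrow> (\<exists>v\<in>fvs.span M. (\<lambda>x. u x * F x - v x) \<in> P)" and
      cardM: "card M \<le> K * (D + Suc D * e + 1) ^ r" unfolding spans_def by (elim exE conjE) (rule that)
    let ?M = "(\<lambda>(m, j) x. m x * x i ^ j) ` (M \<times> {..<d})"
    let ?u = "\<lambda>x. u x * p' d x ^ Suc D"
    have "card ?M \<le> card (M \<times> {..<d})" using fin by (intro card_image_le) simp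
    also have "\<dots> \<le> K * (D + Suc D * e + 1) ^ r * d" using cardM by (simp add: card_cartesian_product)
    also have "D + Suc D * e + 1 = (e + 1) * (D + 1)" by simp
    finally have card: "card ?M \<le> d * K * (e + 1) ^ r * (D + 1) ^ r"
      unfolding power_mult_distrib by (simp only: mult_ac)
    have u': "?u \<in> pf UNIV - P"
      using u pd' power_mem[OF pd'(1), of "Suc D"]
      by (intro DiffI pf_mult pf_power not_mem_mult) blast+
    have "\<exists>v\<in>fvs.span ?M. (\<lambda>x. ?u x * F x - v x) \<in> P" if F: "pdeg (insert i S) D F" for F
    proof -
      obtain a where a: "\<forall>j. pdeg S D (a j)" "F = (\<lambda>x. \<Sum>j\<le>D. a j x * x i ^ j)"
        using pdeg_expand[OF F] by (elim exE conjE) (rule that)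
      from pseudo_division[of S D a e p' "Suc D" i d, OF spec[OF a(1)] p']
      obtain b q where b: "\<forall>j. pdeg S (D + Suc D * e) (b j)" and q: "q \<in> pf (insert i S)"
        and eq: "\<forall>x. p' d x ^ Suc D * (\<Sum>j<Suc D. a j x * x i ^ j) =
           (\<Sum>j<d. b j x * x i ^ j) + q x * (\<Sum>j\<le>d. p' j x * x i ^ j)"
        by (elim exE conjE) (rule that)
      have "\<forall>j. \<exists>v. v \<in> fvs.span M \<and> (\<lambda>x. u x * b j x - v x) \<in> P" using red b by blast
      from choice[OF this] obtain v where v: "\<forall>j. v j \<in> fvs.span M \<and> (\<lambda>x. u x * b j x - v j x) \<in> P" ..
      let ?v = "\<lambda>x. \<Sum>j<d. v j x * x i ^ j"
      have "?v \<in> fvs.span ?M"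
      proof (rule span_sum_fun)
        fix j assume "j \<in> {..<d}"
        then show "(\<lambda>x. v j x * x i ^ j) \<in> fvs.span ?M"
          by (intro span_times[of "v j" M]) (use v in auto)
      qed
      moreover have "(\<lambda>x. ?u x * F x - ?v x) \<in> P"
      proof -
        have "(\<lambda>x. \<Sum>j<d. (u x * b j x - v j x) * x i ^ j) \<in> P"
          by (intro sum_mem mult' pf_power pf_coord) (use v in auto)
        moreover have "(\<lambda>x. (u x * q x) * (\<Sum>j\<le>d. p' j x * x i ^ j)) \<in> P"
          using u by (intro mult R' pf_mult pf_UNIV[OF q]) auto
        ultimately have "(\<lambda>x. (\<Sum>j<d. (u x * b j x - v j x) * x i ^ j) + (u x * q x) * (\<Sum>j\<le>d. p' j x * x i ^ j)) \<in> P"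
          by (rule add)
        moreover have "(\<Sum>j<d. (u x * b j x - v j x) * x i ^ j) + (u x * q x) * (\<Sum>j\<le>d. p' j x * x i ^ j) = ?u x * F x - ?v x" for x
        proof -
          have "?u x * F x = u x * (p' d x ^ Suc D * (\<Sum>j<Suc D. a j x * x i ^ j))"
            unfolding a(2) lessThan_Suc_atMost by (simp only: mult.assoc)
          also have "\<dots> = u x * (\<Sum>j<d. b j x * x i ^ j) + (u x * q x) * (\<Sum>j\<le>d. p' j x * x i ^ j)"
            unfolding spec[OF eq, of x] by (simp only: distrib_left mult.assoc)
          finally show ?thesis
            by (simp add: sum_distrib_left sum_subtractf left_diff_distrib mult.assoc)
        qed
        ultimately show ?thesis by simp
      qed
      ultimately show ?thesis by (intro bexI[of _ ?v])
    qed
    with fin u' card show "\<exists>M u. spans (insert i S) D M u \<and> card M \<le> d * K * (e + 1) ^ r * (D + 1) ^ r"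
      unfolding spans_def
      by (intro exI[of _ ?M] exI[of _ ?u]) simp
  qed
qed

text \<open>The monomials in the \<open>y j\<close> with exponents below \<open>m\<close> number
  \<open>m ^ n\<close>, are independent modulo \<open>P\<close>, and have degree linear in
  \<open>m\<close>; for large \<open>m\<close> this exceeds a bound of order \<open>m ^ r\<close>
  unless \<open>n \<le> r\<close>.\<close>

lemma alg_ind_le_growth:
  assumes "grow UNIV r" "alg_ind P n y"
  shows "n \<le> r"
proof (rule ccontr)
  assume "\<not> n \<le> r"
  then have rn: "Suc r \<le> n" by simp
  from assms(1) obtain K where K: "\<forall>D. \<exists>M u. spans UNIV D M u \<and> card M \<le> K * (D + 1) ^ r" unfolding grow_def by (elim exE)
  define y' where "y' = (\<lambda>j x. if j < n then y j x else 0)"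
  have "y' j \<in> pf UNIV" for j
    using assms(2) unfolding y'_def alg_ind_def by (cases "j < n") simp_all
  from pf_bounded[of y', OF this] obtain e where e: "\<forall>j<n. pdeg UNIV e (y' j)" by blast
  \<comment> \<open>Chosen so that \<open>m ^ Suc r\<close> exceeds
    \<open>K * (m * (n * e + 1)) ^ r\<close>, which bounds \<open>K * (D + 1) ^ r\<close>.\<close>
  define m where "m = K * (n * e + 1) ^ r + 1"
  define D where "D = n * (m * e)"
  from spec[OF K, of D] obtain M u where fin: "finite M" and u: "u \<in> pf UNIV - P" and
    red: "\<forall>F. pdeg UNIV D F \<longrightarrow> (\<exists>v\<in>fvs.span M. (\<lambda>x. u x * F x - v x) \<in> P)" and
    cardM: "card M \<le> K * (D + 1) ^ r" unfolding spans_def by (elim exE conjE) (rule that)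
  let ?B = "PiE {..<n} (\<lambda>_. {..<m})"
  define mon where "mon = (\<lambda>\<alpha> x. \<Prod>j<n. y' j x ^ \<alpha> j)"
  have deg: "pdeg UNIV D (mon \<alpha>)" if "\<alpha> \<in> ?B" for \<alpha>
  proof -
    have "pdeg UNIV (\<Sum>j<n. \<alpha> j * e) (mon \<alpha>)" unfolding mon_def
      by (intro pdeg_prod pdeg_power) (use e in auto)
    moreover have "(\<Sum>j<n. \<alpha> j * e) \<le> (\<Sum>j<n. m * e)"
      using that by (intro sum_mono mult_right_mono) (auto simp: PiE_def Pi_def intro: less_imp_le)
    ultimately show ?thesis unfolding D_def by (elim pdeg_mono) simp_all
  qed
  have "\<forall>\<alpha>. \<exists>v. \<alpha> \<in> ?B \<longrightarrow> v \<in> fvs.span M \<and> (\<lambda>x. u x * mon \<alpha> x - v x) \<in> P" using red deg by blast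
  from choice[OF this] obtain s where s: "\<forall>\<alpha>. \<alpha> \<in> ?B \<longrightarrow> s \<alpha> \<in> fvs.span M \<and> (\<lambda>x. u x * mon \<alpha> x - s \<alpha> x) \<in> P" ..
  have finB: "finite ?B" by (intro finite_PiE) simp_all
  have "card ?B \<le> card M"
  proof (rule family_card_le[of _ _ s])
    \<comment> \<open>A linear dependence among the reduced functions puts \<open>u\<close> times a
      combination of monomials into \<open>P\<close>; primality removes \<open>u\<close>, and
      independence of the \<open>y j\<close> kills the combination.\<close>
    fix c assume c: "\<And>x. (\<Sum>\<alpha>\<in>?B. c \<alpha> * s \<alpha> x) = 0"
    have "(\<lambda>x. \<Sum>\<alpha>\<in>?B. c \<alpha> * (u x * mon \<alpha> x - s \<alpha> x)) \<in> P"
      by (intro sum_mem mult) (use s in auto)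
    also have "(\<lambda>x. \<Sum>\<alpha>\<in>?B. c \<alpha> * (u x * mon \<alpha> x - s \<alpha> x)) = (\<lambda>x. u x * (\<Sum>\<alpha>\<in>?B. c \<alpha> * mon \<alpha> x))"
      by (rule ext) (simp add: right_diff_distrib sum_subtractf c sum_distrib_left mult.left_commute)
    finally have "(\<lambda>x. u x * (\<Sum>\<alpha>\<in>?B. c \<alpha> * mon \<alpha> x)) \<in> P" .
    moreover have monpf: "(\<lambda>x. \<Sum>\<alpha>\<in>?B. c \<alpha> * mon \<alpha> x) \<in> pf UNIV"
    proof (rule pf_sum)
      fix \<alpha> assume "\<alpha> \<in> ?B"
      from pfI[OF deg[OF this]] show "(\<lambda>x. c \<alpha> * mon \<alpha> x) \<in> pf UNIV" by (rule pf_mult[OF pf_const])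
    qed
    ultimately have mem: "(\<lambda>x. \<Sum>\<alpha>\<in>?B. c \<alpha> * mon \<alpha> x) \<in> P"
      using prime[of u "\<lambda>x. \<Sum>\<alpha>\<in>?B. c \<alpha> * mon \<alpha> x"] u by blast
    define q :: "(nat \<Rightarrow> 'k) \<Rightarrow> 'k" where "q = (\<lambda>z. \<Sum>\<alpha>\<in>?B. c \<alpha> * (\<Prod>j<n. z j ^ \<alpha> j))"
    have q: "q \<in> pf {..<n}" unfolding q_def
      by (intro pf_sum pf_mult pf_prod pf_power pf_coord pf_const)
    have "(\<lambda>x. q (\<lambda>j. y j x)) = (\<lambda>x. \<Sum>\<alpha>\<in>?B. c \<alpha> * mon \<alpha> x)"
      unfolding q_def mon_def y'_def by (intro ext sum.cong refl arg_cong2[where f = "(*)"] prod.cong) auto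
    with mem q assms(2) have "q = (\<lambda>_. 0)" unfolding alg_ind_def by metis
    then have "(\<Sum>\<alpha>\<in>?B. c \<alpha> * (\<Prod>j<n. z j ^ \<alpha> j)) = 0" for z
      unfolding q_def by (rule fun_cong)
    from box_monomials_independent[OF this] show "\<forall>\<alpha>\<in>?B. c \<alpha> = 0" by blast
  qed (use finB fin s in auto)
  then have "m ^ n \<le> K * (D + 1) ^ r" using cardM by (simp add: card_PiE)
  moreover have "m * m ^ r \<le> m ^ n" using power_increasing[OF rn, of m] by (simp add: m_def)
  moreover have "D + 1 \<le> m * (n * e + 1)" unfolding D_def m_def by (simp add: algebra_simps)
  then have "K * (D + 1) ^ r \<le> K * (m * (n * e + 1)) ^ r" by (intro mult_left_mono power_mono) simp_all
  ultimately have "m * m ^ r \<le> (K * (n * e + 1) ^ r) * m ^ r"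
    unfolding power_mult_distrib by (simp only: mult_ac) 
  then show False by (simp add: m_def)
qed

section \<open>Independent coordinates relative to a set of coordinates\<close>

lemma free_mono:
  assumes "free S i" "S' \<subseteq> S"
  shows "free S' i"
  unfolding free_def
proof (rule allI, rule allI, rule impI, rule impI)
  fix L a assume a: "\<forall>j. a j \<in> pf S'" and mem: "(\<lambda>x. \<Sum>j<L. a j x * x i ^ j) \<in> P"
  have "\<forall>j. a j \<in> pf S" by (rule allI, rule pf_mono[OF spec[OF a] assms(2)])
  with assms(1) mem show "\<forall>j<L. a j \<in> P" unfolding free_def by simp
qed

text \<open>A set of coordinates algebraically independent over those in \<open>S\<close>, presented
  by an order in which each is transcendental over \<open>S\<close> and its predecessors.\<close>

inductive rel_free :: "'i set \<Rightarrow> 'i set \<Rightarrow> bool" for S where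
  empty: "rel_free S {}"
| insert: "rel_free S A \<Longrightarrow> i \<notin> S \<union> A \<Longrightarrow> free (S \<union> A) i \<Longrightarrow> rel_free S (insert i A)"

text \<open>
  \<open>zero_locus (P \<inter> pf S)\<close> is the cylinder over the closure of the projection of \<open>zero_locus P\<close> to
  the coordinates in \<open>S\<close>.
\<close>
lemma rel_free_zero_locus:
  assumes "rel_free S A" "x \<in> zero_locus (P \<inter> pf S)" "\<And>i. i \<in> S \<Longrightarrow> y i = x i"
  shows "y \<in> zero_locus (P \<inter> pf (S \<union> A))"
  using assms(1)
proof induction
  case empty
  have "f y = 0" if "f \<in> P" "f \<in> pf S" for f
  proof -
    have "f y = f x" by (rule pf_cong[OF that(2) assms(3)])
    then show ?thesis using assms(2) that by (simp add: zero_locus_def)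
  qed
  then show ?case by (simp add: zero_locus_def)
next
  case (insert A i)
  have "f y = 0" if f: "f \<in> P" "f \<in> pf (insert i (S \<union> A))" for f
    using extend_free[OF insert.hyps(3,2) _ f, of y "y i"] insert.IH by (simp add: zero_locus_def)
  then show ?case by (simp add: zero_locus_def)
qed

text \<open>A greedy choice. Each new coordinate is tested against all coordinates treated before,
  not only the selected ones: if it is free over them, it is also free over the smaller set
  \<open>S \<union> A\<close>; if not, a relation over them leaves the growth exponent
  unchanged.\<close>

lemma generic_coordinates:
  assumes "finite K" "K \<inter> S = {}" "grow S r"
  shows "\<exists>A\<subseteq>K. rel_free S A \<and> grow (S \<union> K) (r + card A)"
  using assms
proof (induction K)
  case empty
  then show ?case using rel_free.empty by auto
next
  case (insert i K)
  then obtain A where A: "A \<subseteq> K" "rel_free S A" "grow (S \<union> K) (r + card A)" by auto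
  have fin: "finite A" "i \<notin> A" using A insert finite_subset by blast+
  show ?case
  proof (cases "free (S \<union> K) i")
    case True
    have "free (S \<union> A) i" using free_mono[OF True] A(1) by blast
    then have "rel_free S (insert i A)"
      using A insert by (intro rel_free.insert) auto
    moreover have "grow (S \<union> insert i K) (r + card (insert i A))"
      using grow_insert[OF A(3), of i] fin by simp
    ultimately show ?thesis using A(1) by (intro exI[of _ "insert i A"]) auto
  next
    case False
    then obtain d p where "relation (S \<union> K) i d p" by (rule minimal_relation) (rule that)
    from grow_relation[OF A(3) this] show ?thesis using A by (intro exI[of _ A]) auto
  qed
qed

section \<open>Lifting points along coordinate projections\<close>

lemma extension:
  assumes "finite K" "K \<inter> S = {}" "g \<in> pf (S \<union> K) - P"
  shows "\<exists>h\<in>pf S - P. \<forall>x\<in>zero_locus (P \<inter> pf S). h x \<noteq> 0 \<longrightarrow>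
    (\<exists>y\<in>zero_locus (P \<inter> pf (S \<union> K)). (\<forall>i\<in>S. y i = x i) \<and> g y \<noteq> 0)"
  using assms
proof (induction K arbitrary: g)
  case empty
  then show ?case by (intro bexI[of _ g]) auto
next
  case (insert i K)
  have i: "i \<notin> S \<union> K" using insert by auto
  \<comment> \<open>The coordinate \<open>i\<close> is lifted last, so its condition
    \<open>h1\<close> becomes the function that the induction hypothesis has to keep
    nonzero.\<close>
  have "\<exists>h\<in>pf (S \<union> K) - P. \<forall>x. (\<forall>f\<in>P \<inter> pf (S \<union> K). f x = 0) \<longrightarrow> h x \<noteq> 0 \<longrightarrow>
    (\<exists>t. g (x(i := t)) \<noteq> 0 \<and> (\<forall>f\<in>P \<inter> pf (insert i (S \<union> K)). f (x(i := t)) = 0))"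
    by (rule extend_one[OF i]) (use insert.prems in auto)
  then obtain h1 where h1: "h1 \<in> pf (S \<union> K) - P" and ext1: "\<And>x. (\<forall>f\<in>P \<inter> pf (S \<union> K). f x = 0) \<Longrightarrow> h1 x \<noteq> 0 \<Longrightarrow>
    (\<exists>t. g (x(i := t)) \<noteq> 0 \<and> (\<forall>f\<in>P \<inter> pf (insert i (S \<union> K)). f (x(i := t)) = 0))" by blast
  have "K \<inter> S = {}" using insert by blast
  from insert.IH[OF this h1] obtain h where h: "h \<in> pf S - P" and ext: "\<And>x. x \<in> zero_locus (P \<inter> pf S) \<Longrightarrow> h x \<noteq> 0 \<Longrightarrow>
    (\<exists>y\<in>zero_locus (P \<inter> pf (S \<union> K)). (\<forall>i\<in>S. y i = x i) \<and> h1 y \<noteq> 0)" by blast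
  show ?case
  proof (intro bexI[OF _ h] ballI impI)
    fix x assume "x \<in> zero_locus (P \<inter> pf S)" "h x \<noteq> 0"
    from ext[OF this] obtain y where y: "y \<in> zero_locus (P \<inter> pf (S \<union> K))" "\<forall>i\<in>S. y i = x i" "h1 y \<noteq> 0" by blast
    from ext1[of y] y obtain t where "g (y(i := t)) \<noteq> 0" "\<forall>f\<in>P \<inter> pf (insert i (S \<union> K)). f (y(i := t)) = 0"
      unfolding zero_locus_def by blast
    then show "\<exists>y\<in>zero_locus (P \<inter> pf (S \<union> insert i K)). (\<forall>i\<in>S. y i = x i) \<and> g y \<noteq> 0"
      using i y(2) by (intro bexI[of _ "y(i := t)"]) (auto simp: zero_locus_def)
  qed
qed

lemma extension_UNIV:
  assumes "finite (- S)" "g \<in> pf UNIV - P"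
  shows "\<exists>h\<in>pf S - P. \<forall>x\<in>zero_locus (P \<inter> pf S). h x \<noteq> 0 \<longrightarrow>
    (\<exists>y\<in>zero_locus P. (\<forall>i\<in>S. y i = x i) \<and> g y \<noteq> 0)"
proof -
  have "P \<inter> pf UNIV = P" using sub by blast
  then show ?thesis using extension[of "- S" S g] assms by simp
qed

section \<open>Zeros and generic equations of prime ideals\<close>

lemma const_mem: "f \<in> P \<Longrightarrow> f \<in> pf {} \<Longrightarrow> f x = 0"
proof (rule ccontr)
  assume f: "f \<in> P" "f \<in> pf {}" "f x \<noteq> 0"
  have "f y = f x" for y by (rule pf_cong[OF f(2)]) simp
  from this[symmetric] have "inverse (f x) * f y = 1" for y using f(3) by (metis left_inverse)
  with mult[OF pf_const f(1), of "inverse (f x)"] one show False by simp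
qed

text \<open>The case \<open>S = {}\<close> of the extension: \<open>P\<close> contains no nonzero
  constant, so every point satisfies its constant equations, and \<open>h\<close> is a nonzero
  constant.\<close>

lemma nullstellensatz:
  assumes "finite (UNIV :: 'i set)" "g \<in> pf UNIV - P"
  obtains y where "y \<in> zero_locus P" "g y \<noteq> 0"
proof -
  obtain h where h: "h \<in> pf {} - P" and ext: "\<forall>x\<in>zero_locus (P \<inter> pf {}). h x \<noteq> 0 \<longrightarrow> (\<exists>y\<in>zero_locus P. g y \<noteq> 0)"
    using extension_UNIV[of "{}" g] assms by auto
  have "h (\<lambda>_. 0) \<noteq> 0"
  proof
    assume "h (\<lambda>_. 0) = 0"
    then have "h = (\<lambda>_. 0)" using pf_empty[of h] h by simp
    then show False using h zero by simp
  qed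
  moreover have "(\<lambda>_. 0) \<in> zero_locus (P \<inter> pf {})" using const_mem by (simp add: zero_locus_def)
  ultimately show ?thesis using ext that by blast
qed

text \<open>Adding one coordinate at a time, a free coordinate contributes no equation and any other
  contributes a minimal relation, which suffices where its leading coefficient is nonzero;
  \<open>q\<close> collects these leading coefficients.\<close>

lemma generically_finitely_generated:
  assumes "finite K"
  shows "\<exists>B q. finite B \<and> B \<subseteq> P \<and> q \<in> pf UNIV - P \<and>
    (\<forall>x\<in>zero_locus B. q x \<noteq> 0 \<longrightarrow> x \<in> zero_locus (P \<inter> pf K))"
  using assms
proof (induction K)
  case empty
  then show ?case
    by (intro exI[of _ "{}"] exI[of _ "\<lambda>_. 1"]) (use one const_mem in \<open>auto simp: zero_locus_def\<close>)
next
  case (insert i K)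
  then obtain B q where B: "finite B" "B \<subseteq> P" "q \<in> pf UNIV - P"
    and Bq: "\<And>x. x \<in> zero_locus B \<Longrightarrow> q x \<noteq> 0 \<Longrightarrow> x \<in> zero_locus (P \<inter> pf K)" by blast
  show ?case
  proof (cases "free K i")
    case True
    have "x \<in> zero_locus (P \<inter> pf (insert i K))" if "x \<in> zero_locus B" "q x \<noteq> 0" for x
      using extend_free[OF True insert(2), of x _ "x i"] Bq[OF that] by (simp add: zero_locus_def)
    then show ?thesis using B by (intro exI[of _ B] exI[of _ q]) simp
  next
    case False
    then obtain d p where rel: "relation K i d p" and d: "0 < d" and
      min: "\<And>b. (\<And>j. b j \<in> pf K) \<Longrightarrow> (\<lambda>x. \<Sum>j<d. b j x * x i ^ j) \<in> P \<Longrightarrow> \<forall>j<d. b j \<in> P"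
      by (rule minimal_relation) blast
    let ?R = "\<lambda>x. \<Sum>j\<le>d. p j x * x i ^ j"
    have p: "p d \<in> pf UNIV" "p d \<notin> P" "?R \<in> P" using rel pf_UNIV unfolding relation_def by auto
    have "x \<in> zero_locus (P \<inter> pf (insert i K))" if "x \<in> zero_locus (insert ?R B)" "q x * p d x \<noteq> 0" for x
    proof -
      have "x \<in> zero_locus B" "q x \<noteq> 0" "p d x \<noteq> 0" "?R x = 0" using that by (simp_all add: zero_locus_def)
      then have van: "f x = 0" if "f \<in> P" "f \<in> pf K" for f
        using Bq[of x] that by (simp add: zero_locus_def)
      have "f x = 0" if f: "f \<in> P" "f \<in> pf (insert i K)" for f
        by (rule relation_eliminates[OF rel min f van]) (assumption | fact)+
      then show ?thesis by (simp add: zero_locus_def)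
    qed
    moreover have "(\<lambda>x. q x * p d x) \<in> pf UNIV - P"
      using not_mem_mult pf_mult B(3) p by blast
    ultimately show ?thesis using B p(3)
      by (intro exI[of _ "insert ?R B"] exI[of _ "\<lambda>x. q x * p d x"]) simp
  qed
qed

end

text \<open>Krull's lemma: an ideal that is maximal among those containing \<open>J\<close> and
  avoiding the multiplicative set \<open>M\<close> is prime. It later extracts irreducible sets from
  sets that may be reducible.\<close>

lemma exists_prime:
  fixes J M :: "(('i \<Rightarrow> 'k::alg_closed_field) \<Rightarrow> 'k) set"
  assumes J: "J \<subseteq> pf UNIV" "(\<lambda>_. 0) \<in> J" "\<And>p q. p \<in> J \<Longrightarrow> q \<in> J \<Longrightarrow> (\<lambda>x. p x + q x) \<in> J"
      "\<And>p q. p \<in> pf UNIV \<Longrightarrow> q \<in> J \<Longrightarrow> (\<lambda>x. p x * q x) \<in> J"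
    and M: "(\<lambda>_. 1) \<in> M" "\<And>p q. p \<in> M \<Longrightarrow> q \<in> M \<Longrightarrow> (\<lambda>x. p x * q x) \<in> M"
    and disj: "J \<inter> M = {}"
  obtains P where "pf_prime P" "J \<subseteq> P" "P \<inter> M = {}"
proof -
  define ideal where "ideal = (\<lambda>I :: (('i \<Rightarrow> 'k) \<Rightarrow> 'k) set. I \<subseteq> pf UNIV \<and> (\<lambda>_. 0) \<in> I \<and>
    (\<forall>p\<in>I. \<forall>q\<in>I. (\<lambda>x. p x + q x) \<in> I) \<and> (\<forall>p\<in>pf UNIV. \<forall>q\<in>I. (\<lambda>x. p x * q x) \<in> I))"
  let ?\<A> = "{I. ideal I \<and> J \<subseteq> I \<and> I \<inter> M = {}}"
  have "\<exists>P\<in>?\<A>. \<forall>X\<in>?\<A>. P \<subseteq> X \<longrightarrow> X = P"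
  proof (rule subset_Zorn_nonempty)
    have "ideal J" unfolding ideal_def using J by blast
    then show "?\<A> \<noteq> {}" using disj by blast
  next
    fix \<C> assume "\<C> \<noteq> {}" and C: "subset.chain ?\<A> \<C>"
    then obtain I where I: "I \<in> \<C>" by blast
    have sub: "\<And>I. I \<in> \<C> \<Longrightarrow> ideal I \<and> J \<subseteq> I \<and> I \<inter> M = {}" using C unfolding subset.chain_def by blast
    have total: "\<And>X Y. X \<in> \<C> \<Longrightarrow> Y \<in> \<C> \<Longrightarrow> X \<subseteq> Y \<or> Y \<subseteq> X"
      using C unfolding subset.chain_def by blast
    have "(\<lambda>x. p x + q x) \<in> \<Union>\<C>" if pq: "p \<in> \<Union>\<C>" "q \<in> \<Union>\<C>" for p q
    proof -
      obtain I1 I2 where I12: "I1 \<in> \<C>" "p \<in> I1" "I2 \<in> \<C>" "q \<in> I2" using pq by blast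
      have "I1 \<subseteq> I2 \<or> I2 \<subseteq> I1" by (rule total[OF I12(1,3)])
      with I12 obtain I where "I \<in> \<C>" "p \<in> I" "q \<in> I" by blast
      then show ?thesis using sub[of I] unfolding ideal_def by blast
    qed
    moreover have "(\<lambda>x. p x * q x) \<in> \<Union>\<C>" if "p \<in> pf UNIV" "q \<in> \<Union>\<C>" for p q
      using that sub unfolding ideal_def by blast
    moreover have "\<Union>\<C> \<subseteq> pf UNIV" "(\<lambda>_. 0) \<in> \<Union>\<C>" using sub I unfolding ideal_def by blast+
    ultimately have "ideal (\<Union>\<C>)" unfolding ideal_def by simp
    then show "\<Union>\<C> \<in> ?\<A>" using sub I by blast
  qed
  then obtain P where PA: "P \<in> ?\<A>" and maxA: "\<forall>X\<in>?\<A>. P \<subseteq> X \<longrightarrow> X = P" by (rule bexE)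
  have P: "ideal P" "J \<subseteq> P" "P \<inter> M = {}" using PA by simp_all
  have max: "X = P" if "ideal X" "P \<subseteq> X" "X \<inter> M = {}" for X
    using bspec[OF maxA, of X] that P(2) by simp
  have Psub: "\<And>p. p \<in> P \<Longrightarrow> p \<in> pf UNIV" and P0: "(\<lambda>_. 0) \<in> P"
    and Padd: "\<And>p q. p \<in> P \<Longrightarrow> q \<in> P \<Longrightarrow> (\<lambda>x. p x + q x) \<in> P"
    and Pmult: "\<And>p q. p \<in> pf UNIV \<Longrightarrow> q \<in> P \<Longrightarrow> (\<lambda>x. p x * q x) \<in> P"
    using P(1) unfolding ideal_def by (simp_all add: subset_iff)
  \<comment> \<open>By maximality the ideal generated by \<open>P\<close> and \<open>p\<close> meets
    \<open>M\<close>.\<close>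
  have meets: "\<exists>s a. s \<in> P \<and> a \<in> pf UNIV \<and> (\<lambda>x. s x + a x * p x) \<in> M" if p: "p \<in> pf UNIV" "p \<notin> P" for p
  proof -
    let ?X = "{\<lambda>x. s x + a x * p x | s a. s \<in> P \<and> a \<in> pf UNIV}"
    have sub: "P \<subseteq> ?X"
    proof
      fix s assume "s \<in> P"
      then show "s \<in> ?X" by (intro CollectI exI[of _ s] exI[of _ "\<lambda>_. 0"]) simp
    qed
    have idX: "ideal ?X" unfolding ideal_def
    proof (intro conjI ballI)
      show "?X \<subseteq> pf UNIV"
      proof
        fix f assume "f \<in> ?X"
        then obtain s a where "f = (\<lambda>x. s x + a x * p x)" "s \<in> P" "a \<in> pf UNIV" by blast
        then show "f \<in> pf UNIV" by (simp add: pf_add pf_mult p Psub)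
      qed
      show "(\<lambda>_. 0) \<in> ?X" using sub P0 by blast
      fix f g :: "('i \<Rightarrow> 'k) \<Rightarrow> 'k" assume g: "g \<in> ?X"
      then obtain s a where s: "g = (\<lambda>x. s x + a x * p x)" "s \<in> P" "a \<in> pf UNIV" by blast
      { assume "f \<in> ?X"
        then obtain s' a' where s': "f = (\<lambda>x. s' x + a' x * p x)" "s' \<in> P" "a' \<in> pf UNIV" by blast
        have "(\<lambda>x. f x + g x) = (\<lambda>x. (s' x + s x) + (a' x + a x) * p x)"
          unfolding s s' by (simp add: algebra_simps)
        then show "(\<lambda>x. f x + g x) \<in> ?X"
          by (intro CollectI exI[of _ "\<lambda>x. s' x + s x"] exI[of _ "\<lambda>x. a' x + a x"])
            (simp add: Padd[OF s'(2) s(2)] pf_add[OF s'(3) s(3)]) }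
      { assume f: "f \<in> pf UNIV"
        have "(\<lambda>x. f x * g x) = (\<lambda>x. (f x * s x) + (f x * a x) * p x)"
          unfolding s by (simp add: algebra_simps)
        then show "(\<lambda>x. f x * g x) \<in> ?X"
          by (intro CollectI exI[of _ "\<lambda>x. f x * s x"] exI[of _ "\<lambda>x. f x * a x"])
            (simp add: Pmult[OF f s(2)] pf_mult[OF f s(3)]) }
    qed
    have pX: "p \<in> ?X"
      by (intro CollectI exI[of _ "\<lambda>_. 0"] exI[of _ "\<lambda>_. 1"]) (simp add: P0)
    have "?X \<inter> M \<noteq> {}"
    proof
      assume "?X \<inter> M = {}"
      from max[OF idX sub this] pX p(2) show False by simp
    qed
    then obtain m where "m \<in> ?X" and m: "m \<in> M" by blast
    then obtain s a where "m = (\<lambda>x. s x + a x * p x)" "s \<in> P" "a \<in> pf UNIV"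
      by (elim CollectE exE conjE) (rule that)
    with m show ?thesis by (intro exI[of _ s] exI[of _ a]) simp
  qed
  have "pf_prime P"
  proof
    fix p q :: "('i \<Rightarrow> 'k) \<Rightarrow> 'k"
    assume p: "p \<in> pf UNIV" and q: "q \<in> pf UNIV" and pq: "(\<lambda>x. p x * q x) \<in> P"
    show "p \<in> P \<or> q \<in> P"
    proof (rule ccontr)
      assume "\<not> ?thesis"
      then obtain s a s' a' where s: "s \<in> P" "a \<in> pf UNIV" "(\<lambda>x. s x + a x * p x) \<in> M"
        and s': "s' \<in> P" "a' \<in> pf UNIV" "(\<lambda>x. s' x + a' x * q x) \<in> M"
        using meets[OF p] meets[OF q] by blast
      have "(\<lambda>x. (s x + a x * p x) * (s' x + a' x * q x)) \<in> M"
        by (rule M(2)[OF s(3) s'(3)])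
      \<comment> \<open>Each summand of the expanded product has a factor \<open>s\<close>,
        \<open>s'\<close> or \<open>p * q\<close> from \<open>P\<close>.\<close>
      moreover have "(\<lambda>x. (s x + a x * p x) * s' x + ((a' x * q x) * s x + (a x * a' x) * (p x * q x))) \<in> P"
        by (intro Padd Pmult pf_add pf_mult Psub s s' p q pq)
      then have "(\<lambda>x. (s x + a x * p x) * (s' x + a' x * q x)) \<in> P" by (simp add: algebra_simps)
      ultimately show False using P(3) by blast
    qed
  next
    show "(\<lambda>_. 1) \<notin> P" using M(1) P(3) by blast
  qed (use Psub P0 Padd Pmult in auto)
  then show ?thesis using that P by blast
qed

section \<open>Irreducible sets, chains and generic fibres\<close>

definition vanishing :: "('i \<Rightarrow> 'k::comm_ring_1) set \<Rightarrow> (('i \<Rightarrow> 'k) \<Rightarrow> 'k) set" where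
  "vanishing W = {f \<in> pf UNIV. \<forall>w\<in>W. f w = 0}"

text \<open>Primality of \<open>vanishing W\<close>, expressed through values. It applies equally to
  sets that are not closed, such as images of regular maps.\<close>

definition irr :: "('i \<Rightarrow> 'k::comm_ring_1) set \<Rightarrow> bool" where
  "irr W \<longleftrightarrow> W \<noteq> {} \<and> (\<forall>f\<in>pf UNIV. \<forall>g\<in>pf UNIV. (\<forall>x\<in>W. f x * g x = 0) \<longrightarrow>
     (\<forall>x\<in>W. f x = 0) \<or> (\<forall>x\<in>W. g x = 0))"

lemma irrD:
  "irr W \<Longrightarrow> f \<in> pf UNIV \<Longrightarrow> g \<in> pf UNIV \<Longrightarrow> (\<And>x. x \<in> W \<Longrightarrow> f x * g x = 0) \<Longrightarrow>
    (\<forall>x\<in>W. f x = 0) \<or> (\<forall>x\<in>W. g x = 0)"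
  unfolding irr_def by blast

lemma closedin_subtopology_zariski:
  "closedin (subtopology zariski W) A \<longleftrightarrow> (\<exists>P\<subseteq>pf UNIV. A = W \<inter> zero_locus P)"
  unfolding closedin_subtopology closedin_zariski poly_functions_eq_pf by blast

lemma irreducible_space_zariski:
  fixes W :: "('i \<Rightarrow> 'k::field) set"
  shows "irreducible_space (subtopology zariski W) \<longleftrightarrow> irr W"
proof
  assume L: "irreducible_space (subtopology zariski W)"
  show "irr W" unfolding irr_def
  proof (intro conjI ballI impI)
    show "W \<noteq> {}" using L unfolding irreducible_space_def by simp
    fix f g :: "('i \<Rightarrow> 'k) \<Rightarrow> 'k"
    assume f: "f \<in> pf UNIV" and g: "g \<in> pf UNIV" and fg: "\<forall>x\<in>W. f x * g x = 0"
    have "closedin (subtopology zariski W) (W \<inter> zero_locus {f})" "closedin (subtopology zariski W) (W \<inter> zero_locus {g})"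
      unfolding closedin_subtopology_zariski using f g by blast+
    moreover have "W \<inter> zero_locus {f} \<union> W \<inter> zero_locus {g} = W"
      using fg by (auto simp: zero_locus_def)
    ultimately have "W \<inter> zero_locus {f} = W \<or> W \<inter> zero_locus {g} = W"
      using L unfolding irreducible_space_def by simp
    then show "(\<forall>x\<in>W. f x = 0) \<or> (\<forall>x\<in>W. g x = 0)" by (auto simp: zero_locus_def)
  qed
next
  assume R: "irr W"
  show "irreducible_space (subtopology zariski W)" unfolding irreducible_space_def
  proof (intro conjI allI impI)
    show "topspace (subtopology zariski W) \<noteq> {}" using R unfolding irr_def by simp
    fix A B assume A: "closedin (subtopology zariski W) A" and B: "closedin (subtopology zariski W) B"
      and AB: "A \<union> B = topspace (subtopology zariski W)"
    obtain PA PB where PA: "PA \<subseteq> pf UNIV" "A = W \<inter> zero_locus PA" and PB: "PB \<subseteq> pf UNIV" "B = W \<inter> zero_locus PB"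
      using A B unfolding closedin_subtopology_zariski by blast
    show "A = topspace (subtopology zariski W) \<or> B = topspace (subtopology zariski W)"
    proof (rule ccontr)
      assume "\<not> ?thesis"
      then obtain a b where a: "a \<in> W" "a \<notin> A" and b: "b \<in> W" "b \<notin> B" using AB by auto
      obtain f where f: "f \<in> PA" "f a \<noteq> 0" using a PA(2) by (auto simp: zero_locus_def)
      obtain g where g: "g \<in> PB" "g b \<noteq> 0" using b PB(2) by (auto simp: zero_locus_def)
      have "f x * g x = 0" if "x \<in> W" for x
        using that AB PA(2) PB(2) f(1) g(1) by (auto simp: zero_locus_def)
      with irrD[OF R, of f g] f g a b PA(1) PB(1) show False by blast
    qed
  qed
qed

lemma irreducible_subset_zariski: "irreducible_subset (subtopology zariski W) S \<longleftrightarrow> S \<subseteq> W \<and> irr S"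
proof -
  have "S \<subseteq> W \<Longrightarrow> W \<inter> S = S" by blast
  then show ?thesis
    unfolding irreducible_subset_def subtopology_subtopology
    by (auto simp: irreducible_space_zariski)
qed

lemma irr_pf_prime:
  fixes W :: "('i \<Rightarrow> 'k::alg_closed_field) set"
  assumes "irr W"
  shows "pf_prime (vanishing W)"
proof
  fix p q :: "('i \<Rightarrow> 'k) \<Rightarrow> 'k"
  assume "p \<in> pf UNIV" "q \<in> pf UNIV" "(\<lambda>x. p x * q x) \<in> vanishing W"
  then show "p \<in> vanishing W \<or> q \<in> vanishing W"
    using irrD[OF assms, of p q] by (simp add: vanishing_def)
next
  show "(\<lambda>_. 1) \<notin> vanishing W" using assms by (auto simp: vanishing_def irr_def)
qed (auto simp: vanishing_def pf_add pf_mult)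

lemma zero_locus_vanishing:
  assumes "P \<subseteq> pf UNIV"
  shows "zero_locus (vanishing (zero_locus P)) = zero_locus P"
  using assms by (auto simp: zero_locus_def vanishing_def)

lemma closedin_zariski_vanishing:
  "closedin zariski W \<longleftrightarrow> zero_locus (vanishing W) = W"
proof
  assume "closedin zariski W"
  then show "zero_locus (vanishing W) = W"
    unfolding closedin_zariski poly_functions_eq_pf using zero_locus_vanishing by metis
next
  assume "zero_locus (vanishing W) = W"
  moreover have "vanishing W \<subseteq> pf UNIV" unfolding vanishing_def by blast
  ultimately show "closedin zariski W"
    unfolding closedin_zariski poly_functions_eq_pf by metis
qed

text \<open>On the line through \<open>a\<close> and \<open>b\<close> both functions become nonzero
  polynomials in one variable, and an infinite field has a point that is a root of neither.\<close>

lemma pf_nonzero_common: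
  fixes f g :: "('i \<Rightarrow> 'k::alg_closed_field) \<Rightarrow> 'k"
  assumes "f \<in> pf S" "g \<in> pf T" "f a \<noteq> 0" "g b \<noteq> 0"
  obtains x where "f x \<noteq> 0" "g x \<noteq> 0"
proof -
  define l where "l = (\<lambda>t i. a i + t * (b i - a i))"
  have line: "\<exists>p. \<forall>t. f (l t) = poly p t" if "f \<in> pf S" for f S
    using that
  proof (induction rule: pf_induct)
    case (const c) show ?case by (rule exI[of _ "[:c:]"]) simp
  next
    case (coord i) show ?case by (rule exI[of _ "[:a i, b i - a i:]"]) (simp add: l_def)
  next
    case (add p q)
    then obtain u v where "\<forall>t. p (l t) = poly u t" "\<forall>t. q (l t) = poly v t" by (elim exE)
    then show ?case by (intro exI[of _ "u + v"]) simp
  next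
    case (mult p q)
    then obtain u v where "\<forall>t. p (l t) = poly u t" "\<forall>t. q (l t) = poly v t" by (elim exE)
    then show ?case by (intro exI[of _ "u * v"]) simp
  qed
  obtain u where u: "\<forall>t. f (l t) = poly u t" using line[OF assms(1)] ..
  obtain v where v: "\<forall>t. g (l t) = poly v t" using line[OF assms(2)] ..
  have "l 0 = a" "l 1 = b" by (auto simp: l_def)
  then have "poly u 0 \<noteq> 0" "poly v 1 \<noteq> 0" using u v assms by metis+
  then have "u * v \<noteq> 0" by auto
  then have "finite {t. poly (u * v) t = 0}" by (rule poly_roots_finite)
  then have "{t. poly (u * v) t = 0} \<noteq> UNIV" using infinite_alg_closed[where 'k = 'k] by metis
  then obtain t where "poly (u * v) t \<noteq> 0" by blast
  then show ?thesis using that[of "l t"] u v by simp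
qed

text \<open>For \<open>P = vanishing W\<close> this says that \<open>W\<close> projects densely to
  the coordinates in \<open>A\<close>.\<close>

definition coord_ind :: "(('i \<Rightarrow> 'k::comm_ring_1) \<Rightarrow> 'k) set \<Rightarrow> 'i set \<Rightarrow> bool" where
  "coord_ind P A \<longleftrightarrow> (\<forall>q\<in>pf A. q \<in> P \<longrightarrow> q = (\<lambda>_. 0))"

lemma coord_ind_alg_ind:
  fixes P :: "(('i \<Rightarrow> 'k::alg_closed_field) \<Rightarrow> 'k) set"
  assumes "coord_ind P A" "finite A"
  shows "\<exists>y. alg_ind P (card A) y"
proof -
  obtain e where "bij_betw e {..<card A} A"
    using ex_bij_betw_nat_finite[OF assms(2)] by (auto simp: atLeast0LessThan)
  then have e: "inj_on e {..<card A}" "e ` {..<card A} = A" by (auto simp: bij_betw_def)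
  have "q = (\<lambda>_. 0)" if q: "q \<in> pf {..<card A}" "(\<lambda>x. q (\<lambda>j. x (e j))) \<in> P" for q
  proof (rule ext)
    fix z :: "nat \<Rightarrow> 'k"
    let ?x = "\<lambda>i. z (inv_into {..<card A} e i)"
    have "(\<lambda>x. q (\<lambda>j. x (e j))) \<in> pf A"
      by (rule pf_subst[OF q(1)], rule pf_coord) (use e(2) in blast)
    then have 0: "(\<lambda>x. q (\<lambda>j. x (e j))) = (\<lambda>_. 0)" using assms(1) q(2) unfolding coord_ind_def by blast
    have "q z = q (\<lambda>j. ?x (e j))" using e(1) by (intro pf_cong[OF q(1)]) simp
    then show "q z = 0" using fun_cong[OF 0, of ?x] by simp
  qed
  then have "alg_ind P (card A) (\<lambda>j x. x (e j))"
    unfolding alg_ind_def by (simp add: pf_coord)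
  then show ?thesis by (rule exI[of "alg_ind P (card A)"])
qed

text \<open>Expand a relation modulo \<open>P\<close> in powers of \<open>f\<close>. Modulo
  \<open>Q\<close> only the constant coefficient is left, so it vanishes; then one factor
  \<open>f\<close> can be cancelled because \<open>f\<close> is outside the prime \<open>P\<close>,
  and the argument repeats.\<close>

lemma alg_ind_Suc:
  fixes P Q :: "(('i \<Rightarrow> 'k::alg_closed_field) \<Rightarrow> 'k) set"
  assumes P: "pf_prime P" and Q: "pf_prime Q" and PQ: "P \<subseteq> Q" and f: "f \<in> Q" "f \<notin> P"
    and y: "alg_ind Q n y"
  shows "alg_ind P (Suc n) (y(n := f))"
proof -
  interpret P: pf_prime P by (rule P)
  interpret Q: pf_prime Q by (rule Q)
  have fpf: "f \<in> pf UNIV" using f Q.sub by blast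
  have ypf: "\<And>j. j < n \<Longrightarrow> y j \<in> pf UNIV"
    and yind: "\<And>q. q \<in> pf {..<n} \<Longrightarrow> (\<lambda>x. q (\<lambda>j. y j x)) \<in> Q \<Longrightarrow> q = (\<lambda>_. 0)"
    using y unfolding alg_ind_def by blast+
  have apf: "(\<lambda>x. b (\<lambda>j. y j x)) \<in> pf UNIV" if "b \<in> pf {..<n}" for b
    by (rule pf_subst[OF that]) (simp add: ypf)
  have coeffs: "\<forall>j<L. a j = (\<lambda>_. 0)"
    if "\<And>j. a j \<in> pf {..<n}" "(\<lambda>x. \<Sum>j<L. a j (\<lambda>l. y l x) * f x ^ j) \<in> P" for a L
    using that
  proof (induction L arbitrary: a)
    case (Suc L)
    let ?r = "\<lambda>x. \<Sum>j<L. a (Suc j) (\<lambda>l. y l x) * f x ^ j"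
    have r: "?r \<in> pf UNIV" by (intro pf_sum pf_mult pf_power apf Suc.prems(1) fpf)
    have split: "(\<Sum>j<Suc L. a j (\<lambda>l. y l x) * f x ^ j) = a 0 (\<lambda>l. y l x) + ?r x * f x" for x
      by (subst sum.lessThan_Suc_shift) (simp add: sum_distrib_left sum_distrib_right mult_ac)
    have mem: "(\<lambda>x. a 0 (\<lambda>l. y l x) + ?r x * f x) \<in> P" using Suc.prems(2) unfolding split .
    have "(\<lambda>x. a 0 (\<lambda>l. y l x)) \<in> Q"
      by (rule Q.diff_cancel[OF subsetD[OF PQ mem] Q.mult[OF r f(1)]])
    from yind[OF Suc.prems(1) this] have a0: "a 0 = (\<lambda>_. 0)" .
    then have "(\<lambda>x. ?r x * f x) \<in> P" using mem by simp
    then have "?r \<in> P" using P.prime[OF r fpf] f(2) by blast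
    from Suc.IH[OF Suc.prems(1) this] have "\<forall>j<L. a (Suc j) = (\<lambda>_. 0)" .
    then show ?case using a0 by (auto simp: less_Suc_eq_0_disj)
  qed simp
  have "q = (\<lambda>_. 0)" if q: "q \<in> pf {..<Suc n}" "(\<lambda>x. q (\<lambda>j. (y(n := f)) j x)) \<in> P" for q
  proof -
    have "q \<in> pf (insert n {..<n})" using q(1) by (simp add: lessThan_Suc)
    then obtain a L where a: "\<And>j. a j \<in> pf {..<n}" and qeq: "q = (\<lambda>x. \<Sum>j<L. a j x * x n ^ j)"
      by (rule pf_expand) (rule that)
    have "a j (\<lambda>l. (y(n := f)) l x) = a j (\<lambda>l. y l x)" for j x
      by (rule pf_cong[OF a]) simp
    then have "(\<lambda>x. q (\<lambda>j. (y(n := f)) j x)) = (\<lambda>x. \<Sum>j<L. a j (\<lambda>l. y l x) * f x ^ j)"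
      unfolding qeq by simp
    with q(2) have "(\<lambda>x. \<Sum>j<L. a j (\<lambda>l. y l x) * f x ^ j) \<in> P" by simp
    from coeffs[OF a this] show ?thesis unfolding qeq by simp
  qed
  then show ?thesis unfolding alg_ind_def using ypf fpf by (simp add: less_Suc_eq)
qed

text \<open>Each strict inclusion supplies a function vanishing on the smaller set but not on the
  larger one.\<close>

lemma chain_alg_ind:
  fixes Z :: "nat \<Rightarrow> ('i \<Rightarrow> 'k::alg_closed_field) set"
  assumes "\<And>j. j \<le> n \<Longrightarrow> closedin zariski (Z j) \<and> irr (Z j)" "\<And>j. j < n \<Longrightarrow> Z j \<subset> Z (Suc j)"
  shows "\<exists>y. alg_ind (vanishing (Z n)) n y"
  using assms
proof (induction n)
  case 0
  have "q = (\<lambda>_. 0)" if "q \<in> pf {}" "(\<lambda>x. q (\<lambda>j. 0)) \<in> vanishing (Z 0)" for q :: "(nat \<Rightarrow> 'k) \<Rightarrow> 'k"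
    using pf_empty[OF that(1)] that(2) 0(1)[of 0] by (auto simp: vanishing_def irr_def)
  then have "alg_ind (vanishing (Z 0)) 0 (\<lambda>_ _. 0)"
    unfolding alg_ind_def by simp
  then show ?case by (rule exI[of "alg_ind (vanishing (Z 0)) 0"])
next
  case (Suc n)
  then obtain y where y: "alg_ind (vanishing (Z n)) n y" by (metis le_SucI less_SucI)
  have sub: "Z n \<subset> Z (Suc n)" and cl: "closedin zariski (Z n)" and irr: "irr (Z n)" "irr (Z (Suc n))"
    using Suc.prems by auto
  obtain w where w: "w \<in> Z (Suc n)" "w \<notin> Z n" using sub by blast
  then obtain f where f: "f \<in> vanishing (Z n)" "f w \<noteq> 0"
    using cl unfolding closedin_zariski_vanishing by (auto simp: zero_locus_def)
  have "f \<notin> vanishing (Z (Suc n))" using f w by (auto simp: vanishing_def)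
  moreover have "vanishing (Z (Suc n)) \<subseteq> vanishing (Z n)" using sub by (auto simp: vanishing_def)
  ultimately show ?case using alg_ind_Suc[OF irr_pf_prime irr_pf_prime _ f(1) _ y] irr by blast
qed

section \<open>Generic fibres of coordinate projections\<close>

context pf_prime
begin

lemma vanishing_zero_locus:
  assumes "finite (UNIV :: 'i set)"
  shows "vanishing (zero_locus P) = P"
proof (intro equalityI subsetI)
  fix f assume f: "f \<in> vanishing (zero_locus P)"
  show "f \<in> P"
  proof (rule ccontr)
    assume "f \<notin> P"
    with f obtain y where "y \<in> zero_locus P" "f y \<noteq> 0"
      using nullstellensatz[OF assms, of f] by (auto simp: vanishing_def)
    with f show False by (simp add: vanishing_def)
  qed
qed (use sub in \<open>auto simp: vanishing_def zero_locus_def\<close>)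

lemma irr_zero_locus:
  assumes "finite (UNIV :: 'i set)"
  shows "irr (zero_locus P)"
proof -
  have "(\<lambda>_. 1) \<in> pf UNIV - P" using one by simp
  then have "zero_locus P \<noteq> {}" using nullstellensatz[OF assms] by blast
  moreover have "(\<forall>x\<in>zero_locus P. f x = 0) \<or> (\<forall>x\<in>zero_locus P. g x = 0)"
    if fg: "f \<in> pf UNIV" "g \<in> pf UNIV" "\<forall>x\<in>zero_locus P. f x * g x = 0" for f g
  proof -
    have "(\<lambda>x. f x * g x) \<in> vanishing (zero_locus P)" using fg by (simp add: vanishing_def pf_mult)
    then have "f \<in> P \<or> g \<in> P" unfolding vanishing_zero_locus[OF assms] using prime fg by blast
    then show ?thesis by (auto simp: zero_locus_def)
  qed
  ultimately show ?thesis unfolding irr_def by blast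
qed

lemma closedin_zero_locus: "closedin zariski (zero_locus P)"
  unfolding closedin_zariski poly_functions_eq_pf using sub by blast

text \<open>Over a suitable \<gamma> almost all values of the coordinates in \<open>A\<close> lift
  to points of the fibre, so no nonzero polynomial in these coordinates vanishes on it. The fibre
  may be reducible; \<open>P'\<close> selects an irreducible piece still projecting densely to
  \<open>A\<close>.\<close>

lemma generic_fibre:
  assumes fin: "finite (UNIV :: 'i set)" and AJ: "A \<inter> J = {}"
    and rel: "\<And>x y. x \<in> zero_locus P \<Longrightarrow> (\<And>i. i \<in> J \<Longrightarrow> y i = x i) \<Longrightarrow> y \<in> zero_locus (P \<inter> pf (J \<union> A))"
  obtains P' \<gamma> where "pf_prime P'" "coord_ind P' A" "\<gamma> \<in> zero_locus P"
    "zero_locus P' \<subseteq> {x \<in> zero_locus P. \<forall>i\<in>J. x i = \<gamma> i}"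
proof -
  have "finite (- (J \<union> A))" using fin rev_finite_subset by blast
  moreover have "(\<lambda>_. 1) \<in> pf UNIV - P" using one by simp
  ultimately obtain h where h: "h \<in> pf (J \<union> A) - P" and
    ext: "\<And>x. x \<in> zero_locus (P \<inter> pf (J \<union> A)) \<Longrightarrow> h x \<noteq> 0 \<Longrightarrow> (\<exists>y\<in>zero_locus P. \<forall>i\<in>J \<union> A. y i = x i)"
    using extension_UNIV[of "J \<union> A" "\<lambda>_. 1"] by auto
  have hpf: "h \<in> pf UNIV - P" using h pf_UNIV by blast
  obtain \<gamma> where \<gamma>: "\<gamma> \<in> zero_locus P" "h \<gamma> \<noteq> 0" by (rule nullstellensatz[OF fin hpf])
  define F where "F = {x \<in> zero_locus P. \<forall>i\<in>J. x i = \<gamma> i}"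
  define M where "M = {m \<in> pf A. m \<noteq> (\<lambda>_::'i \<Rightarrow> 'k. 0 :: 'k)}"
  have disj: "vanishing F \<inter> M = {}"
  proof (rule ccontr)
    assume "\<not> ?thesis"
    then obtain m where m: "m \<in> pf A" "m \<noteq> (\<lambda>_. 0)" "\<forall>x\<in>F. m x = 0"
      by (auto simp: vanishing_def M_def)
    then obtain a where a: "m a \<noteq> 0" by (metis ext)
    \<comment> \<open>\<open>spec s\<close> has the coordinates of \<gamma> in \<open>J\<close> and
      those of \<open>s\<close> elsewhere. It fixes \<gamma>, and \<gamma> was chosen with
      \<open>h\<close> nonzero, so \<open>h\<close> composed with \<open>spec\<close> is not the
      zero function.\<close>
    define spec where "spec = (\<lambda>s i. if i \<in> J then \<gamma> i else s i)"
    have "(\<lambda>s :: 'i \<Rightarrow> 'k. if i \<in> J then \<gamma> i else s i) \<in> pf UNIV" for i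
      by (cases "i \<in> J") (simp_all add: pf_coord)
    then have hs: "(\<lambda>s. h (spec s)) \<in> pf UNIV"
      unfolding spec_def using hpf
      by (intro pf_subst[where f = "\<lambda>i s. if i \<in> J then \<gamma> i else s i" and p = h and S = UNIV]) simp_all
    have "spec \<gamma> = \<gamma>" by (auto simp: spec_def)
    then have "h (spec \<gamma>) \<noteq> 0" using \<gamma>(2) by simp
    with a obtain s where s: "m s \<noteq> 0" "h (spec s) \<noteq> 0"
      by (rule pf_nonzero_common[OF m(1) hs])
    have "spec s \<in> zero_locus (P \<inter> pf (J \<union> A))" by (rule rel[OF \<gamma>(1)]) (simp add: spec_def)
    from ext[OF this s(2)] obtain y where y: "y \<in> zero_locus P" "\<forall>i\<in>J \<union> A. y i = spec s i" by blast
    have "y \<in> F" unfolding F_def using y by (simp add: spec_def)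
    moreover have "m y = m s" by (rule pf_cong[OF m(1)]) (use y AJ in \<open>auto simp: spec_def\<close>)
    ultimately show False using m(3) s(1) by simp
  qed
  obtain P' where P': "pf_prime P'" "vanishing F \<subseteq> P'" "P' \<inter> M = {}"
  proof (rule exists_prime[of "vanishing F" M])
    show "(\<lambda>x. p x * q x) \<in> M" if "p \<in> M" "q \<in> M" for p q
    proof -
      have pq: "p \<in> pf A" "q \<in> pf A" using that by (auto simp: M_def)
      have "\<exists>a. p a \<noteq> 0" "\<exists>b. q b \<noteq> 0" using that unfolding M_def fun_eq_iff by simp_all
      then obtain a b where "p a \<noteq> 0" "q b \<noteq> 0" by (elim exE)
      then obtain x where "p x \<noteq> 0" "q x \<noteq> 0" by (rule pf_nonzero_common[OF pq])
      then have "(\<lambda>x. p x * q x) \<noteq> (\<lambda>_. 0)" by (metis mult_eq_0_iff)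
      then show ?thesis using pf_mult[OF pq] by (simp add: M_def)
    qed
    show "(\<lambda>_. 1) \<in> M" by (simp add: M_def fun_eq_iff)
  qed (use disj in \<open>auto simp: vanishing_def pf_add pf_mult\<close>)
  have "coord_ind P' A" using P'(3) by (auto simp: coord_ind_def M_def)
  moreover have "zero_locus P' \<subseteq> F"
  proof
    fix x assume x: "x \<in> zero_locus P'"
    have x0: "f x = 0" if "f \<in> vanishing F" for f using x P'(2) that by (auto simp: zero_locus_def)
    have "P \<subseteq> vanishing F" using sub by (auto simp: vanishing_def F_def zero_locus_def)
    then have "x \<in> zero_locus P" using x0 by (auto simp: zero_locus_def)
    moreover have "x i = \<gamma> i" if "i \<in> J" for i
    proof -
      have "(\<lambda>x. x i - \<gamma> i) \<in> vanishing F"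
        using that by (simp add: vanishing_def F_def pf_diff pf_coord)
      from x0[OF this] show ?thesis by simp
    qed
    ultimately show "x \<in> F" by (simp add: F_def)
  qed
  ultimately show ?thesis using that P'(1) \<gamma>(1) unfolding F_def by blast
qed

text \<open>Dimension of a variety against image and fibre of the projection to the coordinates
  \<open>J\<close>: \<open>A\<close> accounts for the image and \<open>B\<close> for a
  fibre.\<close>

lemma fibre_dimension:
  assumes fin: "finite (UNIV :: 'i set)" and y: "alg_ind P N y"
  obtains A B P' \<gamma> where "A \<subseteq> J" "B \<inter> J = {}" "N \<le> card A + card B" "coord_ind P A"
    "pf_prime P'" "coord_ind P' B" "\<gamma> \<in> zero_locus P" "zero_locus P' \<subseteq> {x \<in> zero_locus P. \<forall>i\<in>J. x i = \<gamma> i}"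
proof -
  have fin': "finite S" for S :: "'i set" using fin rev_finite_subset by blast
  \<comment> \<open>The coordinates in \<open>J\<close> are treated before the others, so that
    \<open>B\<close> becomes independent over all of \<open>J\<close> and not merely over
    \<open>A\<close>.\<close>
  obtain A where A: "A \<subseteq> J" "rel_free {} A" "grow J (card A)"
    using generic_coordinates[OF fin' _ grow_empty, of J] by auto
  obtain B where B: "B \<subseteq> - J" "rel_free J B" "grow UNIV (card A + card B)"
    using generic_coordinates[OF fin' _ A(3), of "- J"] by auto
  have "x \<in> zero_locus (P \<inter> pf A)" for x
    using rel_free_zero_locus[OF A(2), of x x] const_mem by (auto simp: zero_locus_def)
  then have "coord_ind P A" by (auto simp: coord_ind_def zero_locus_def fun_eq_iff)
  moreover have "B \<inter> J = {}" using B(1) by blast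
  moreover have rel: "z \<in> zero_locus (P \<inter> pf (J \<union> B))" if "x \<in> zero_locus P" "\<And>i. i \<in> J \<Longrightarrow> z i = x i" for x z
    by (rule rel_free_zero_locus[OF B(2) _ that(2)]) (use that(1) in \<open>auto simp: zero_locus_def\<close>)
  obtain P' \<gamma> where "pf_prime P'" "coord_ind P' B" "\<gamma> \<in> zero_locus P"
    "zero_locus P' \<subseteq> {x \<in> zero_locus P. \<forall>i\<in>J. x i = \<gamma> i}"
  proof (rule generic_fibre[OF fin \<open>B \<inter> J = {}\<close>])
    fix x z assume "x \<in> zero_locus P" "\<And>i. i \<in> J \<Longrightarrow> z i = x i"
    then show "z \<in> zero_locus (P \<inter> pf (J \<union> B))" by (rule rel)
  qed (rule that)
  ultimately show ?thesis using that A(1) alg_ind_le_growth[OF B(3) y] by blast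
qed

lemma alg_ind_le_card:
  assumes fin: "finite (UNIV :: 'i set)" and y: "alg_ind P N y"
  shows "N \<le> card (UNIV :: 'i set)"
proof -
  obtain A B :: "'i set" where AB: "A \<subseteq> UNIV" "B \<inter> UNIV = {}" "N \<le> card A + card B"
    by (rule fibre_dimension[OF fin y, of UNIV]) (rule that)
  then show ?thesis using card_mono[OF fin AB(1)] by simp
qed

end

text \<open>Freezing the coordinate \<open>i\<close> at a generic value leaves an irreducible set on
  which the other coordinates are still independent. It is strictly smaller, since
  \<open>x i\<close> is not constant on \<open>zero_locus P\<close>; each coordinate thus gives one
  link.\<close>

lemma coord_ind_chain:
  fixes P :: "(('i::finite \<Rightarrow> 'k::alg_closed_field) \<Rightarrow> 'k) set"
  assumes "pf_prime P" "coord_ind P A"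
  shows "\<exists>Z. Z (card A) = zero_locus P \<and> (\<forall>j\<le>card A. closedin zariski (Z j) \<and> irr (Z j)) \<and>
    (\<forall>j<card A. Z j \<subset> Z (Suc j))"
  using finite[of A] assms
proof (induction A arbitrary: P)
  case empty
  then interpret pf_prime P by simp
  show ?case
    by (rule exI[of _ "\<lambda>_. zero_locus P"]) (simp add: closedin_zero_locus irr_zero_locus)
next
  case (insert i A)
  interpret pf_prime P by fact
  have "q z = 0" if "q \<in> P" "q \<in> pf (insert i A)" for q z
  proof -
    have "q = (\<lambda>_. 0)" using insert.prems(2) that unfolding coord_ind_def by blast
    then show ?thesis by (rule fun_cong)
  qed
  then have rel: "z \<in> zero_locus (P \<inter> pf ({i} \<union> A))" for z
    by (simp add: zero_locus_def)
  have "A \<inter> {i} = {}" using insert.hyps(2) by simp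
  then obtain P' \<gamma> where P': "pf_prime P'" "coord_ind P' A" and \<gamma>: "\<gamma> \<in> zero_locus P"
    and sub': "zero_locus P' \<subseteq> {x \<in> zero_locus P. \<forall>l\<in>{i}. x l = \<gamma> l}"
    by (rule generic_fibre[OF finite]) (rule rel, rule that)
  from insert.IH[OF P'] obtain Z where Z: "Z (card A) = zero_locus P'"
    "\<forall>j\<le>card A. closedin zariski (Z j) \<and> irr (Z j)" "\<forall>j<card A. Z j \<subset> Z (Suc j)" by blast
  have "zero_locus P' \<noteq> zero_locus P"
  proof
    assume eq: "zero_locus P' = zero_locus P"
    have ipf: "(\<lambda>x::'i \<Rightarrow> 'k. x i - \<gamma> i) \<in> pf S" if "i \<in> S" for S
      using that by (simp add: pf_diff pf_coord)
    have "(\<lambda>x. x i - \<gamma> i) \<in> vanishing (zero_locus P)"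
      using sub' ipf unfolding eq[symmetric] by (auto simp: vanishing_def)
    then have "(\<lambda>x. x i - \<gamma> i) \<in> P" by (simp add: vanishing_zero_locus)
    then have "(\<lambda>x::'i \<Rightarrow> 'k. x i - \<gamma> i) = (\<lambda>_. 0)"
      using insert.prems(2) ipf[of "insert i A"] unfolding coord_ind_def by blast
    from fun_cong[OF this, of "\<lambda>_. \<gamma> i + 1"] show False by simp
  qed
  then have strict: "zero_locus P' \<subset> zero_locus P" using sub' by blast
  have card: "card (insert i A) = Suc (card A)" using insert.hyps by (rule card_insert_disjoint)
  show ?case unfolding card
    by (rule exI[of _ "Z(Suc (card A) := zero_locus P)"])
      (use Z strict in \<open>auto simp: closedin_zero_locus irr_zero_locus le_Suc_eq less_Suc_eq\<close>)
qed

section \<open>Homomorphisms onto the integers\<close>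

interpretation rat_fun: vector_space_pair "\<lambda>(c::rat) (f::'x \<Rightarrow> rat) x. c * f x" "(*) :: rat \<Rightarrow> rat \<Rightarrow> rat"
  by unfold_locales (auto simp: algebra_simps)

text \<open>By the assumption on \<open>j0\<close> the unit vector at \<open>j0\<close> lies outside
  the rational span of \<open>L\<close>, so it extends a basis of this span and a functional can
  separate them.\<close>

lemma rational_functional:
  fixes L :: "('n \<Rightarrow> int) set"
  assumes L: "(\<lambda>_. 0) \<in> L" "\<And>a b. a \<in> L \<Longrightarrow> b \<in> L \<Longrightarrow> (\<lambda>j. a j + b j) \<in> L"
    "\<And>a c. a \<in> L \<Longrightarrow> (\<lambda>j. c * a j) \<in> L"
    and j0: "\<And>d. d > 0 \<Longrightarrow> (\<lambda>j. if j = j0 then d else 0) \<notin> L"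
  obtains g :: "('n \<Rightarrow> rat) \<Rightarrow> rat" where
    "\<And>v w. g (\<lambda>j. v j + w j) = g v + g w" "\<And>c v. g (\<lambda>j. c * v j) = c * g v"
    "\<And>a. a \<in> L \<Longrightarrow> g (\<lambda>j. of_int (a j)) = 0" "g (\<lambda>j. if j = j0 then 1 else 0) = 1"
proof -
  \<comment> \<open>The rational span of \<open>L\<close>, written with one common denominator
    \<open>d\<close>.\<close>
  define S :: "('n \<Rightarrow> rat) set" where "S = {v. \<exists>d>0. \<exists>a\<in>L. \<forall>j. of_int d * v j = of_int (a j)}"
  have SI: "v \<in> S" if "d > 0" "a \<in> L" "\<And>j. of_int d * v j = of_int (a j)" for v d a
    unfolding S_def by (rule CollectI, rule exI[of _ d], rule conjI[OF that(1)], rule bexI[OF _ that(2)]) (simp add: that(3))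
  have subspace: "fvs.subspace S"
    unfolding fvs.subspace_def
  proof (intro conjI ballI allI)
    show "0 \<in> S" by (rule SI[OF zero_less_one L(1)]) simp
  next
    fix v w :: "'n \<Rightarrow> rat" assume "v \<in> S" "w \<in> S"
    then obtain d e a b where d: "d > 0" "a \<in> L" "\<And>j. of_int d * v j = of_int (a j)"
      and e: "e > 0" "b \<in> L" "\<And>j. of_int e * w j = of_int (b j)" unfolding S_def by blast
    have 1: "(\<lambda>j. e * a j + d * b j) \<in> L" by (intro L(2,3) d e)
    have 2: "of_int (d * e) * (v + w) j = of_int (e * a j + d * b j)" for j
    proof -
      have "of_int (d * e) * (v j + w j) = of_int e * (of_int d * v j) + of_int d * (of_int e * w j)"
        unfolding of_int_mult by (simp only: distrib_left mult_ac)
      then show ?thesis by (simp add: d e)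
    qed
    have "d * e > 0" using d e by simp
    from SI[OF this 1 2] show "v + w \<in> S" .
  next
    fix c and v :: "'n \<Rightarrow> rat" assume "v \<in> S"
    then obtain d a where d: "d > 0" "a \<in> L" "\<And>j. of_int d * v j = of_int (a j)" unfolding S_def by blast
    obtain p q where pq: "quotient_of c = (p, q)" by force
    then have q: "q > 0" "c = of_int p / of_int q" by (auto simp: quotient_of_denom_pos quotient_of_div)
    have 1: "of_int (q * d) * (c * v j) = of_int (p * a j)" for j
    proof -
      have "of_int (q * d) * (c * v j) = of_int p * (of_int d * v j)" using q by simp
      then show ?thesis by (simp add: d)
    qed
    have "q * d > 0" using d q by simp
    from SI[OF this L(3)[OF d(2)] 1] show "(\<lambda>x. c * v x) \<in> S" .
  qed
  let ?e = "\<lambda>j. if j = j0 then 1 else 0 :: rat"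
  have eS: "?e \<notin> S"
  proof
    assume "?e \<in> S"
    then obtain d a where d: "d > 0" "a \<in> L" "\<forall>j. of_int d * ?e j = (of_int (a j) :: rat)" unfolding S_def by blast
    have "a j = (if j = j0 then d else 0)" for j
      using spec[OF d(3), of j] by (cases "j = j0") auto
    then have "a = (\<lambda>j. if j = j0 then d else 0)" by (rule ext)
    with j0[OF d(1)] d(2) show False by simp
  qed
  obtain B where B: "B \<subseteq> S" "fvs.independent B" "S \<subseteq> fvs.span B"
    using fvs.maximal_independent_subset[of S] by blast
  have "fvs.span B \<subseteq> S" using fvs.span_minimal[OF B(1) subspace] .
  with eS have "?e \<notin> fvs.span B" by blast
  then have ind: "fvs.independent (insert ?e B)" using B(2) by (simp add: fvs.independent_insert)
  from rat_fun.linear_independent_extend[OF ind, of "\<lambda>v. if v = ?e then 1 else 0"]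
  obtain g where lin: "Vector_Spaces.linear (\<lambda>(c::rat) f x. c * f x) (*) g"
    and g: "\<And>x. x \<in> insert ?e B \<Longrightarrow> g x = (if x = ?e then 1 else 0)" by blast
  interpret g: Vector_Spaces.linear "\<lambda>(c::rat) (f::'n \<Rightarrow> rat) x. c * f x" "(*)" g by (rule lin)
  have gB: "g v = 0" if "v \<in> B" for v
    using g[of v] that B(1) eS by auto
  have gS: "g v = 0" if "v \<in> S" for v
  proof -
    have "v \<in> fvs.span B" using that B(3) by blast
    then show ?thesis
    proof (induction rule: fvs.span_induct_alt)
      case base
      show ?case by (rule g.zero)
    next
      case (step c x y)
      then show ?case by (simp only: g.add g.scale gB)
    qed
  qed
  show ?thesis
  proof (rule that)
    show "g (\<lambda>j. v j + w j) = g v + g w" for v w using g.add[of v w] by (simp add: plus_fun_def)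
    show "g (\<lambda>j. c * v j) = c * g v" for c v by (rule g.scale)
    show "g (\<lambda>j. of_int (a j)) = 0" if "a \<in> L" for a
      by (rule gS, rule SI[OF zero_less_one that]) simp
    show "g ?e = 1" using g[of ?e] by simp
  qed
qed

text \<open>The values of \<delta> form a nonzero subgroup of the integers, generated by the least
  positive value \<open>d\<close>; division by \<open>d\<close> makes 1 a value.\<close>

lemma (in group) additive_normalize:
  fixes \<delta> :: "'a \<Rightarrow> int"
  assumes add: "\<And>a b. a \<in> carrier G \<Longrightarrow> b \<in> carrier G \<Longrightarrow> \<delta> (a \<otimes> b) = \<delta> a + \<delta> b"
    and ne: "s \<in> carrier G" "\<delta> s \<noteq> 0"
  obtains \<delta>' :: "'a \<Rightarrow> int" and t where
    "\<And>a b. a \<in> carrier G \<Longrightarrow> b \<in> carrier G \<Longrightarrow> \<delta>' (a \<otimes> b) = \<delta>' a + \<delta>' b"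
    "t \<in> carrier G" "\<delta>' t = 1"
proof -
  have one: "\<delta> \<one> = 0" using add[of \<one> \<one>] by simp
  have inv: "\<delta> (inv a) = - \<delta> a" if "a \<in> carrier G" for a
    using add[of a "inv a"] that one by simp
  have pow: "\<delta> (a [^] k) = int k * \<delta> a" if "a \<in> carrier G" for a and k :: nat
    by (induction k) (simp_all add: one add that algebra_simps)
  have ipow: "\<delta> (a [^] k) = k * \<delta> a" if "a \<in> carrier G" for a and k :: int
    using pow[OF that] inv that by (cases k rule: int_cases2) (simp_all add: int_pow_int int_pow_neg_int)
  have "\<exists>n. \<exists>a\<in>carrier G. \<delta> a = int n \<and> 0 < n"
  proof (cases "\<delta> s > 0")
    case True
    then show ?thesis using ne by (intro exI[of _ "nat (\<delta> s)"] bexI[of _ s]) auto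
  next
    case False
    then show ?thesis using ne inv[OF ne(1)] by (intro exI[of _ "nat (- \<delta> s)"] bexI[of _ "inv s"]) auto
  qed
  note ex = this
  define d where "d = (LEAST n. \<exists>a\<in>carrier G. \<delta> a = int n \<and> 0 < n)"
  from LeastI_ex[OF ex] obtain t where t: "t \<in> carrier G" "\<delta> t = int d" "0 < d"
    unfolding d_def[symmetric] by blast
  have dvd: "int d dvd \<delta> a" if a: "a \<in> carrier G" for a
  proof (rule ccontr)
    assume "\<not> int d dvd \<delta> a"
    then have "\<delta> a mod int d \<noteq> 0" by (simp only: dvd_eq_mod_eq_0) simp
    moreover have d0: "0 < int d" using t(3) by simp
    ultimately have m: "0 < \<delta> a mod int d" "\<delta> a mod int d < int d"
      using pos_mod_sign[OF d0, of "\<delta> a"] pos_mod_bound[OF d0, of "\<delta> a"] by linarith+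
    let ?r = "a \<otimes> t [^] (- (\<delta> a div int d))"
    have "\<delta> ?r = \<delta> a mod int d"
      using a t by (simp only: add ipow int_pow_closed minus_mult_div_eq_mod[symmetric]) simp
    have "?r \<in> carrier G" using a t by simp
    have "\<exists>b\<in>carrier G. \<delta> b = int (nat (\<delta> a mod int d)) \<and> 0 < nat (\<delta> a mod int d)"
      using m \<open>\<delta> ?r = \<delta> a mod int d\<close> \<open>?r \<in> carrier G\<close> by (intro bexI[of _ ?r]) simp_all
    then have "d \<le> nat (\<delta> a mod int d)" unfolding d_def by (rule Least_le)
    then show False using m by linarith
  qed
  show ?thesis
  proof (rule that[of "\<lambda>a. \<delta> a div int d" t])
    show "\<delta> (a \<otimes> b) div int d = \<delta> a div int d + \<delta> b div int d"
      if "a \<in> carrier G" "b \<in> carrier G" for a b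
      using dvd that by (simp add: add div_plus_div_distrib_dvd_left)
    show "\<delta> t div int d = 1" using t by simp
  qed (rule t)
qed

text \<open>The map \<open>E\<close> presents the abelianization as a quotient of integer exponent
  vectors by the lattice \<open>L\<close>. An infinite quotient has a generator of infinite order,
  and a rational functional that kills \<open>L\<close> and is 1 on this generator becomes integral
  after clearing denominators.\<close>

lemma (in group) hom_onto_integers:
  fixes f :: "'n::finite \<Rightarrow> 'a"
  assumes f: "range f \<subseteq> carrier G" and gen: "generate G (range f) = carrier G"
    and inf: "infinite (rcosets (derived G (carrier G)))"
  obtains \<delta> :: "'a \<Rightarrow> int" and t where
    "\<And>a b. a \<in> carrier G \<Longrightarrow> b \<in> carrier G \<Longrightarrow> \<delta> (a \<otimes> b) = \<delta> a + \<delta> b"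
    "t \<in> carrier G" "\<delta> t = 1"
proof -
  let ?K = "derived G (carrier G)"
  let ?Q = "G Mod ?K"
  note one_FactGroup [simp del] mult_FactGroup [simp del]
  have norm: "?K \<lhd> G" by (rule derived_is_normal) (rule normal_self)
  interpret Q: comm_group ?Q by (rule derived_quot_is_comm_group)
  interpret \<pi>: group_hom G ?Q "\<lambda>a. ?K #> a"
    using normal.r_coset_hom_Mod[OF norm] Q.is_group is_group by (simp add: group_hom_def group_hom_axioms_def)
  have fc: "f j \<in> carrier G" for j using f by blast
  define E where "E = (\<lambda>m :: 'n \<Rightarrow> int. finprod ?Q (\<lambda>j. (?K #> f j) [^]\<^bsub>?Q\<^esub> m j) UNIV)"
  have E_closed: "E m \<in> carrier ?Q" for m unfolding E_def using fc by (intro Q.finprod_closed) auto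
  have E_add: "E (\<lambda>j. m j + m' j) = E m \<otimes>\<^bsub>?Q\<^esub> E m'" for m m'
    unfolding E_def using fc by (subst Q.finprod_multf[symmetric]) (auto simp: Q.int_pow_mult)
  have E_zero: "E (\<lambda>_. 0) = \<one>\<^bsub>?Q\<^esub>" unfolding E_def by (intro Q.finprod_one_eqI int_pow_0)
  have E_unit: "E (\<lambda>j. if j = l then d else 0) = (?K #> f l) [^]\<^bsub>?Q\<^esub> d" for l d
  proof -
    have "E (\<lambda>j. if j = l then d else 0) = finprod ?Q (\<lambda>j. if l = j then (?K #> f j) [^]\<^bsub>?Q\<^esub> d else \<one>\<^bsub>?Q\<^esub>) UNIV"
      unfolding E_def using fc Q.one_closed by (intro Q.finprod_cong') auto
    also have "\<dots> = (?K #> f l) [^]\<^bsub>?Q\<^esub> d"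
      using fc by (intro Q.finprod_singleton) auto
    finally show ?thesis .
  qed
  have E_neg: "E (\<lambda>j. - m j) = inv\<^bsub>?Q\<^esub> E m" for m
  proof -
    have "E (\<lambda>j. - m j) \<otimes>\<^bsub>?Q\<^esub> E m = \<one>\<^bsub>?Q\<^esub>" using E_add[of "\<lambda>j. - m j" m] E_zero by simp
    from Q.inv_equality[OF this E_closed E_closed] show ?thesis by simp
  qed
  have surj: "\<exists>m. ?K #> a = E m" if "a \<in> carrier G" for a
  proof -
    have "a \<in> generate G (range f)" using that gen by simp
    then show ?thesis
    proof (induction rule: generate.induct)
      case one
      show ?case using E_zero \<pi>.hom_one by metis
    next
      case (incl h)
      then obtain l where "h = f l" by blast
      then show ?case using E_unit[of l 1] fc by (metis Q.int_pow_1 \<pi>.hom_closed)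
    next
      case (inv h)
      then obtain l where "h = f l" by blast
      then show ?case using E_unit[of l "- 1"] fc by (metis Q.int_pow_1 Q.int_pow_neg \<pi>.hom_closed \<pi>.hom_inv)
    next
      case (eng h1 h2)
      have h: "h1 \<in> carrier G" "h2 \<in> carrier G" using eng gen by auto
      from eng obtain m m' where "?K #> h1 = E m" "?K #> h2 = E m'" by blast
      then have "?K #> (h1 \<otimes> h2) = E (\<lambda>j. m j + m' j)" by (simp only: \<pi>.hom_mult[OF h] E_add)
      then show ?case by blast
    qed
  qed
  have "\<exists>l. \<forall>d::int. d > 0 \<longrightarrow> (?K #> f l) [^]\<^bsub>?Q\<^esub> d \<noteq> \<one>\<^bsub>?Q\<^esub>"
  proof (rule ccontr)
    assume "\<not> ?thesis"
    then have "\<forall>l. \<exists>d::int. d > 0 \<and> (?K #> f l) [^]\<^bsub>?Q\<^esub> d = \<one>\<^bsub>?Q\<^esub>" by blast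
    from choice[OF this] obtain d :: "'n \<Rightarrow> int" where d: "\<And>l. d l > 0" "\<And>l. (?K #> f l) [^]\<^bsub>?Q\<^esub> d l = \<one>\<^bsub>?Q\<^esub>" by blast
    \<comment> \<open>If every generator had finite order, exponents could be reduced modulo these
      orders, leaving only finitely many values of \<open>E\<close>.\<close>
    have red: "E m = E (\<lambda>j. m j mod d j)" for m
      unfolding E_def
    proof (rule Q.finprod_cong')
      fix j
      have c: "?K #> f j \<in> carrier ?Q" using fc by simp
      have "(?K #> f j) [^]\<^bsub>?Q\<^esub> m j = (?K #> f j) [^]\<^bsub>?Q\<^esub> (d j * (m j div d j) + m j mod d j)" by simp
      also have "\<dots> = ((?K #> f j) [^]\<^bsub>?Q\<^esub> d j) [^]\<^bsub>?Q\<^esub> (m j div d j) \<otimes>\<^bsub>?Q\<^esub> (?K #> f j) [^]\<^bsub>?Q\<^esub> (m j mod d j)"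
        using c by (simp only: Q.int_pow_mult Q.int_pow_pow)
      also have "\<dots> = (?K #> f j) [^]\<^bsub>?Q\<^esub> (m j mod d j)" using c by (simp only: d(2) Q.int_pow_one Q.l_one Q.int_pow_closed)
      finally show "(?K #> f j) [^]\<^bsub>?Q\<^esub> m j = (?K #> f j) [^]\<^bsub>?Q\<^esub> (m j mod d j)" .
    qed (use fc in auto)
    have "carrier ?Q \<subseteq> E ` PiE UNIV (\<lambda>j. {0..<d j})"
    proof
      fix x assume "x \<in> carrier ?Q"
      then obtain a where "a \<in> carrier G" "x = ?K #> a" by (auto simp: FactGroup_def RCOSETS_def)
      then obtain m where "x = E m" using surj by blast
      then have "x = E (\<lambda>j. m j mod d j)" using red by simp
      moreover have "(\<lambda>j. m j mod d j) \<in> PiE UNIV (\<lambda>j. {0..<d j})" using d(1) by auto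
      ultimately show "x \<in> E ` PiE UNIV (\<lambda>j. {0..<d j})" by blast
    qed
    then have "finite (carrier ?Q)" by (rule finite_subset) (intro finite_imageI finite_PiE, simp_all)
    then show False using inf by (simp add: FactGroup_def)
  qed
  then obtain j0 where j0: "\<And>d::int. d > 0 \<Longrightarrow> (?K #> f j0) [^]\<^bsub>?Q\<^esub> d \<noteq> \<one>\<^bsub>?Q\<^esub>" by blast
  define L where "L = {m. E m = \<one>\<^bsub>?Q\<^esub>}"
  have E_npow: "E (\<lambda>j. int k * m j) = E m [^]\<^bsub>?Q\<^esub> k" for k :: nat and m
  proof (induction k)
    case (Suc k)
    have "E (\<lambda>j. int (Suc k) * m j) = E (\<lambda>j. int k * m j + m j)" by (simp add: algebra_simps)
    then show ?case by (simp add: E_add Suc)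
  qed (simp add: E_zero)
  have Lscale: "(\<lambda>j. c * m j) \<in> L" if "m \<in> L" for c m
  proof (cases c rule: int_cases2)
    case (nonneg k)
    then show ?thesis using that E_npow[of k m] by (simp add: L_def)
  next
    case (nonpos k)
    then show ?thesis using that E_npow[of k m] E_neg[of "\<lambda>j. int k * m j"] by (simp add: L_def)
  qed
  have Ladd: "(\<lambda>j. a j + b j) \<in> L" if "a \<in> L" "b \<in> L" for a b
    using that E_add[of a b] by (simp add: L_def)
  have Lzero: "(\<lambda>_. 0) \<in> L" using E_zero by (simp add: L_def)
  have Lj0: "(\<lambda>j. if j = j0 then d else 0) \<notin> L" if "d > 0" for d
    using j0[OF that] E_unit[of j0 d] by (simp add: L_def)
  obtain g :: "('n \<Rightarrow> rat) \<Rightarrow> rat" where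
    g_add: "\<And>v w. g (\<lambda>j. v j + w j) = g v + g w" and g_scale: "\<And>c v. g (\<lambda>j. c * v j) = c * g v"
    and gL: "\<And>a. a \<in> L \<Longrightarrow> g (\<lambda>j. of_int (a j)) = 0" and g1: "g (\<lambda>j. if j = j0 then 1 else 0) = 1"
    by (rule rational_functional[OF Lzero Ladd Lscale Lj0], assumption+) (rule that)
  define gz where "gz = (\<lambda>m :: 'n \<Rightarrow> int. g (\<lambda>j. of_int (m j)))"
  have gz_add: "gz (\<lambda>j. a j + b j) = gz a + gz b" for a b
    unfolding gz_def by (simp add: g_add)
  have gz_scale: "gz (\<lambda>j. c * a j) = of_int c * gz a" for c a
    unfolding gz_def by (simp add: g_scale)
  have gz_diff: "gz a = gz b" if "E a = E b" for a b
  proof -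
    have "E (\<lambda>j. a j + - b j) = \<one>\<^bsub>?Q\<^esub>" using that E_closed[of b] by (simp only: E_add E_neg) simp
    then have "(\<lambda>j. a j + (- 1) * b j) \<in> L" by (simp add: L_def)
    then have "gz (\<lambda>j. a j + (- 1) * b j) = 0" unfolding gz_def by (rule gL)
    then show ?thesis by (simp only: gz_add gz_scale)
  qed
  let ?u = "\<lambda>l j. if j = l then 1 else 0 :: int"
  have gz_sum: "gz (\<lambda>j. if j \<in> S then m j else 0) = (\<Sum>l\<in>S. of_int (m l) * gz (?u l))" if "finite S" for S m
    using that
  proof induction
    case empty
    show ?case using gz_scale[of 0 "\<lambda>_. 0"] by simp
  next
    case (insert l S)
    have "(\<lambda>j. if j \<in> insert l S then m j else 0) = (\<lambda>j. (if j \<in> S then m j else 0) + m l * ?u l j)"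
      using insert.hyps by auto
    then show ?case using insert gz_add[of "\<lambda>j. if j \<in> S then m j else 0" "\<lambda>j. m l * ?u l j"]
      by (simp only: gz_scale sum.insert[OF insert.hyps] add.commute)
  qed
  \<comment> \<open>A common denominator for \<open>gz\<close> on the unit vectors serves for all
    exponent vectors.\<close>
  have "\<exists>D>0. \<forall>l\<in>S. of_int D * gz (?u l) \<in> \<int>" if "finite S" for S
    using that
  proof induction
    case empty
    show ?case by (rule exI[of _ 1]) simp
  next
    case (insert l S)
    then obtain D where D: "D > 0" "\<forall>l\<in>S. of_int D * gz (?u l) \<in> \<int>" by blast
    obtain p q where "quotient_of (gz (?u l)) = (p, q)" by force
    then have q: "q > 0" "gz (?u l) = of_int p / of_int q" by (auto simp: quotient_of_denom_pos quotient_of_div)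
    have "of_int (q * D) * gz (?u l) = of_int (D * p)" using q by simp
    then have "of_int (q * D) * gz (?u l) \<in> \<int>" by (metis Ints_of_int)
    moreover have "of_int (q * D) * gz (?u l') \<in> \<int>" if "l' \<in> S" for l'
    proof -
      have "of_int q * (of_int D * gz (?u l')) \<in> \<int>" by (rule Ints_mult[OF Ints_of_int bspec[OF D(2) that]])
      then show ?thesis by (simp only: of_int_mult mult.assoc)
    qed
    ultimately have "\<forall>l'\<in>insert l S. of_int (q * D) * gz (?u l') \<in> \<int>" by blast
    moreover have "q * D > 0" using q D by simp
    ultimately show ?case by blast
  qed
  from this[of UNIV] obtain D where D: "D > 0" "\<And>l. of_int D * gz (?u l) \<in> \<int>" by auto
  have D2: "\<exists>z. of_int D * gz m = of_int z" for m
  proof -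
    have "gz m = (\<Sum>l\<in>UNIV. of_int (m l) * gz (?u l))" using gz_sum[of UNIV m] by simp
    then have "of_int D * gz m = (\<Sum>l\<in>UNIV. of_int D * (of_int (m l) * gz (?u l)))"
      by (simp only: sum_distrib_left)
    also have "\<dots> = (\<Sum>l\<in>UNIV. of_int (m l) * (of_int D * gz (?u l)))"
      by (intro sum.cong refl mult.left_commute)
    also have "\<dots> \<in> \<int>" by (intro Ints_sum Ints_mult Ints_of_int D(2))
    finally show ?thesis by (auto elim: Ints_cases)
  qed
  \<comment> \<open>The value is independent of the chosen exponent vector by \<open>gz_diff\<close>
    and is already integral; the floor only changes its type.\<close>
  define \<delta> where "\<delta> = (\<lambda>a. \<lfloor>of_int D * gz (SOME m. ?K #> a = E m)\<rfloor>)"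
  have \<delta>: "of_int (\<delta> a) = of_int D * gz m" if "a \<in> carrier G" "?K #> a = E m" for a m
  proof -
    have "?K #> a = E (SOME m. ?K #> a = E m)" using someI[of "\<lambda>m. ?K #> a = E m" m, OF that(2)] .
    then have "gz (SOME m. ?K #> a = E m) = gz m" using that(2) gz_diff by metis
    moreover obtain z where "of_int D * gz m = of_int z" using D2 by blast
    ultimately show ?thesis unfolding \<delta>_def by simp
  qed
  have \<delta>_add: "\<delta> (a \<otimes> b) = \<delta> a + \<delta> b" if ab: "a \<in> carrier G" "b \<in> carrier G" for a b
  proof -
    obtain m m' where m: "?K #> a = E m" "?K #> b = E m'" using surj ab by metis
    have "?K #> (a \<otimes> b) = E (\<lambda>j. m j + m' j)" using ab m by (simp add: \<pi>.hom_mult E_add)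
    from \<delta>[OF _ this] have "(of_int (\<delta> (a \<otimes> b)) :: rat) = of_int (\<delta> a + \<delta> b)"
      using ab \<delta>[OF ab(1) m(1)] \<delta>[OF ab(2) m(2)] by (simp add: gz_add distrib_left)
    then show ?thesis by (simp only: of_int_eq_iff)
  qed
  have "?K #> f j0 = E (\<lambda>j. if j = j0 then 1 else 0)" using E_unit[of j0 1] fc by simp
  from \<delta>[OF fc this] have "of_int (\<delta> (f j0)) = (of_int D :: rat)"
    using g1 by (simp add: gz_def if_distrib[of of_int] cong: if_cong)
  then have "\<delta> (f j0) \<noteq> 0" using D(1) by simp
  from additive_normalize[OF \<delta>_add fc this] show ?thesis using that by blast
qed

section \<open>Regular maps\<close>

text \<open>The polynomial formula is demanded only on \<open>D\<close>, because group
  multiplication and inversion are polynomial only on the carrier.\<close>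

definition regular_on :: "('a \<Rightarrow> 'k::comm_ring_1) set \<Rightarrow> (('a \<Rightarrow> 'k) \<Rightarrow> ('b \<Rightarrow> 'k)) \<Rightarrow> bool" where
  "regular_on D \<psi> \<longleftrightarrow> (\<forall>i. \<exists>p\<in>pf UNIV. \<forall>x\<in>D. \<psi> x i = p x)"

lemma regular_pullback:
  assumes "regular_on D \<psi>" "f \<in> pf UNIV"
  obtains p where "p \<in> pf UNIV" "\<And>x. x \<in> D \<Longrightarrow> f (\<psi> x) = p x"
proof -
  have "\<forall>i. \<exists>p. p \<in> pf UNIV \<and> (\<forall>x\<in>D. \<psi> x i = p x)"
    using assms(1) unfolding regular_on_def Bex_def .
  from choice[OF this] obtain p where p: "\<forall>i. p i \<in> pf UNIV \<and> (\<forall>x\<in>D. \<psi> x i = p i x)" ..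
  show ?thesis
  proof (rule that)
    show "(\<lambda>x. f (\<lambda>i. p i x)) \<in> pf UNIV"
      using p by (intro pf_subst[where f = p and p = f, OF assms(2)]) simp
    fix x assume "x \<in> D"
    then have "\<psi> x = (\<lambda>i. p i x)" using p by auto
    then show "f (\<psi> x) = f (\<lambda>i. p i x)" by simp
  qed
qed

lemma regular_onI: "(\<And>i. \<exists>p\<in>pf UNIV. \<forall>x\<in>D. \<psi> x i = p x) \<Longrightarrow> regular_on D \<psi>"
  unfolding regular_on_def by blast

lemma regular_const: "regular_on D (\<lambda>_. a)"
  unfolding regular_on_def
proof
  fix i show "\<exists>p\<in>pf UNIV. \<forall>x\<in>D. a i = p x" by (rule bexI[of _ "\<lambda>_. a i"]) simp_all
qed

lemma regular_coords: "regular_on D (\<lambda>x i. x (h i))"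
  unfolding regular_on_def
proof
  fix i show "\<exists>p\<in>pf UNIV. \<forall>x\<in>D. x (h i) = p x"
    by (rule bexI[of _ "\<lambda>x. x (h i)"]) (simp_all add: pf_coord)
qed

lemma regular_id: "regular_on D (\<lambda>x. x)"
  using regular_coords[of D "\<lambda>i. i"] .

lemma regular_comp:
  assumes "regular_on D \<psi>" "regular_on E \<theta>" "\<And>x. x \<in> D \<Longrightarrow> \<psi> x \<in> E"
  shows "regular_on D (\<lambda>x. \<theta> (\<psi> x))"
proof (rule regular_onI)
  fix i
  obtain q where q: "q \<in> pf UNIV" "\<forall>y\<in>E. \<theta> y i = q y" using assms(2) unfolding regular_on_def by blast
  obtain p where p: "p \<in> pf UNIV" "\<And>x. x \<in> D \<Longrightarrow> q (\<psi> x) = p x"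
    by (rule regular_pullback[OF assms(1) q(1)]) (rule that)
  show "\<exists>p\<in>pf UNIV. \<forall>x\<in>D. \<theta> (\<psi> x) i = p x"
    by (rule bexI[OF _ p(1)]) (simp add: q(2) assms(3) p(2)[symmetric])
qed

lemma regular_case_sum:
  assumes "regular_on D a" "regular_on D b"
  shows "regular_on D (\<lambda>x. case_sum (a x) (b x))"
proof (rule regular_onI)
  fix i show "\<exists>p\<in>pf UNIV. \<forall>x\<in>D. case_sum (a x) (b x) i = p x"
    using assms unfolding regular_on_def by (cases i) simp_all
qed

lemma regular_cong: "regular_on D \<psi> \<Longrightarrow> (\<And>x. x \<in> D \<Longrightarrow> \<theta> x = \<psi> x) \<Longrightarrow> regular_on D \<theta>"
  unfolding regular_on_def by simp

lemma irr_image: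
  assumes "irr D" "regular_on D \<psi>"
  shows "irr (\<psi> ` D)"
  unfolding irr_def
proof (intro conjI ballI impI)
  show "\<psi> ` D \<noteq> {}" using assms(1) unfolding irr_def by simp
  fix f g assume f: "f \<in> pf UNIV" and g: "g \<in> pf UNIV" and fg: "\<forall>x\<in>\<psi> ` D. f x * g x = 0"
  obtain p where p: "p \<in> pf UNIV" "\<And>x. x \<in> D \<Longrightarrow> f (\<psi> x) = p x" by (rule regular_pullback[OF assms(2) f]) (rule that)
  obtain q where q: "q \<in> pf UNIV" "\<And>x. x \<in> D \<Longrightarrow> g (\<psi> x) = q x" by (rule regular_pullback[OF assms(2) g]) (rule that)
  have "(\<forall>x\<in>D. p x = 0) \<or> (\<forall>x\<in>D. q x = 0)"
    by (rule irrD[OF assms(1) p(1) q(1)]) (use fg in \<open>simp add: p(2)[symmetric] q(2)[symmetric]\<close>)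
  then show "(\<forall>x\<in>\<psi> ` D. f x = 0) \<or> (\<forall>x\<in>\<psi> ` D. g x = 0)" by (simp add: p(2) q(2))
qed

text \<open>\<open>W\<close> need not be closed, so images under regular maps can be measured
  directly; \<open>vanishing_closure\<close> shows that closing changes nothing.\<close>

definition dim_ge :: "('i \<Rightarrow> 'k::comm_ring_1) set \<Rightarrow> nat \<Rightarrow> bool" where
  "dim_ge W n \<longleftrightarrow> irr W \<and> (\<exists>y. alg_ind (vanishing W) n y)"

lemma dim_geI: "irr W \<Longrightarrow> alg_ind (vanishing W) n y \<Longrightarrow> dim_ge W n"
  unfolding dim_ge_def by (rule conjI, assumption, rule exI[of "alg_ind (vanishing W) n"])

lemma dim_geE:
  assumes "dim_ge W n"
  obtains y where "irr W" "\<forall>j<n. y j \<in> pf UNIV"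
    "\<forall>q\<in>pf {..<n}. (\<forall>x\<in>W. q (\<lambda>j. y j x) = 0) \<longrightarrow> q = (\<lambda>_. 0)"
proof -
  from assms obtain y where irr: "irr W" and y: "alg_ind (vanishing W) n y" unfolding dim_ge_def by blast
  have ypf: "\<And>j. j < n \<Longrightarrow> y j \<in> pf UNIV" using y unfolding alg_ind_def by blast
  have "q = (\<lambda>_. 0)" if q: "q \<in> pf {..<n}" "\<And>x. x \<in> W \<Longrightarrow> q (\<lambda>j. y j x) = 0" for q
  proof -
    have "(\<lambda>x. q (\<lambda>j. y j x)) \<in> pf UNIV"
      using ypf by (intro pf_subst[where f = y and p = q, OF q(1)]) simp
    then have "(\<lambda>x. q (\<lambda>j. y j x)) \<in> vanishing W" using q(2) by (simp add: vanishing_def)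
    with y q(1) show ?thesis unfolding alg_ind_def by blast
  qed
  then show ?thesis using that[OF irr, of y] ypf by simp
qed

lemma dim_ge_intro:
  assumes "irr W" "\<And>j. j < n \<Longrightarrow> y j \<in> pf UNIV"
    "\<And>q. q \<in> pf {..<n} \<Longrightarrow> (\<And>x. x \<in> W \<Longrightarrow> q (\<lambda>j. y j x) = 0) \<Longrightarrow> q = (\<lambda>_. 0)"
  shows "dim_ge W n"
proof (rule dim_geI[OF assms(1)])
  show "alg_ind (vanishing W) n y"
    unfolding alg_ind_def
  proof (intro conjI allI impI ballI)
    fix q assume "q \<in> pf {..<n}" "(\<lambda>x. q (\<lambda>j. y j x)) \<in> vanishing W"
    then show "q = (\<lambda>_. 0)" by (intro assms(3)) (simp_all add: vanishing_def)
  qed (rule assms(2))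
qed

text \<open>Independent functions on the image compose to independent functions on the source.
  Applied to a regular inverse, this also carries bounds from a set to its image.\<close>

lemma dim_ge_pullback:
  assumes "dim_ge (\<psi> ` D) n" "irr D" "regular_on D \<psi>"
  shows "dim_ge D n"
proof -
  obtain y where y': "\<forall>j<n. y j \<in> pf UNIV"
    and ind': "\<forall>q\<in>pf {..<n}. (\<forall>x\<in>\<psi> ` D. q (\<lambda>j. y j x) = 0) \<longrightarrow> q = (\<lambda>_. 0)"
    by (rule dim_geE[OF assms(1)]) (rule that)
  note y = mp[OF spec[OF y']]
  have ind: "q = (\<lambda>_. 0)" if "q \<in> pf {..<n}" "\<And>x. x \<in> \<psi> ` D \<Longrightarrow> q (\<lambda>j. y j x) = 0" for q
    using bspec[OF ind' that(1)] that(2) by simp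
  have "\<forall>j. \<exists>p. j < n \<longrightarrow> p \<in> pf UNIV \<and> (\<forall>x\<in>D. y j (\<psi> x) = p x)"
  proof
    fix j show "\<exists>p. j < n \<longrightarrow> p \<in> pf UNIV \<and> (\<forall>x\<in>D. y j (\<psi> x) = p x)"
    proof (cases "j < n")
      case True
      then obtain p where "p \<in> pf UNIV" "\<And>x. x \<in> D \<Longrightarrow> y j (\<psi> x) = p x"
        by (rule regular_pullback[OF assms(3) y]) (rule that)
      then show ?thesis by (intro exI[of _ p]) simp
    qed simp
  qed
  from choice[OF this] obtain p where p: "\<forall>j. j < n \<longrightarrow> p j \<in> pf UNIV \<and> (\<forall>x\<in>D. y j (\<psi> x) = p j x)" ..
  show ?thesis
  proof (rule dim_ge_intro[OF assms(2)])
    show "p j \<in> pf UNIV" if "j < n" for j using p that by blast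
    fix q assume q: "q \<in> pf {..<n}" "\<And>x. x \<in> D \<Longrightarrow> q (\<lambda>j. p j x) = 0"
    show "q = (\<lambda>_. 0)"
    proof (rule ind[OF q(1)])
      fix z assume "z \<in> \<psi> ` D"
      then obtain x where x: "x \<in> D" "z = \<psi> x" by blast
      have "q (\<lambda>j. y j z) = q (\<lambda>j. p j x)"
        by (rule pf_cong[OF q(1)]) (use p x in simp)
      then show "q (\<lambda>j. y j z) = 0" using q(2)[OF x(1)] by simp
    qed
  qed
qed

lemma vanishing_closure: "vanishing (zero_locus (vanishing W)) = vanishing W"
  by (auto simp: vanishing_def zero_locus_def)

lemma closure_superset: "W \<subseteq> zero_locus (vanishing W)"
  by (auto simp: vanishing_def zero_locus_def)

lemma irr_closure:
  assumes "irr W"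
  shows "irr (zero_locus (vanishing W))"
  unfolding irr_def
proof (intro conjI ballI impI)
  have van: "(\<forall>x\<in>zero_locus (vanishing W). f x = 0) \<longleftrightarrow> (\<forall>x\<in>W. f x = 0)" if "f \<in> pf UNIV" for f
    using that closure_superset[of W] by (auto simp: vanishing_def zero_locus_def)
  show "zero_locus (vanishing W) \<noteq> {}" using assms closure_superset unfolding irr_def by blast
  fix f g assume f: "f \<in> pf UNIV" and g: "g \<in> pf UNIV" and fg: "\<forall>x\<in>zero_locus (vanishing W). f x * g x = 0"
  have "(\<forall>x\<in>W. f x = 0) \<or> (\<forall>x\<in>W. g x = 0)"
    using fg closure_superset[of W] by (intro irrD[OF assms f g]) blast
  then show "(\<forall>x\<in>zero_locus (vanishing W). f x = 0) \<or> (\<forall>x\<in>zero_locus (vanishing W). g x = 0)"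
    by (simp add: van f g)
qed

lemma closedin_closure: "closedin zariski (zero_locus (vanishing W))"
  unfolding closedin_zariski_vanishing by (simp add: vanishing_closure)

lemma closure_minimal:
  assumes "closedin zariski C" "W \<subseteq> C"
  shows "zero_locus (vanishing W) \<subseteq> C"
proof -
  have "zero_locus (vanishing W) \<subseteq> zero_locus (vanishing C)"
    using assms(2) by (auto simp: vanishing_def zero_locus_def)
  then show ?thesis using assms(1) unfolding closedin_zariski_vanishing by simp
qed

lemma dim_ge_closure: "dim_ge W n \<Longrightarrow> dim_ge (zero_locus (vanishing W)) n"
  unfolding dim_ge_def vanishing_closure using irr_closure by blast

lemma dim_ge_singleton: "dim_ge {a :: 'i \<Rightarrow> 'k::alg_closed_field} 0"
proof (rule dim_ge_intro)
  show "irr {a}" unfolding irr_def by auto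
  fix q :: "(nat \<Rightarrow> 'k) \<Rightarrow> 'k" assume q: "q \<in> pf {..<0}" "\<And>x. x \<in> {a} \<Longrightarrow> q (\<lambda>j. (\<lambda>_ _. 0) j x) = 0"
  have "q z = 0" for z
    using pf_cong[OF q(1), of z "\<lambda>_. 0"] q(2) by simp
  then show "q = (\<lambda>_. 0)" by (rule ext)
qed simp

lemma dim_ge_le_card:
  fixes W :: "('i::finite \<Rightarrow> 'k::alg_closed_field) set"
  assumes "dim_ge W n"
  shows "n \<le> card (UNIV :: 'i set)"
proof -
  obtain y where "irr W" "alg_ind (vanishing W) n y" using assms unfolding dim_ge_def by blast
  then show ?thesis using pf_prime.alg_ind_le_card[OF irr_pf_prime] finite by blast
qed

section \<open>Products of irreducible sets\<close>

definition set_prod :: "('a \<Rightarrow> 'k) set \<Rightarrow> ('b \<Rightarrow> 'k) set \<Rightarrow> ('a + 'b \<Rightarrow> 'k) set" where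
  "set_prod X Y = {case_sum x y | x y. x \<in> X \<and> y \<in> Y}"

lemma set_prodI: "x \<in> X \<Longrightarrow> y \<in> Y \<Longrightarrow> case_sum x y \<in> set_prod X Y"
  unfolding set_prod_def by blast

lemma set_prodE:
  assumes "d \<in> set_prod X Y"
  obtains x y where "d = case_sum x y" "x \<in> X" "y \<in> Y"
  using assms unfolding set_prod_def by blast

lemma pf_slice_left:
  fixes f :: "('a + 'b \<Rightarrow> 'k::comm_ring_1) \<Rightarrow> 'k"
  assumes "f \<in> pf UNIV"
  shows "(\<lambda>x. f (case_sum x y)) \<in> pf UNIV"
proof -
  obtain p where p: "p \<in> pf UNIV" "\<And>x. x \<in> UNIV \<Longrightarrow> f (case_sum x y) = p x"
    by (rule regular_pullback[OF regular_case_sum[OF regular_id regular_const] assms]) (rule that)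
  then show ?thesis by simp
qed

lemma pf_slice_right:
  fixes f :: "('a + 'b \<Rightarrow> 'k::comm_ring_1) \<Rightarrow> 'k"
  assumes "f \<in> pf UNIV"
  shows "(\<lambda>y. f (case_sum x y)) \<in> pf UNIV"
proof -
  obtain p where p: "p \<in> pf UNIV" "\<And>y. y \<in> UNIV \<Longrightarrow> f (case_sum x y) = p y"
    by (rule regular_pullback[OF regular_case_sum[OF regular_const regular_id] assms]) (rule that)
  then show ?thesis by simp
qed

text \<open>One variable is frozen at a time: irreducibility of \<open>Y\<close> makes
  \<open>f\<close> vanish at \<open>y1\<close> or \<open>g\<close> vanish at \<open>y2\<close> for
  every \<open>x\<close>, and irreducibility of \<open>X\<close> then makes one alternative hold for
  all \<open>x\<close>.\<close>

lemma irr_set_prod: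
  fixes X :: "('a \<Rightarrow> 'k::alg_closed_field) set" and Y :: "('b \<Rightarrow> 'k) set"
  assumes X: "irr X" and Y: "irr Y"
  shows "irr (set_prod X Y)"
  unfolding irr_def
proof (intro conjI ballI impI)
  show "set_prod X Y \<noteq> {}" using X Y unfolding irr_def set_prod_def by blast
  fix f g :: "('a + 'b \<Rightarrow> 'k) \<Rightarrow> 'k"
  assume f: "f \<in> pf UNIV" and g: "g \<in> pf UNIV" and fg: "\<forall>x\<in>set_prod X Y. f x * g x = 0"
  show "(\<forall>x\<in>set_prod X Y. f x = 0) \<or> (\<forall>x\<in>set_prod X Y. g x = 0)"
  proof (rule ccontr)
    assume "\<not> ?thesis"
    then obtain x1 y1 x2 y2 where 1: "x1 \<in> X" "y1 \<in> Y" "f (case_sum x1 y1) \<noteq> 0"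
      and 2: "x2 \<in> X" "y2 \<in> Y" "g (case_sum x2 y2) \<noteq> 0" unfolding set_prod_def by blast
    have "f (case_sum x y1) * g (case_sum x y2) = 0" if x: "x \<in> X" for x
    proof -
      have "(\<forall>y\<in>Y. f (case_sum x y) = 0) \<or> (\<forall>y\<in>Y. g (case_sum x y) = 0)"
        by (rule irrD[OF Y pf_slice_right[OF f] pf_slice_right[OF g]])
          (use fg set_prodI[OF x] in blast)
      then show ?thesis using 1 2 by auto
    qed
    from irrD[OF X pf_slice_left[OF f] pf_slice_left[OF g] this] 1 2 show False by blast
  qed
qed

text \<open>In a relation \<open>q\<close>, fixing \<open>x\<close> and using independence on
  \<open>Y\<close> frees the last \<open>n\<close> arguments; fixing these and using independence on
  \<open>X\<close> frees the first \<open>m\<close>.\<close>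

lemma dim_ge_set_prod:
  fixes X :: "('a \<Rightarrow> 'k::alg_closed_field) set" and Y :: "('b \<Rightarrow> 'k) set"
  assumes X: "dim_ge X m" and Y: "dim_ge Y n"
  shows "dim_ge (set_prod X Y) (m + n)"
proof -
  obtain u where irrX: "irr X" and u': "\<forall>j<m. u j \<in> pf UNIV"
    and indX': "\<forall>q\<in>pf {..<m}. (\<forall>x\<in>X. q (\<lambda>j. u j x) = 0) \<longrightarrow> q = (\<lambda>_. 0)"
    by (rule dim_geE[OF X]) (rule that)
  note u = mp[OF spec[OF u']]
  have indX: "q = (\<lambda>_. 0)" if "q \<in> pf {..<m}" "\<And>x. x \<in> X \<Longrightarrow> q (\<lambda>j. u j x) = 0" for q
    using bspec[OF indX' that(1)] that(2) by simp
  obtain v where irrY: "irr Y" and v': "\<forall>j<n. v j \<in> pf UNIV"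
    and indY': "\<forall>q\<in>pf {..<n}. (\<forall>x\<in>Y. q (\<lambda>j. v j x) = 0) \<longrightarrow> q = (\<lambda>_. 0)"
    by (rule dim_geE[OF Y]) (rule that)
  note v = mp[OF spec[OF v']]
  have indY: "q = (\<lambda>_. 0)" if "q \<in> pf {..<n}" "\<And>x. x \<in> Y \<Longrightarrow> q (\<lambda>j. v j x) = 0" for q
    using bspec[OF indY' that(1)] that(2) by simp
  define w where "w = (\<lambda>j d. if j < m then u j (\<lambda>i. d (Inl i)) else v (j - m) (\<lambda>i. d (Inr i)))"
  show ?thesis
  proof (rule dim_ge_intro[OF irr_set_prod[OF irrX irrY]])
    fix j assume j: "j < m + n"
    show "w j \<in> pf UNIV"
    proof (cases "j < m")
      case True
      have "(\<lambda>d. u j (\<lambda>i. d (Inl i))) \<in> pf UNIV"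
        by (rule pf_subst[where f = "\<lambda>i d. d (Inl i)" and p = "u j", OF u[OF True]]) (simp add: pf_coord)
      then show ?thesis using True by (simp add: w_def)
    next
      case False
      have "(\<lambda>d. v (j - m) (\<lambda>i. d (Inr i))) \<in> pf UNIV"
        using False j by (intro pf_subst[where f = "\<lambda>i d. d (Inr i)" and p = "v (j - m)", OF v]) (simp_all add: pf_coord)
      then show ?thesis using False by (simp add: w_def)
    qed
  next
    fix q :: "(nat \<Rightarrow> 'k) \<Rightarrow> 'k"
    assume q: "q \<in> pf {..<m + n}" "\<And>d. d \<in> set_prod X Y \<Longrightarrow> q (\<lambda>j. w j d) = 0"
    let ?mix = "\<lambda>s t j. if j < m then s j else t (j - m) :: 'k"
    have 1: "q (?mix (\<lambda>j. u j x) t) = 0" if x: "x \<in> X" for x t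
    proof -
      have "(\<lambda>t. q (?mix (\<lambda>j. u j x) t)) \<in> pf {..<n}"
      proof (rule pf_subst[where f = "\<lambda>j t. ?mix (\<lambda>j. u j x) t j" and p = q, OF q(1)])
        fix j assume "j \<in> {..<m + n}"
        then show "(\<lambda>t. ?mix (\<lambda>j. u j x) t j) \<in> pf {..<n}"
          by (cases "j < m") (simp_all add: pf_coord)
      qed
      moreover have "q (?mix (\<lambda>j. u j x) (\<lambda>j. v j y)) = 0" if "y \<in> Y" for y
      proof -
        have "w j (case_sum x y) = ?mix (\<lambda>j. u j x) (\<lambda>j. v j y) j" for j
          by (cases "j < m") (simp_all add: w_def)
        then show ?thesis using q(2)[OF set_prodI[OF x that]] by simp
      qed
      ultimately have "(\<lambda>t. q (?mix (\<lambda>j. u j x) t)) = (\<lambda>_. 0)" by (rule indY)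
      then show ?thesis by (rule fun_cong)
    qed
    show "q = (\<lambda>_. 0)"
    proof (rule ext)
      fix z :: "nat \<Rightarrow> 'k"
      let ?t = "\<lambda>j. z (j + m)"
      have "(\<lambda>s. q (?mix s ?t)) \<in> pf {..<m}"
      proof (rule pf_subst[where f = "\<lambda>j s. ?mix s ?t j" and p = q, OF q(1)])
        fix j assume "j \<in> {..<m + n}"
        then show "(\<lambda>s. ?mix s ?t j) \<in> pf {..<m}"
          by (cases "j < m") (simp_all add: pf_coord)
      qed
      from indX[OF this 1] have "q (?mix z ?t) = 0" by (rule fun_cong)
      moreover have "?mix z ?t = z" by auto
      ultimately show "q z = 0" by simp
    qed
  qed
qed

section \<open>Components\<close>

text \<open>Each \<open>b\<close> in the ideal of \<open>Z\<close> is killed on \<open>H\<close> by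
  some \<open>g\<close> outside that ideal. Finitely many \<open>b\<close> cut out \<open>Z\<close>
  where \<open>q\<close> is nonzero, so it suffices to choose \<open>p\<close> in \<open>Z\<close>
  where \<open>q\<close> and the corresponding finitely many \<open>g b\<close> are nonzero.\<close>

lemma generic_point_of_component:
  fixes H :: "('i::finite \<Rightarrow> 'k::alg_closed_field) set"
  assumes H: "closedin zariski H" and Z: "Z \<in> irreducible_components (subtopology zariski H)"
  obtains p where "p \<in> Z" "\<And>T. irr T \<Longrightarrow> T \<subseteq> H \<Longrightarrow> p \<in> T \<Longrightarrow> T \<subseteq> Z" "closedin zariski Z"
proof -
  have ZH: "Z \<subseteq> H" and irrZ: "irr Z" and max: "\<And>T. T \<subseteq> H \<Longrightarrow> irr T \<Longrightarrow> Z \<subseteq> T \<Longrightarrow> T = Z"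
    using Z unfolding irreducible_components_def irreducible_subset_zariski by blast+
  have Zcl: "zero_locus (vanishing Z) = Z"
    using max[OF closure_minimal[OF H ZH] irr_closure[OF irrZ] closure_superset] .
  have clZ: "closedin zariski Z" using Zcl unfolding closedin_zariski_vanishing .
  let ?P = "vanishing Z"
  interpret P: pf_prime ?P by (rule irr_pf_prime[OF irrZ])
  obtain B q where B: "finite B" "B \<subseteq> ?P" "q \<in> pf UNIV - ?P"
    and Bq: "\<And>x. x \<in> zero_locus B \<Longrightarrow> q x \<noteq> 0 \<Longrightarrow> x \<in> zero_locus (?P \<inter> pf UNIV)"
    using P.generically_finitely_generated[OF finite, of UNIV] by blast
  have PU: "?P \<inter> pf UNIV = ?P" by (auto simp: vanishing_def)
  \<comment> \<open>Otherwise no \<open>g * b ^ N\<close> with \<open>g \<notin> ?P\<close> vanishes on \<open>H\<close>, and a prime ideal avoiding all of these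
    defines an irreducible subset of \<open>H\<close> strictly larger than \<open>Z\<close>.\<close>
  have local: "\<exists>g. g \<in> pf UNIV - ?P \<and> (\<forall>x\<in>H. g x * b x = 0)" if b: "b \<in> ?P" for b
  proof (rule ccontr)
    assume contra: "\<not> ?thesis"
    have bpf: "b \<in> pf UNIV" using b by (simp add: vanishing_def)
    define M where "M = {\<lambda>x. g x * b x ^ N | g N. g \<in> pf UNIV - ?P}"
    have MI: "(\<lambda>x. g x * b x ^ N) \<in> M" if "g \<in> pf UNIV" "g \<notin> ?P" for g N
      unfolding M_def by (intro CollectI exI[of _ g] exI[of _ N] conjI refl DiffI that)
    have disj: "vanishing H \<inter> M = {}"
    proof (rule ccontr)
      assume "\<not> ?thesis"
      then obtain m where m: "m \<in> vanishing H" "m \<in> M" by blast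
      then obtain g N where g: "m = (\<lambda>x. g x * b x ^ N)" "g \<in> pf UNIV - ?P" unfolding M_def by blast
      have 0: "g x * b x ^ N = 0" if "x \<in> H" for x using m(1) that unfolding g(1) vanishing_def by simp
      \<comment> \<open>Values lie in a field, so a positive exponent may be lowered to 1; for
        exponent 0 already \<open>g x\<close> is zero.\<close>
      have "g x * b x = 0" if "x \<in> H" for x using 0[OF that] by (cases "N = 0") auto
      then show False using contra g(2) by blast
    qed
    obtain P' where P': "pf_prime P'" "vanishing H \<subseteq> P'" "P' \<inter> M = {}"
    proof (rule exists_prime[of "vanishing H" M])
      show "(\<lambda>x. s x * r x) \<in> M" if s: "s \<in> M" and r: "r \<in> M" for s r
      proof -
        obtain g N where g: "s = (\<lambda>x. g x * b x ^ N)" "g \<in> pf UNIV - ?P" using s unfolding M_def by blast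
        obtain g' N' where g': "r = (\<lambda>x. g' x * b x ^ N')" "g' \<in> pf UNIV - ?P" using r unfolding M_def by blast
        have "(\<lambda>x. (g x * g' x) * b x ^ (N + N')) \<in> M"
          by (rule MI) (use g g' pf_mult P.not_mem_mult in auto)
        moreover have "(\<lambda>x. s x * r x) = (\<lambda>x. (g x * g' x) * b x ^ (N + N'))"
          unfolding g g' power_add by (rule ext) (simp only: mult_ac)
        ultimately show ?thesis by simp
      qed
      show "(\<lambda>_. 1) \<in> M" using MI[of "\<lambda>_. 1" 0] P.one by simp
    qed (use disj in \<open>auto simp: vanishing_def pf_add pf_mult\<close>)
    interpret P': pf_prime P' by (rule P'(1))
    \<comment> \<open>Exponent 0 in \<open>M\<close> keeps everything outside \<open>?P\<close> out
      of \<open>P'\<close>; exponent 1 keeps \<open>b\<close> out of \<open>P'\<close>.\<close>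
    have sub: "P' \<subseteq> ?P"
    proof
      fix g assume "g \<in> P'"
      then show "g \<in> ?P" using MI[of g 0] P'(3) P'.sub by auto
    qed
    have bP': "b \<notin> P'" using MI[of "\<lambda>_. 1" 1] P.one P'(3) by auto
    have "zero_locus P' \<subseteq> zero_locus (vanishing H)" using P'(2) by (auto simp: zero_locus_def)
    then have "zero_locus P' \<subseteq> H" using H unfolding closedin_zariski_vanishing by simp
    moreover have "Z \<subseteq> zero_locus P'" using sub by (auto simp: zero_locus_def vanishing_def)
    ultimately have "zero_locus P' = Z" by (intro max P'.irr_zero_locus finite)
    then have "P' = ?P" using P'.vanishing_zero_locus[OF finite] by simp
    then show False using b bP' by simp
  qed
  have "\<forall>b. \<exists>g. b \<in> ?P \<longrightarrow> g \<in> pf UNIV - ?P \<and> (\<forall>x\<in>H. g x * b x = 0)" using local by blast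
  from choice[OF this] obtain g where g: "\<forall>b. b \<in> ?P \<longrightarrow> g b \<in> pf UNIV - ?P \<and> (\<forall>x\<in>H. g b x * b x = 0)" ..
  have "(\<lambda>x. \<Prod>b\<in>B'. g b x) \<in> pf UNIV - ?P" if "finite B'" "B' \<subseteq> ?P" for B'
    using that
  proof induction
    case empty
    then show ?case using P.one by simp
  next
    case (insert b B')
    then have "(\<lambda>x. g b x * (\<Prod>b\<in>B'. g b x)) \<in> pf UNIV - ?P"
      using g P.not_mem_mult[of "g b" "\<lambda>x. \<Prod>b\<in>B'. g b x"] pf_mult[of "g b" UNIV "\<lambda>x. \<Prod>b\<in>B'. g b x"] by simp
    then show ?case using insert by simp
  qed
  from this[OF B(1,2)] have "(\<lambda>x. q x * (\<Prod>b\<in>B. g b x)) \<notin> ?P" "(\<lambda>x. q x * (\<Prod>b\<in>B. g b x)) \<in> pf UNIV"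
    using B(3) P.not_mem_mult[of q "\<lambda>x. \<Prod>b\<in>B. g b x"] pf_mult[of q UNIV "\<lambda>x. \<Prod>b\<in>B. g b x"] by auto
  then obtain p where p: "p \<in> Z" "q p * (\<Prod>b\<in>B. g b p) \<noteq> 0" by (auto simp: vanishing_def)
  show ?thesis
  proof (rule that[OF p(1) _ clZ])
    fix T assume T: "irr T" "T \<subseteq> H" "p \<in> T"
    have bT: "\<forall>x\<in>T. b x = 0" if b: "b \<in> B" for b
    proof -
      have bP: "b \<in> ?P" using b B(2) by blast
      then have gb: "g b \<in> pf UNIV" "b \<in> pf UNIV" using g by (auto simp: vanishing_def)
      have "(\<forall>x\<in>T. g b x = 0) \<or> (\<forall>x\<in>T. b x = 0)"
        by (rule irrD[OF T(1) gb]) (use g bP T(2) in blast)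
      moreover have "g b p \<noteq> 0" using p(2) b B(1) by auto
      ultimately show ?thesis using T(3) by blast
    qed
    have "f x = 0" if f: "f \<in> ?P" and x: "x \<in> T" for f x
    proof -
      have "(\<forall>x\<in>T. q x = 0) \<or> (\<forall>x\<in>T. f x = 0)"
      proof (rule irrD[OF T(1)])
        fix z assume z: "z \<in> T"
        show "q z * f z = 0"
        proof (cases "q z = 0")
          case False
          have "z \<in> zero_locus B" using bT z by (auto simp: zero_locus_def)
          from Bq[OF this False] f show ?thesis unfolding PU by (auto simp: zero_locus_def)
        qed simp
      qed (use B(3) f in \<open>auto simp: vanishing_def\<close>)
      then show ?thesis using p(2) T(3) x by auto
    qed
    then have "T \<subseteq> zero_locus ?P" by (auto simp: zero_locus_def)
    then show "T \<subseteq> Z" using Zcl by simp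
  qed
qed

section \<open>Regular maps into an algebraic group\<close>

text \<open>The closed set \<open>S\<close>, on which both maps have polynomial formulas, contains
  the closure of \<open>W\<close>; there the differences of the formulas still vanish.\<close>

lemma closure_equal:
  assumes "regular_on S \<psi>" "regular_on S \<theta>" "closedin zariski S" "W \<subseteq> S"
    and "\<And>x. x \<in> W \<Longrightarrow> \<psi> x = \<theta> x" and z: "z \<in> zero_locus (vanishing W)"
  shows "\<psi> z = \<theta> z"
proof (rule ext)
  fix i
  obtain p where p: "p \<in> pf UNIV" "\<forall>x\<in>S. \<psi> x i = p x" using assms(1) unfolding regular_on_def by blast
  obtain q where q: "q \<in> pf UNIV" "\<forall>x\<in>S. \<theta> x i = q x" using assms(2) unfolding regular_on_def by blast
  have "p x - q x = 0" if x: "x \<in> W" for x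
  proof -
    have "x \<in> S" using x assms(4) by blast
    with p(2) q(2) assms(5)[OF x] show ?thesis by (metis right_minus_eq)
  qed
  then have "(\<lambda>x. p x - q x) \<in> vanishing W" using p(1) q(1) by (simp add: vanishing_def pf_diff)
  then have "p z - q z = 0" using z by (auto simp: zero_locus_def)
  moreover have "z \<in> S" using closure_minimal[OF assms(3,4)] z by blast
  ultimately show "\<psi> z i = \<theta> z i" using p(2) q(2) by simp
qed

lemma closure_mem:
  assumes "regular_on S \<psi>" "closedin zariski S" "W \<subseteq> S" "closedin zariski E"
    and "\<And>x. x \<in> W \<Longrightarrow> \<psi> x \<in> E" and z: "z \<in> zero_locus (vanishing W)"
  shows "\<psi> z \<in> E"
proof -
  have "\<psi> z \<in> zero_locus (vanishing E)"
    unfolding zero_locus_def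
  proof (intro CollectI ballI)
    fix q assume q: "q \<in> vanishing E"
    then have "q \<in> pf UNIV" by (simp add: vanishing_def)
    then obtain p where p: "p \<in> pf UNIV" "\<And>x. x \<in> S \<Longrightarrow> q (\<psi> x) = p x"
      by (rule regular_pullback[OF assms(1)]) (rule that)
    have "p x = 0" if "x \<in> W" for x
      using p(2)[of x] q assms(3) assms(5)[OF that] that by (auto simp: vanishing_def)
    then have "p \<in> vanishing W" using p(1) by (simp add: vanishing_def)
    then have "p z = 0" using z by (auto simp: zero_locus_def)
    moreover have "z \<in> S" using closure_minimal[OF assms(2,3)] z by blast
    ultimately show "q (\<psi> z) = 0" using p(2) by simp
  qed
  then show ?thesis using assms(4) unfolding closedin_zariski_vanishing by simp
qed

lemma closedin_UNIV_zariski: "closedin zariski UNIV"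
  using closedin_topspace[of zariski] by simp

lemma closedin_zariskiI: "(\<And>z. z \<in> zero_locus (vanishing W) \<Longrightarrow> z \<in> W) \<Longrightarrow> closedin zariski W"
  unfolding closedin_zariski_vanishing using closure_superset[of W] by blast

lemma closed_preimage:
  assumes "regular_on UNIV \<psi>" "closedin zariski E"
  shows "closedin zariski {x. \<psi> x \<in> E}"
  by (rule closedin_zariskiI, rule CollectI, rule closure_mem[OF assms(1) closedin_UNIV_zariski _ assms(2)]) auto

lemma closedin_set_prod:
  assumes X: "closedin zariski X" and Y: "closedin zariski Y"
  shows "closedin zariski (set_prod X Y)"
proof (rule closedin_zariskiI)
  fix d assume d: "d \<in> zero_locus (vanishing (set_prod X Y))"
  have "(\<lambda>i. d (Inl i)) \<in> X"
    by (rule closure_mem[OF regular_coords closedin_UNIV_zariski _ X _ d]) (auto elim: set_prodE)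
  moreover have "(\<lambda>i. d (Inr i)) \<in> Y"
    by (rule closure_mem[OF regular_coords closedin_UNIV_zariski _ Y _ d]) (auto elim: set_prodE)
  moreover have "d = case_sum (\<lambda>i. d (Inl i)) (\<lambda>i. d (Inr i))"
    by (rule ext) (simp split: sum.split)
  ultimately show "d \<in> set_prod X Y"
    using set_prodI by metis
qed

context affine_algebraic_group
begin

lemma regular_mult:
  assumes "regular_on D a" "regular_on D b"
    and "\<And>x. x \<in> D \<Longrightarrow> a x \<in> carrier G" "\<And>x. x \<in> D \<Longrightarrow> b x \<in> carrier G"
  shows "regular_on D (\<lambda>x. a x \<otimes> b x)"
proof (rule regular_onI)
  fix i
  obtain q where q: "q \<in> pf UNIV" "\<forall>x\<in>carrier G. \<forall>y\<in>carrier G. (x \<otimes> y) i = q (case_sum x y)"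
    using mult_regular[of i] unfolding poly_functions_eq_pf by blast
  obtain p where p: "p \<in> pf UNIV" "\<And>x. x \<in> D \<Longrightarrow> q (case_sum (a x) (b x)) = p x"
    by (rule regular_pullback[OF regular_case_sum[OF assms(1,2)] q(1)]) (rule that)
  show "\<exists>p\<in>pf UNIV. \<forall>x\<in>D. (a x \<otimes> b x) i = p x"
    by (rule bexI[OF _ p(1)]) (simp add: q(2) assms(3,4) p(2)[symmetric])
qed

lemma regular_inv:
  assumes "regular_on D a" "\<And>x. x \<in> D \<Longrightarrow> a x \<in> carrier G"
  shows "regular_on D (\<lambda>x. inv (a x))"
proof (rule regular_onI)
  fix i
  obtain q where q: "q \<in> pf UNIV" "\<forall>x\<in>carrier G. (inv x) i = q x"
    using inv_regular[of i] unfolding poly_functions_eq_pf by blast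
  obtain p where p: "p \<in> pf UNIV" "\<And>x. x \<in> D \<Longrightarrow> q (a x) = p x"
    by (rule regular_pullback[OF assms(1) q(1)]) (rule that)
  show "\<exists>p\<in>pf UNIV. \<forall>x\<in>D. (inv (a x)) i = p x"
    by (rule bexI[OF _ p(1)]) (simp add: q(2) assms(2) p(2)[symmetric])
qed

lemma regular_int_pow:
  assumes "regular_on D a" "\<And>x. x \<in> D \<Longrightarrow> a x \<in> carrier G"
  shows "regular_on D (\<lambda>x. a x [^] (k :: int))"
proof -
  have nat: "regular_on D (\<lambda>x. a x [^] m)" for m :: nat
  proof (induction m)
    case 0
    show ?case using regular_const[of D \<one>] by simp
  next
    case (Suc m)
    have "regular_on D (\<lambda>x. a x [^] m \<otimes> a x)"
      by (rule regular_mult[OF Suc assms(1)]) (simp_all add: assms(2))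
    then show ?case by simp
  qed
  show ?thesis
  proof (cases k rule: int_cases2)
    case (nonneg m)
    then show ?thesis using nat[of m] by (simp add: int_pow_int)
  next
    case (nonpos m)
    have "regular_on D (\<lambda>x. inv (a x [^] m))"
      by (rule regular_inv[OF nat]) (simp add: assms(2))
    then show ?thesis
      by (rule regular_cong) (simp add: nonpos int_pow_neg_int assms(2))
  qed
qed

lemma dim_ge_translate:
  assumes W: "dim_ge W n" "W \<subseteq> carrier G" and a: "a \<in> carrier G"
  shows "dim_ge ((\<lambda>x. a \<otimes> x) ` W) n"
proof -
  let ?E = "(\<lambda>x. a \<otimes> x) ` W"
  have inG: "\<And>x. x \<in> W \<Longrightarrow> x \<in> carrier G" using W(2) by blast
  have "(\<lambda>x. inv a \<otimes> x) ` ?E = W"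
    using inG a by (force simp: image_image m_assoc[symmetric])
  moreover have "irr ?E"
    using W(1) inG a unfolding dim_ge_def
    by (intro irr_image regular_mult regular_const regular_id) auto
  moreover have "regular_on ?E (\<lambda>x. inv a \<otimes> x)"
    using inG a by (intro regular_mult regular_const regular_id) auto
  ultimately show ?thesis using dim_ge_pullback[of "\<lambda>x. inv a \<otimes> x" ?E n] W(1) by simp
qed

text \<open>Moving a point of \<open>W\<close> to the identity ensures later that the family of
  homomorphisms contains the given one; closing up makes the graph of the family closed.\<close>

lemma dim_ge_normalize:
  assumes W: "dim_ge W n" "W \<subseteq> K" and K: "subgroup K G" "closedin zariski K"
  obtains X where "dim_ge X n" "closedin zariski X" "\<one> \<in> X" "X \<subseteq> K"
proof -
  have KG: "K \<subseteq> carrier G" using subgroup.subset[OF K(1)] .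
  obtain w where w: "w \<in> W" using W(1) unfolding dim_ge_def irr_def by blast
  have wK: "w \<in> K" "w \<in> carrier G" using w W(2) KG by blast+
  let ?E = "(\<lambda>x. inv w \<otimes> x) ` W"
  have "dim_ge ?E n" using dim_ge_translate[OF W(1) _ inv_closed[OF wK(2)]] W(2) KG by blast
  then have "dim_ge (zero_locus (vanishing ?E)) n" by (rule dim_ge_closure)
  moreover have "\<one> \<in> ?E" using w wK by (intro image_eqI[of _ _ w]) simp_all
  then have "\<one> \<in> zero_locus (vanishing ?E)" using closure_superset[of ?E] by blast
  moreover have "?E \<subseteq> K"
    using W(2) wK(1) subgroup.m_closed[OF K(1) subgroup.m_inv_closed[OF K(1)]] by blast
  then have "zero_locus (vanishing ?E) \<subseteq> K" by (rule closure_minimal[OF K(2)])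
  ultimately show ?thesis using that closedin_closure by blast
qed

end

section \<open>Words and the variety of homomorphisms\<close>

fun weval :: "('a, 'b) monoid_scheme \<Rightarrow> ('n \<Rightarrow> 'a) \<Rightarrow> ('n \<times> bool) list \<Rightarrow> 'a" where
  "weval G g [] = \<one>\<^bsub>G\<^esub>"
| "weval G g ((j, b) # w) = (if b then g j else inv\<^bsub>G\<^esub> g j) \<otimes>\<^bsub>G\<^esub> weval G g w"

lemma (in group) weval_closed: "(\<And>j. g j \<in> carrier G) \<Longrightarrow> weval G g w \<in> carrier G"
  by (induction w) auto

lemma (in group) weval_append:
  assumes "\<And>j. g j \<in> carrier G"
  shows "weval G g (v @ w) = weval G g v \<otimes> weval G g w"
proof (induction v)
  case Nil
  show ?case using weval_closed[of g w, OF assms] by simp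
next
  case (Cons x v)
  then show ?case using weval_closed[of g _, OF assms] assms by (cases x) (simp add: m_assoc)
qed

lemma (in group) generate_word:
  assumes f: "range f \<subseteq> carrier G" and a: "a \<in> generate G (range f)"
  shows "\<exists>w. a = weval G f w"
  using a
proof (induction rule: generate.induct)
  case one
  show ?case by (rule exI[of _ "[]"]) simp
next
  case (incl h)
  then obtain j where "h = f j" "f j \<in> carrier G" using f by blast
  then show ?case by (intro exI[of _ "[(j, True)]"]) simp
next
  case (inv h)
  then obtain j where "h = f j" "f j \<in> carrier G" using f by blast
  then show ?case by (intro exI[of _ "[(j, False)]"]) simp
next
  case (eng h1 h2)
  then obtain v w where "h1 = weval G f v" "h2 = weval G f w" by blast
  moreover have "f j \<in> carrier G" for j using f by blast
  ultimately show ?case using weval_append[of f v w] by (intro exI[of _ "v @ w"]) simp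
qed

lemma (in group_hom) hom_weval:
  assumes "\<And>j. f j \<in> carrier G"
  shows "h (weval G f w) = weval H (\<lambda>j. h (f j)) w"
proof (induction w)
  case (Cons x w)
  then show ?case using assms G.weval_closed[of f w, OF assms] by (cases x) simp
qed simp

definition pt :: "('n \<times> 'i \<Rightarrow> 'k) \<Rightarrow> 'n \<Rightarrow> 'i \<Rightarrow> 'k" where
  "pt x j = (\<lambda>i. x (j, i))"

lemma pt_inject: "(\<And>j. pt x j = pt y j) \<Longrightarrow> x = y"
  by (rule ext) (metis pt_def surj_pair)

lemma pt_case_prod [simp]: "pt (\<lambda>(j, i). h j i) j = h j"
  by (simp add: pt_def)

lemma regular_pt: "regular_on D (\<lambda>x. pt x j)"
  unfolding pt_def by (rule regular_coords)

lemma (in affine_algebraic_group) regular_weval: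
  assumes "\<And>x j. x \<in> D \<Longrightarrow> pt x j \<in> carrier G"
  shows "regular_on D (\<lambda>x. weval G (pt x) w)"
proof (induction w)
  case Nil
  show ?case using regular_const[of D \<one>] by simp
next
  case (Cons y w)
  obtain j b where y: "y = (j, b)" by force
  have "regular_on D (\<lambda>x. (if b then pt x j else inv (pt x j)))"
    using regular_pt regular_inv[OF regular_pt, of D j] assms by (cases b) simp_all
  then have "regular_on D (\<lambda>x. (if b then pt x j else inv (pt x j)) \<otimes> weval G (pt x) w)"
  proof (rule regular_mult[OF _ Cons])
    fix x assume x: "x \<in> D"
    show "weval G (pt x) w \<in> carrier G" by (rule weval_closed) (rule assms[OF x])
  qed (use assms in auto)
  then show ?case by (simp add: y)
qed

locale hom_variety_setup = affine_algebraic_group G + F: group F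
  for G :: "('i::finite \<Rightarrow> 'k::alg_closed_field, 'b) monoid_scheme" (structure)
    and F :: "('f, 'a) monoid_scheme" +
  fixes f :: "'n::finite \<Rightarrow> 'f"
  assumes f_range: "range f \<subseteq> carrier F" and f_generate: "generate F (range f) = carrier F"
begin

lemma f_closed [simp]: "f j \<in> carrier F"
  using f_range by blast

lemma word_exists: "a \<in> carrier F \<Longrightarrow> \<exists>w. a = weval F f w"
  using F.generate_word[OF f_range] f_generate by blast

lemma group_hom_hom: "\<phi> \<in> hom F G \<Longrightarrow> group_hom F G \<phi>"
  by (simp add: group_hom_def group_hom_axioms_def is_group F.is_group)

definition eval_pt :: "('f \<Rightarrow> 'i \<Rightarrow> 'k) \<Rightarrow> 'n \<times> 'i \<Rightarrow> 'k" where
  "eval_pt \<phi> = (\<lambda>(j, i). \<phi> (f j) i)"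

lemma pt_eval_pt [simp]: "pt (eval_pt \<phi>) = (\<lambda>j. \<phi> (f j))"
  by (rule ext) (simp add: eval_pt_def)

lemma hom_variety_eq: "hom_variety F G f = eval_pt ` hom F G"
  unfolding hom_variety_def eval_pt_def ..

lemma weval_eval_pt:
  assumes "\<phi> \<in> hom F G"
  shows "weval G (pt (eval_pt \<phi>)) w = \<phi> (weval F f w)"
  using group_hom.hom_weval[OF group_hom_hom[OF assms], of f w] by simp

text \<open>Every coincidence between two words in \<open>F\<close> is a regular identity on the
  variety, hence holds at a point \<open>z\<close> of the closure; the values of words at
  \<open>z\<close> therefore define a homomorphism.\<close>

lemma closedin_hom_variety: "closedin zariski (hom_variety F G f)"
proof (rule closedin_zariskiI)
  let ?H = "hom_variety F G f"
  define S where "S = {x :: 'n \<times> 'i \<Rightarrow> 'k. \<forall>j. pt x j \<in> carrier G}"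
  have HS: "?H \<subseteq> S" unfolding hom_variety_eq S_def by (auto simp: hom_in_carrier)
  have clS: "closedin zariski S"
  proof (rule closedin_zariskiI)
    fix z assume "z \<in> zero_locus (vanishing S)"
    then have "pt z j \<in> carrier G" for j
      by (rule closure_mem[OF regular_pt closedin_UNIV_zariski _ closed_carrier, rotated 2]) (auto simp: S_def)
    then show "z \<in> S" by (simp add: S_def)
  qed
  fix z assume z: "z \<in> zero_locus (vanishing ?H)"
  have "z \<in> S" using closure_minimal[OF clS HS] z by blast
  then have zG: "\<And>j. pt z j \<in> carrier G" by (simp add: S_def)
  have eq: "weval G (pt z) v = weval G (pt z) w" if vw: "weval F f v = weval F f w" for v w
  proof (rule closure_equal[OF _ _ clS HS _ z])
    fix x assume "x \<in> ?H"
    then show "weval G (pt x) v = weval G (pt x) w"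
      unfolding hom_variety_eq using weval_eval_pt vw by auto
  qed (rule regular_weval, simp add: S_def)+
  define \<phi> where "\<phi> = (\<lambda>a. weval G (pt z) (SOME w. a = weval F f w))"
  have \<phi>: "\<phi> (weval F f w) = weval G (pt z) w" for w
    unfolding \<phi>_def by (rule eq[symmetric]) (rule someI[of _ w], rule refl)
  have "\<phi> \<in> hom F G"
  proof (rule homI)
    fix a assume "a \<in> carrier F"
    show "\<phi> a \<in> carrier G" unfolding \<phi>_def by (rule weval_closed[OF zG])
    fix b assume "b \<in> carrier F"
    obtain v w where vw: "a = weval F f v" "b = weval F f w"
      using word_exists \<open>a \<in> carrier F\<close> \<open>b \<in> carrier F\<close> by blast
    then have "a \<otimes>\<^bsub>F\<^esub> b = weval F f (v @ w)" by (simp add: F.weval_append)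
    then show "\<phi> (a \<otimes>\<^bsub>F\<^esub> b) = \<phi> a \<otimes> \<phi> b" using vw by (simp add: \<phi> weval_append[OF zG])
  qed
  moreover have "\<phi> (f j) = pt z j" for j using \<phi>[of "[(j, True)]"] zG by simp
  then have "eval_pt \<phi> = z" by (intro pt_inject) simp
  ultimately show "z \<in> ?H" unfolding hom_variety_eq by blast
qed

end

section \<open>Twisting homomorphisms along the projection to the integers\<close>

locale hom_twist = hom_variety_setup G F f
  for G :: "('i::finite \<Rightarrow> 'k::alg_closed_field, 'b) monoid_scheme" (structure)
    and F :: "('f, 'a) monoid_scheme" and f :: "'n::finite \<Rightarrow> 'f" +
  fixes \<delta> :: "'f \<Rightarrow> int" and t :: 'f and \<phi> :: "'f \<Rightarrow> 'i \<Rightarrow> 'k"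
  assumes \<delta>_mult: "\<And>a b. a \<in> carrier F \<Longrightarrow> b \<in> carrier F \<Longrightarrow> \<delta> (a \<otimes>\<^bsub>F\<^esub> b) = \<delta> a + \<delta> b"
    and t: "t \<in> carrier F" "\<delta> t = 1" and \<phi>: "\<phi> \<in> hom F G"
begin

sublocale \<phi>: group_hom F G \<phi>
  by (rule group_hom_hom[OF \<phi>])

abbreviation mult_F (infixl "\<cdot>" 70) where
  "a \<cdot> b \<equiv> a \<otimes>\<^bsub>F\<^esub> b"

lemma \<delta>_one: "\<delta> \<one>\<^bsub>F\<^esub> = 0"
  using \<delta>_mult[of "\<one>\<^bsub>F\<^esub>" "\<one>\<^bsub>F\<^esub>"] by simp

lemma \<delta>_inv: "a \<in> carrier F \<Longrightarrow> \<delta> (inv\<^bsub>F\<^esub> a) = - \<delta> a"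
  using \<delta>_mult[of a "inv\<^bsub>F\<^esub> a"] \<delta>_one by simp

lemma \<delta>_pow: "\<delta> (t [^]\<^bsub>F\<^esub> (k :: int)) = k"
proof -
  have nat: "\<delta> (t [^]\<^bsub>F\<^esub> m) = int m" for m :: nat
    by (induction m) (simp_all add: \<delta>_one \<delta>_mult t)
  show ?thesis
    by (cases k rule: int_cases2) (simp_all add: int_pow_int F.int_pow_neg_int nat \<delta>_inv t)
qed

definition central :: "('i \<Rightarrow> 'k) set" where
  "central = {c \<in> carrier G. \<forall>a\<in>carrier F. \<delta> a = 0 \<longrightarrow> c \<otimes> \<phi> a = \<phi> a \<otimes> c}"

lemma central_closed: "c \<in> central \<Longrightarrow> c \<in> carrier G"
  unfolding central_def by blast

lemma centralD: "c \<in> central \<Longrightarrow> a \<in> carrier F \<Longrightarrow> \<delta> a = 0 \<Longrightarrow> c \<otimes> \<phi> a = \<phi> a \<otimes> c"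
  unfolding central_def by blast

lemma subgroup_central: "subgroup central G"
proof (rule subgroupI)
  show "central \<subseteq> carrier G" unfolding central_def by blast
  show "central \<noteq> {}" unfolding central_def by (auto intro!: exI[of _ \<one>])
next
  fix a assume a: "a \<in> central"
  have "inv a \<otimes> \<phi> b = \<phi> b \<otimes> inv a" if b: "b \<in> carrier F" "\<delta> b = 0" for b
  proof -
    have "\<phi> b = inv a \<otimes> (\<phi> b \<otimes> a)"
      using centralD[OF a b, symmetric] central_closed[OF a] b by (simp add: m_assoc[symmetric])
    then have "\<phi> b \<otimes> inv a = inv a \<otimes> (\<phi> b \<otimes> a) \<otimes> inv a" by simp
    then show ?thesis using central_closed[OF a] b by (simp add: m_assoc)
  qed
  then show "inv a \<in> central" using central_closed[OF a] unfolding central_def by blast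
next
  fix a b assume a: "a \<in> central" and b: "b \<in> central"
  have "a \<otimes> b \<otimes> \<phi> c = \<phi> c \<otimes> (a \<otimes> b)" if c: "c \<in> carrier F" "\<delta> c = 0" for c
  proof -
    have "a \<otimes> b \<otimes> \<phi> c = a \<otimes> (b \<otimes> \<phi> c)" using central_closed a b c by (simp add: m_assoc)
    also have "\<dots> = a \<otimes> \<phi> c \<otimes> b" using centralD[OF b c] central_closed a b c by (simp add: m_assoc)
    also have "\<dots> = \<phi> c \<otimes> (a \<otimes> b)" using centralD[OF a c] central_closed a b c by (simp add: m_assoc)
    finally show ?thesis .
  qed
  then show "a \<otimes> b \<in> central" using central_closed[OF a] central_closed[OF b] unfolding central_def by blast
qed

lemma closedin_central: "closedin zariski central"
proof (rule closedin_zariskiI)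
  fix z assume z: "z \<in> zero_locus (vanishing central)"
  have sub: "central \<subseteq> carrier G" unfolding central_def by blast
  have zG: "z \<in> carrier G" using closure_minimal[OF closed_carrier sub] z by blast
  have "z \<otimes> \<phi> a = \<phi> a \<otimes> z" if a: "a \<in> carrier F" "\<delta> a = 0" for a
  proof (rule closure_equal[OF _ _ closed_carrier sub _ z])
    show "regular_on (carrier G) (\<lambda>z. z \<otimes> \<phi> a)" "regular_on (carrier G) (\<lambda>z. \<phi> a \<otimes> z)"
      using a by (intro regular_mult regular_id regular_const; simp)+
  qed (rule centralD[OF _ a])
  then show "z \<in> central" using zG unfolding central_def by blast
qed

text \<open>Writes \<open>a\<close> as a power of \<open>t\<close> times an element of the kernel of
  \<delta>, and replaces \<phi>(t) by \<phi>(t) c in the first factor only.\<close>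

definition twist :: "('i \<Rightarrow> 'k) \<Rightarrow> 'f \<Rightarrow> 'i \<Rightarrow> 'k" where
  "twist c a = (\<phi> t \<otimes> c) [^] \<delta> a \<otimes> \<phi> (t [^]\<^bsub>F\<^esub> (- \<delta> a) \<cdot> a)"

text \<open>\<open>s\<close> conjugates the image of the kernel of \<delta> in the same way as the
  value of \<phi> at \<open>u\<close> does. Unlike equality with that value, this survives the
  replacement of \<phi>(t) by \<phi>(t) c.\<close>

definition conj_rel :: "('i \<Rightarrow> 'k) \<Rightarrow> 'f \<Rightarrow> bool" where
  "conj_rel s u \<longleftrightarrow> s \<in> carrier G \<and> u \<in> carrier F \<and>
     (\<forall>n\<in>carrier F. \<delta> n = 0 \<longrightarrow> \<phi> n \<otimes> s = s \<otimes> \<phi> (inv\<^bsub>F\<^esub> u \<cdot> n \<cdot> u))"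

lemma conj_rel_base:
  assumes c: "c \<in> central"
  shows "conj_rel (\<phi> t \<otimes> c) t"
  unfolding conj_rel_def
proof (intro conjI ballI impI)
  show "\<phi> t \<otimes> c \<in> carrier G" using central_closed[OF c] t by simp
  fix n assume n: "n \<in> carrier F" "\<delta> n = 0"
  let ?m = "inv\<^bsub>F\<^esub> t \<cdot> n \<cdot> t"
  have m: "?m \<in> carrier F" "\<delta> ?m = 0" using n t by (simp_all add: \<delta>_mult \<delta>_inv)
  have "n \<cdot> t = t \<cdot> ?m" using n t by (simp add: F.m_assoc[symmetric])
  then have "\<phi> n \<otimes> \<phi> t = \<phi> t \<otimes> \<phi> ?m" using n t m by (metis \<phi>.hom_mult)
  then have "\<phi> n \<otimes> (\<phi> t \<otimes> c) = \<phi> t \<otimes> \<phi> ?m \<otimes> c"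
    using n t central_closed[OF c] by (simp only: m_assoc[symmetric] \<phi>.hom_closed)
  also have "\<dots> = \<phi> t \<otimes> c \<otimes> \<phi> ?m"
    using centralD[OF c m] n t m(1) central_closed[OF c] by (simp only: m_assoc \<phi>.hom_closed)
  finally show "\<phi> n \<otimes> (\<phi> t \<otimes> c) = \<phi> t \<otimes> c \<otimes> \<phi> ?m" .
qed (rule t)

lemma conj_rel_mult:
  assumes "conj_rel s u" "conj_rel s' u'"
  shows "conj_rel (s \<otimes> s') (u \<cdot> u')"
  unfolding conj_rel_def
proof (intro conjI ballI impI)
  have s: "s \<in> carrier G" "u \<in> carrier F" "\<And>n. n \<in> carrier F \<Longrightarrow> \<delta> n = 0 \<Longrightarrow> \<phi> n \<otimes> s = s \<otimes> \<phi> (inv\<^bsub>F\<^esub> u \<cdot> n \<cdot> u)"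
    using assms(1) unfolding conj_rel_def by blast+
  have s': "s' \<in> carrier G" "u' \<in> carrier F" "\<And>n. n \<in> carrier F \<Longrightarrow> \<delta> n = 0 \<Longrightarrow> \<phi> n \<otimes> s' = s' \<otimes> \<phi> (inv\<^bsub>F\<^esub> u' \<cdot> n \<cdot> u')"
    using assms(2) unfolding conj_rel_def by blast+
  show "s \<otimes> s' \<in> carrier G" "u \<cdot> u' \<in> carrier F" using s s' by auto
  fix n assume n: "n \<in> carrier F" "\<delta> n = 0"
  let ?m = "inv\<^bsub>F\<^esub> u \<cdot> n \<cdot> u"
  let ?k = "inv\<^bsub>F\<^esub> u' \<cdot> ?m \<cdot> u'"
  have m: "?m \<in> carrier F" "\<delta> ?m = 0" using n s(2) by (simp_all add: \<delta>_mult \<delta>_inv)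
  have k: "?k \<in> carrier F" using m(1) s'(2) by simp
  have "\<phi> n \<otimes> (s \<otimes> s') = (\<phi> n \<otimes> s) \<otimes> s'" using n s(1) s'(1) by (simp add: m_assoc)
  also have "\<dots> = s \<otimes> \<phi> ?m \<otimes> s'" by (simp only: s(3)[OF n])
  also have "\<dots> = s \<otimes> (\<phi> ?m \<otimes> s')" by (rule m_assoc[OF s(1) \<phi>.hom_closed[OF m(1)] s'(1)])
  also have "\<dots> = s \<otimes> (s' \<otimes> \<phi> ?k)" by (simp only: s'(3)[OF m])
  also have "\<dots> = s \<otimes> s' \<otimes> \<phi> ?k" by (rule m_assoc[OF s(1) s'(1) \<phi>.hom_closed[OF k], symmetric])
  also have "?k = inv\<^bsub>F\<^esub> (u \<cdot> u') \<cdot> n \<cdot> (u \<cdot> u')"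
    using n s(2) s'(2) by (simp add: F.inv_mult_group F.m_assoc)
  finally show "\<phi> n \<otimes> (s \<otimes> s') = s \<otimes> s' \<otimes> \<phi> (inv\<^bsub>F\<^esub> (u \<cdot> u') \<cdot> n \<cdot> (u \<cdot> u'))" .
qed

lemma conj_rel_inv:
  assumes "conj_rel s u"
  shows "conj_rel (inv s) (inv\<^bsub>F\<^esub> u)"
  unfolding conj_rel_def
proof (intro conjI ballI impI)
  have s: "s \<in> carrier G" "u \<in> carrier F" "\<And>n. n \<in> carrier F \<Longrightarrow> \<delta> n = 0 \<Longrightarrow> \<phi> n \<otimes> s = s \<otimes> \<phi> (inv\<^bsub>F\<^esub> u \<cdot> n \<cdot> u)"
    using assms unfolding conj_rel_def by blast+
  show "inv s \<in> carrier G" "inv\<^bsub>F\<^esub> u \<in> carrier F" using s by auto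
  fix n assume n: "n \<in> carrier F" "\<delta> n = 0"
  let ?m = "inv\<^bsub>F\<^esub> (inv\<^bsub>F\<^esub> u) \<cdot> n \<cdot> inv\<^bsub>F\<^esub> u"
  have m: "?m \<in> carrier F" "\<delta> ?m = 0" using n s(2) by (simp_all add: \<delta>_mult \<delta>_inv)
  have "inv\<^bsub>F\<^esub> u \<cdot> ?m \<cdot> u = n" using n s(2) by (simp add: F.m_assoc) (simp add: F.m_assoc[symmetric])
  with s(3)[OF m] have "\<phi> ?m \<otimes> s = s \<otimes> \<phi> n" by simp
  then have "inv s \<otimes> (\<phi> ?m \<otimes> s) \<otimes> inv s = inv s \<otimes> (s \<otimes> \<phi> n) \<otimes> inv s" by simp
  moreover have "inv s \<otimes> (\<phi> ?m \<otimes> s) \<otimes> inv s = inv s \<otimes> \<phi> ?m"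
    using s(1) \<phi>.hom_closed[OF m(1)] by (simp add: m_assoc)
  moreover have "inv s \<otimes> (s \<otimes> \<phi> n) \<otimes> inv s = \<phi> n \<otimes> inv s"
    using s(1) n(1) by (simp add: m_assoc[symmetric])
  ultimately show "\<phi> n \<otimes> inv s = inv s \<otimes> \<phi> ?m" by simp
qed

lemma conj_rel_pow:
  assumes "conj_rel s u"
  shows "conj_rel (s [^] (k :: int)) (u [^]\<^bsub>F\<^esub> k)"
proof -
  have su: "s \<in> carrier G" "u \<in> carrier F" using assms unfolding conj_rel_def by blast+
  have nat: "conj_rel (s [^] m) (u [^]\<^bsub>F\<^esub> m)" for m :: nat
  proof (induction m)
    case 0
    show ?case by (simp add: conj_rel_def)
  next
    case (Suc m)
    from conj_rel_mult[OF Suc assms] show ?case by simp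
  qed
  show ?thesis
  proof (cases k rule: int_cases2)
    case (nonneg m)
    then show ?thesis using nat[of m] by (simp add: int_pow_int)
  next
    case (nonpos m)
    then show ?thesis using conj_rel_inv[OF nat[of m]] su by (simp add: int_pow_neg_int F.int_pow_neg_int)
  qed
qed

text \<open>With a = t^k n and b = t^l m, the product is t^(k+l) (t^(-l) n t^l) m.
  \<open>conj_rel_pow\<close> moves the \<open>l\<close>-th power of \<phi>(t) c past \<phi>(n) with
  exactly this conjugate of n as the result.\<close>

lemma twist_hom:
  assumes c: "c \<in> central"
  shows "twist c \<in> hom F G"
proof (rule homI)
  let ?s = "\<phi> t \<otimes> c"
  have s: "?s \<in> carrier G" using central_closed[OF c] t by simp
  fix a assume a: "a \<in> carrier F"
  then show "twist c a \<in> carrier G" unfolding twist_def using s t by simp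
  fix b assume b: "b \<in> carrier F"
  define k l where "k = \<delta> a" and "l = \<delta> b"
  define n where "n = t [^]\<^bsub>F\<^esub> (- k) \<cdot> a"
  define m where "m = t [^]\<^bsub>F\<^esub> (- l) \<cdot> b"
  have n: "n \<in> carrier F" "\<delta> n = 0" and m: "m \<in> carrier F"
    using a b t by (simp_all add: n_def m_def k_def \<delta>_mult \<delta>_pow)
  have tl: "t [^]\<^bsub>F\<^esub> l \<in> carrier F" using t by simp
  let ?n' = "inv\<^bsub>F\<^esub> (t [^]\<^bsub>F\<^esub> l) \<cdot> n \<cdot> t [^]\<^bsub>F\<^esub> l"
  have n': "?n' \<in> carrier F" using n tl by simp
  have comm: "\<phi> n \<otimes> ?s [^] l = ?s [^] l \<otimes> \<phi> ?n'"
    using conj_rel_pow[OF conj_rel_base[OF c], of l] n unfolding conj_rel_def by blast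
  have "?n' \<cdot> m = t [^]\<^bsub>F\<^esub> (- (k + l)) \<cdot> (a \<cdot> b)"
  proof -
    have "?n' \<cdot> m = t [^]\<^bsub>F\<^esub> (- l) \<cdot> n \<cdot> (t [^]\<^bsub>F\<^esub> l \<cdot> (t [^]\<^bsub>F\<^esub> (- l) \<cdot> b))"
      using n t b by (simp add: m_def F.int_pow_neg F.m_assoc)
    also have "t [^]\<^bsub>F\<^esub> l \<cdot> (t [^]\<^bsub>F\<^esub> (- l) \<cdot> b) = b"
      using t b by (simp add: F.int_pow_neg F.m_assoc[symmetric])
    also have "t [^]\<^bsub>F\<^esub> (- l) \<cdot> n \<cdot> b = t [^]\<^bsub>F\<^esub> (- l) \<cdot> t [^]\<^bsub>F\<^esub> (- k) \<cdot> (a \<cdot> b)"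
      using a b t by (simp add: n_def F.m_assoc)
    also have "t [^]\<^bsub>F\<^esub> (- l) \<cdot> t [^]\<^bsub>F\<^esub> (- k) = t [^]\<^bsub>F\<^esub> (- (k + l))"
      using F.int_pow_mult[OF t(1), of "- l" "- k"] by (simp add: add.commute)
    finally show ?thesis .
  qed
  then have nm: "\<phi> ?n' \<otimes> \<phi> m = \<phi> (t [^]\<^bsub>F\<^esub> (- (k + l)) \<cdot> (a \<cdot> b))"
    using \<phi>.hom_mult[OF n' m] by simp
  have cl: "?s [^] k \<in> carrier G" "?s [^] l \<in> carrier G" "\<phi> n \<in> carrier G" "\<phi> m \<in> carrier G" "\<phi> ?n' \<in> carrier G"
    using s n m n' by simp_all
  have "twist c a \<otimes> twist c b = ?s [^] k \<otimes> \<phi> n \<otimes> (?s [^] l \<otimes> \<phi> m)"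
    by (simp only: twist_def n_def m_def k_def l_def)
  also have "\<dots> = ?s [^] k \<otimes> (\<phi> n \<otimes> ?s [^] l) \<otimes> \<phi> m" using cl by (simp add: m_assoc)
  also have "\<dots> = ?s [^] k \<otimes> (?s [^] l \<otimes> \<phi> ?n') \<otimes> \<phi> m" by (simp only: comm)
  also have "\<dots> = ?s [^] k \<otimes> ?s [^] l \<otimes> (\<phi> ?n' \<otimes> \<phi> m)" using cl by (simp only: m_assoc m_closed)
  also have "\<dots> = ?s [^] (k + l) \<otimes> (\<phi> ?n' \<otimes> \<phi> m)" by (simp only: int_pow_mult[OF s])
  also have "\<dots> = twist c (a \<cdot> b)" unfolding nm twist_def by (simp only: \<delta>_mult[OF a b] k_def l_def)
  finally show "twist c (a \<cdot> b) = twist c a \<otimes> twist c b" ..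
qed

lemma twist_kernel:
  assumes "c \<in> central" "a \<in> carrier F" "\<delta> a = 0"
  shows "twist c a = \<phi> a"
  using assms central_closed t by (simp add: twist_def)

lemma twist_one:
  assumes "a \<in> carrier F"
  shows "twist \<one> a = \<phi> a"
proof -
  have "twist \<one> a = \<phi> (t [^]\<^bsub>F\<^esub> \<delta> a) \<otimes> \<phi> (t [^]\<^bsub>F\<^esub> (- \<delta> a) \<cdot> a)"
    using t by (simp add: twist_def \<phi>.hom_int_pow)
  also have "\<dots> = \<phi> (t [^]\<^bsub>F\<^esub> \<delta> a \<cdot> (t [^]\<^bsub>F\<^esub> (- \<delta> a) \<cdot> a))"
    using t assms by (intro \<phi>.hom_mult[symmetric]) simp_all
  also have "t [^]\<^bsub>F\<^esub> \<delta> a \<cdot> (t [^]\<^bsub>F\<^esub> (- \<delta> a) \<cdot> a) = a"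
    using t assms by (simp add: F.int_pow_neg F.m_assoc[symmetric])
  finally show ?thesis .
qed

lemma twist_t:
  assumes "c \<in> central"
  shows "twist c t = \<phi> t \<otimes> c"
  using assms central_closed t by (simp add: twist_def F.int_pow_neg)

end

section \<open>A family of homomorphisms of dimension at least that of the group\<close>

context hom_twist
begin

lemma conj_hom:
  assumes g: "g \<in> carrier G" and \<psi>: "\<psi> \<in> hom F G"
  shows "(\<lambda>a. g \<otimes> \<psi> a \<otimes> inv g) \<in> hom F G"
proof (rule homI)
  interpret \<psi>: group_hom F G \<psi> by (rule group_hom_hom[OF \<psi>])
  fix a b assume a: "a \<in> carrier F" and b: "b \<in> carrier F"
  show "g \<otimes> \<psi> a \<otimes> inv g \<in> carrier G" using a g by simp
  have "g \<otimes> \<psi> a \<otimes> inv g \<otimes> (g \<otimes> \<psi> b \<otimes> inv g) = g \<otimes> \<psi> a \<otimes> (inv g \<otimes> (g \<otimes> (\<psi> b \<otimes> inv g)))"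
    using a b g by (simp add: m_assoc)
  also have "inv g \<otimes> (g \<otimes> (\<psi> b \<otimes> inv g)) = \<psi> b \<otimes> inv g"
    using b g by (simp add: m_assoc[symmetric])
  finally show "g \<otimes> \<psi> (a \<cdot> b) \<otimes> inv g = g \<otimes> \<psi> a \<otimes> inv g \<otimes> (g \<otimes> \<psi> b \<otimes> inv g)"
    using a b g by (simp add: m_assoc)
qed

definition family_hom :: "('i + 'i \<Rightarrow> 'k) \<Rightarrow> 'f \<Rightarrow> 'i \<Rightarrow> 'k" where
  "family_hom d a = (\<lambda>i. d (Inl i)) \<otimes> twist (\<lambda>i. d (Inr i)) a \<otimes> inv (\<lambda>i. d (Inl i))"

lemma family_hom_case_sum: "family_hom (case_sum g c) a = g \<otimes> twist c a \<otimes> inv g"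
  by (simp add: family_hom_def)

lemma family_hom_hom:
  assumes "g \<in> carrier G" "c \<in> central"
  shows "family_hom (case_sum g c) \<in> hom F G"
  using conj_hom[OF assms(1) twist_hom[OF assms(2)]] unfolding family_hom_case_sum[abs_def] .

lemma regular_family:
  assumes "X \<subseteq> carrier G" "C \<subseteq> central"
  shows "regular_on (set_prod X C) (\<lambda>d. eval_pt (family_hom d))"
proof -
  have D: "(\<lambda>i. d (Inl i)) \<in> carrier G" "(\<lambda>i. d (Inr i)) \<in> central" if "d \<in> set_prod X C" for d
    using that assms by (auto elim!: set_prodE)
  have c: "(\<lambda>i. d (Inr i)) \<in> carrier G" if "d \<in> set_prod X C" for d
    using central_closed[OF D(2)[OF that]] .
  \<comment> \<open>For fixed \<open>a\<close> the exponent \<delta>(a) is a fixed integer, so the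
    power is a regular map.\<close>
  have "regular_on (set_prod X C) (\<lambda>d. family_hom d a)" if a: "a \<in> carrier F" for a
    unfolding family_hom_def twist_def
    by (intro regular_mult regular_inv regular_int_pow regular_const regular_coords)
      (use a t D c in simp_all)
  then have "regular_on (set_prod X C) (\<lambda>d. family_hom d (f j))" for j by simp
  then show ?thesis unfolding regular_on_def eval_pt_def by auto
qed

text \<open>
  The fibres of \<open>(g, c) \<mapsto> g (twist c) g\<inverse>\<close> have dimension at most that of \<open>central\<close>: the element \<open>g\<close>
  determines \<open>c\<close> on a fibre, and \<open>g\<close> varies in a coset of \<open>central\<close>.
\<close>
lemma fibre_dim_ge_central:
  assumes X: "X \<subseteq> carrier G" and C: "C \<subseteq> central"
    and Y: "dim_ge Y r" "\<And>x. x \<in> Y \<Longrightarrow> \<exists>g\<in>X. \<exists>c\<in>C. x = case_sum m (case_sum g c) \<and> eval_pt (family_hom (case_sum g c)) = m"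
  obtains W where "W \<subseteq> central" "dim_ge W r"
proof -
  define pr where "pr = (\<lambda>(x :: 'n \<times> 'i + ('i + 'i) \<Rightarrow> 'k) i. x (Inr (Inl i)))"
  obtain w where w: "t = weval F f w" using word_exists t(1) by blast
  define M where "M = weval G (pt m) w"
  \<comment> \<open>\<open>M\<close> is the common value at \<open>t\<close> of all homomorphisms in
    the fibre, namely g \<phi>(t) c g^(-1). Solving for c recovers the point of the fibre from g
    alone.\<close>
  define \<theta> where "\<theta> = (\<lambda>g. case_sum m (case_sum g (inv (\<phi> t) \<otimes> (inv g \<otimes> M \<otimes> g))))"
  have irrY: "irr Y" using Y(1) unfolding dim_ge_def by blast
  have word: "g \<otimes> twist c a \<otimes> inv g = weval G (pt m) v"
    if "g \<in> X" "c \<in> C" "eval_pt (family_hom (case_sum g c)) = m" "a = weval F f v" for g c a v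
  proof -
    have "family_hom (case_sum g c) \<in> hom F G" using that X C by (intro family_hom_hom) auto
    from weval_eval_pt[OF this, of v] show ?thesis using that by (simp add: family_hom_case_sum)
  qed
  have pr: "pr x \<in> X \<and> \<theta> (pr x) = x \<and> M \<in> carrier G" if x: "x \<in> Y" for x
  proof -
    obtain g c where gc: "g \<in> X" "c \<in> C" "x = case_sum m (case_sum g c)" "eval_pt (family_hom (case_sum g c)) = m"
      using Y(2)[OF x] by blast
    have cl: "g \<in> carrier G" "c \<in> carrier G" "c \<in> central" using gc X C central_closed by blast+
    have prx: "pr x = g" by (simp add: pr_def gc(3))
    have M: "M = g \<otimes> (\<phi> t \<otimes> c) \<otimes> inv g"
      using word[OF gc(1,2,4) w] twist_t[OF cl(3)] by (simp add: M_def)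
    have "inv g \<otimes> M \<otimes> g = \<phi> t \<otimes> c"
      unfolding M using cl t by (simp add: m_assoc) (simp add: m_assoc[symmetric])
    then have "inv (\<phi> t) \<otimes> (inv g \<otimes> M \<otimes> g) = c"
      using cl t by (simp add: m_assoc[symmetric])
    then have "\<theta> g = x" unfolding \<theta>_def gc(3) by simp
    then have "\<theta> (pr x) = x" unfolding prx .
    moreover have "M \<in> carrier G" unfolding M using cl t by simp
    ultimately show ?thesis using gc(1) prx by simp
  qed
  have "Y \<noteq> {}" using irrY unfolding irr_def by blast
  then have MG: "M \<in> carrier G" using pr by blast
  let ?X = "pr ` Y"
  have XG: "?X \<subseteq> carrier G" using pr X by blast
  have "\<theta> ` ?X = Y" using pr by (force simp: image_image)
  moreover have "irr ?X" unfolding pr_def by (intro irr_image[OF irrY] regular_coords)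
  moreover have "regular_on ?X \<theta>"
    unfolding \<theta>_def
    by (intro regular_case_sum regular_const regular_id regular_mult regular_inv)
      (use XG MG t in auto)
  ultimately have dimX: "dim_ge ?X r" using dim_ge_pullback[of \<theta> ?X r] Y(1) by simp
  obtain y0 where y0: "y0 \<in> Y" using \<open>Y \<noteq> {}\<close> by blast
  \<comment> \<open>On the kernel of \<delta> every twist equals \<phi>, so two points of the fibre
    conjugate \<phi> identically there and their quotient centralizes its image.\<close>
  have comm: "inv (pr y0) \<otimes> pr y \<in> central" if y: "y \<in> Y" for y
  proof -
    obtain g c where gc: "g \<in> X" "c \<in> C" "y = case_sum m (case_sum g c)" "eval_pt (family_hom (case_sum g c)) = m"
      using Y(2)[OF y] by blast
    obtain g0 c0 where gc0: "g0 \<in> X" "c0 \<in> C" "y0 = case_sum m (case_sum g0 c0)" "eval_pt (family_hom (case_sum g0 c0)) = m"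
      using Y(2)[OF y0] by blast
    have cl: "g \<in> carrier G" "g0 \<in> carrier G" "c \<in> central" "c0 \<in> central" using gc gc0 X C by blast+
    have "inv g0 \<otimes> g \<otimes> \<phi> a = \<phi> a \<otimes> (inv g0 \<otimes> g)" if a: "a \<in> carrier F" "\<delta> a = 0" for a
    proof -
      obtain v where v: "a = weval F f v" using word_exists a(1) by blast
      have "g \<otimes> \<phi> a \<otimes> inv g = g0 \<otimes> \<phi> a \<otimes> inv g0"
        using word[OF gc(1,2,4) v] word[OF gc0(1,2,4) v] twist_kernel a cl by simp
      then have "inv g0 \<otimes> (g \<otimes> \<phi> a \<otimes> inv g) \<otimes> g = inv g0 \<otimes> (g0 \<otimes> \<phi> a \<otimes> inv g0) \<otimes> g" by simp
      moreover have "inv g0 \<otimes> (g \<otimes> \<phi> a \<otimes> inv g) \<otimes> g = inv g0 \<otimes> g \<otimes> \<phi> a"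
        using cl a by (simp add: m_assoc)
      moreover have "inv g0 \<otimes> (g0 \<otimes> \<phi> a \<otimes> inv g0) \<otimes> g = \<phi> a \<otimes> (inv g0 \<otimes> g)"
        using cl a by (simp add: m_assoc[symmetric])
      ultimately show ?thesis by simp
    qed
    then show ?thesis unfolding central_def using cl by (simp add: pr_def gc(3) gc0(3))
  qed
  show ?thesis
  proof (rule that)
    show "(\<lambda>x. inv (pr y0) \<otimes> x) ` ?X \<subseteq> central" using comm by blast
    show "dim_ge ((\<lambda>x. inv (pr y0) \<otimes> x) ` ?X) r"
      by (rule dim_ge_translate[OF dimX XG]) (use XG y0 in auto)
  qed
qed

text \<open>The source has dimension at least \<open>n + Max \<D>\<close> and the chosen fibre at
  most \<open>Max \<D>\<close>, so at least \<open>n\<close> independent coordinates are left for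
  the image \<open>T\<close>.\<close>

lemma large_family:
  assumes X0: "dim_ge X0 n" "X0 \<subseteq> carrier G"
  obtains T A where "irr T" "T \<subseteq> hom_variety F G f" "eval_pt \<phi> \<in> T"
    "coord_ind (vanishing T) A" "n \<le> card A"
proof -
  obtain X where X: "dim_ge X n" "closedin zariski X" "\<one> \<in> X" "X \<subseteq> carrier G"
    by (rule dim_ge_normalize[OF X0 subgroup_self closed_carrier])
  \<comment> \<open>The maximum of this set plays the role of the dimension of
    \<open>central\<close>: it is attained by \<open>C\<close> and bounds every irreducible subset,
    in particular those obtained from fibres.\<close>
  define \<D> where "\<D> = {m. \<exists>W\<subseteq>central. dim_ge W m}"
  have "\<D> \<subseteq> {..card (UNIV :: 'i set)}" unfolding \<D>_def using dim_ge_le_card by blast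
  then have finD: "finite \<D>" by (rule finite_subset) simp
  have "0 \<in> \<D>" unfolding \<D>_def
    using dim_ge_singleton[of \<one>] subgroup.one_closed[OF subgroup_central] by blast
  then have "Max \<D> \<in> \<D>" using finD by (intro Max_in) auto
  then obtain W where W: "dim_ge W (Max \<D>)" "W \<subseteq> central" unfolding \<D>_def by blast
  obtain C where C: "dim_ge C (Max \<D>)" "closedin zariski C" "\<one> \<in> C" "C \<subseteq> central"
    by (rule dim_ge_normalize[OF W subgroup_central closedin_central])
  let ?D = "set_prod X C"
  have dimD: "dim_ge ?D (n + Max \<D>)" by (rule dim_ge_set_prod[OF X(1) C(1)])
  then have irrD': "irr ?D" unfolding dim_ge_def by blast
  have clD: "closedin zariski ?D" by (rule closedin_set_prod[OF X(2) C(2)])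
  define \<mu> where "\<mu> = (\<lambda>d. eval_pt (family_hom d))"
  have reg: "regular_on ?D \<mu>" unfolding \<mu>_def by (rule regular_family[OF X(4) C(4)])
  \<comment> \<open>Passing to the graph turns \<open>\<mu>\<close> into a coordinate projection of a closed set.\<close>
  define \<Gamma> where "\<Gamma> = (\<lambda>d. case_sum (\<mu> d) d) ` ?D"
  have irr\<Gamma>: "irr \<Gamma>" unfolding \<Gamma>_def
    by (intro irr_image[OF irrD'] regular_case_sum reg regular_id)
  have cl\<Gamma>: "closedin zariski \<Gamma>"
  proof (rule closedin_zariskiI)
    fix z :: "'n \<times> 'i + ('i + 'i) \<Rightarrow> 'k" assume z: "z \<in> zero_locus (vanishing \<Gamma>)"
    let ?S = "{z :: 'n \<times> 'i + ('i + 'i) \<Rightarrow> 'k. (\<lambda>i. z (Inr i)) \<in> ?D}"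
    have clS: "closedin zariski ?S" by (rule closed_preimage[OF regular_coords clD])
    have sub: "\<Gamma> \<subseteq> ?S" unfolding \<Gamma>_def by auto
    have zS: "(\<lambda>i. z (Inr i)) \<in> ?D" using closure_minimal[OF clS sub] z by blast
    have "(\<lambda>i. z (Inl i)) = \<mu> (\<lambda>i. z (Inr i))"
    proof (rule closure_equal[OF regular_coords _ clS sub _ z])
      show "regular_on ?S (\<lambda>z. \<mu> (\<lambda>i. z (Inr i)))"
        by (rule regular_comp[OF regular_coords reg]) simp
    qed (auto simp: \<Gamma>_def)
    then have "z = case_sum (\<mu> (\<lambda>i. z (Inr i))) (\<lambda>i. z (Inr i))"
      by (intro ext) (metis sum.case_eq_if sum.collapse(1) sum.collapse(2))
    then show "z \<in> \<Gamma>" unfolding \<Gamma>_def using zS by (rule image_eqI)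
  qed
  have "(\<lambda>z i. z (Inr i)) ` \<Gamma> = ?D" unfolding \<Gamma>_def image_image by simp
  then have "dim_ge \<Gamma> (n + Max \<D>)"
    using dim_ge_pullback[OF _ irr\<Gamma> regular_coords, of Inr "n + Max \<D>"] dimD by simp
  then obtain y where y: "alg_ind (vanishing \<Gamma>) (n + Max \<D>) y" unfolding dim_ge_def by blast
  interpret P: pf_prime "vanishing \<Gamma>" by (rule irr_pf_prime[OF irr\<Gamma>])
  have \<Gamma>_eq: "zero_locus (vanishing \<Gamma>) = \<Gamma>" using cl\<Gamma> unfolding closedin_zariski_vanishing .
  \<comment> \<open>Projecting to the target coordinates \<open>range Inl\<close>, \<open>A\<close>
    measures the image of \<mu> and \<open>B\<close> a fibre.\<close>
  obtain A B P' \<gamma> where A: "A \<subseteq> range Inl" "n + Max \<D> \<le> card A + card B" "coord_ind (vanishing \<Gamma>) A"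
    and P': "pf_prime P'" "coord_ind P' B" "zero_locus P' \<subseteq> {x \<in> zero_locus (vanishing \<Gamma>). \<forall>i\<in>range Inl. x i = \<gamma> i}"
    by (rule P.fibre_dimension[OF finite y, of "range Inl"]) (rule that)
  have "card B \<le> Max \<D>"
  proof -
    interpret P': pf_prime P' by (rule P'(1))
    obtain y' where "alg_ind P' (card B) y'" using coord_ind_alg_ind[OF P'(2) finite] by blast
    then have dimY: "dim_ge (zero_locus P') (card B)"
      by (intro dim_geI[OF P'.irr_zero_locus[OF finite]]) (simp add: P'.vanishing_zero_locus)
    have "\<exists>g\<in>X. \<exists>c\<in>C. x = case_sum (\<lambda>i. \<gamma> (Inl i)) (case_sum g c) \<and> eval_pt (family_hom (case_sum g c)) = (\<lambda>i. \<gamma> (Inl i))"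
      if x: "x \<in> zero_locus P'" for x
    proof -
      have "x \<in> \<Gamma>" "\<forall>i. x (Inl i) = \<gamma> (Inl i)" using P'(3) x unfolding \<Gamma>_eq by auto
      then obtain d where d: "d \<in> ?D" "x = case_sum (\<mu> d) d" unfolding \<Gamma>_def by blast
      have "\<mu> d = (\<lambda>i. \<gamma> (Inl i))" using \<open>\<forall>i. x (Inl i) = \<gamma> (Inl i)\<close> unfolding d(2) by auto
      moreover obtain g c where "d = case_sum g c" "g \<in> X" "c \<in> C" using d(1) by (rule set_prodE)
      ultimately show ?thesis using d(2) unfolding \<mu>_def by auto
    qed
    then obtain W where "W \<subseteq> central" "dim_ge W (card B)"
      by (rule fibre_dim_ge_central[OF X(4) C(4) dimY])
    then have "card B \<in> \<D>" unfolding \<D>_def by blast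
    then show ?thesis using finD by (rule Max_ge[rotated])
  qed
  then have nA: "n \<le> card A" using A(2) by simp
  let ?T = "\<mu> ` ?D" and ?A = "Inl -` A :: ('n \<times> 'i) set"
  have "A = Inl ` ?A" using A(1) by blast
  then have cardA: "card A = card ?A" by (metis card_image inj_Inl)
  have ind: "coord_ind (vanishing ?T) ?A"
    unfolding coord_ind_def
  proof (intro ballI impI)
    fix q :: "('n \<times> 'i \<Rightarrow> 'k) \<Rightarrow> 'k" assume q: "q \<in> pf ?A" "q \<in> vanishing ?T"
    let ?q = "\<lambda>z :: 'n \<times> 'i + ('i + 'i) \<Rightarrow> 'k. q (\<lambda>i. z (Inl i))"
    have qA: "?q \<in> pf A"
      by (rule pf_subst[where f = "\<lambda>i z. z (Inl i)" and p = q, OF q(1)], rule pf_coord) simp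
    have "?q \<in> pf UNIV" by (rule pf_mono[OF qA]) simp
    moreover have "?q z = 0" if "z \<in> \<Gamma>" for z
      using that q(2) unfolding \<Gamma>_def vanishing_def by auto
    ultimately have "?q \<in> vanishing \<Gamma>" by (simp add: vanishing_def)
    then have "?q = (\<lambda>_. 0)" using A(3) qA unfolding coord_ind_def by blast
    then have "q x = 0" for x using fun_cong[of ?q "\<lambda>_. 0" "case_sum x (\<lambda>_. 0)"] by simp
    then show "q = (\<lambda>_. 0)" by (rule ext)
  qed
  have irrT: "irr ?T" by (rule irr_image[OF irrD' reg])
  have TH: "?T \<subseteq> hom_variety F G f"
  proof
    fix x assume "x \<in> ?T"
    then obtain d where d: "d \<in> ?D" "x = \<mu> d" by blast
    obtain g c where "d = case_sum g c" "g \<in> X" "c \<in> C" using d(1) by (rule set_prodE)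
    then have "family_hom d \<in> hom F G" using family_hom_hom X(4) C(4) by blast
    then show "x \<in> hom_variety F G f" unfolding hom_variety_eq d(2) \<mu>_def by blast
  qed
  \<comment> \<open>Both factors pass through the identity, and these parameters give the
    homomorphism \<phi> itself.\<close>
  have "\<mu> (case_sum \<one> \<one>) = eval_pt \<phi>"
    unfolding \<mu>_def by (rule pt_inject) (simp add: family_hom_case_sum twist_one)
  then have "eval_pt \<phi> \<in> ?T" using set_prodI[OF X(3) C(3)] by (metis image_eqI)
  then show ?thesis using that[OF irrT TH _ ind] nA cardA by simp
qed

end

theorem mainTheorem4:
  fixes F :: "('f, 'a) monoid_scheme"
    and f :: "'n::finite \<Rightarrow> 'f"
    and G :: "('i::finite \<Rightarrow> 'k::alg_closed_field, 'b) monoid_scheme"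
    and Z :: "('n \<times> 'i \<Rightarrow> 'k) set"
  assumes "affine_algebraic_group G"
    and "group F"
    and "range f \<subseteq> carrier F"
    and "generate F (range f) = carrier F"
    and "infinite (rcosets\<^bsub>F\<^esub> (derived F (carrier F)))"
    and "Z \<in> irreducible_components (subtopology zariski (hom_variety F G f))"
  shows "krull_dim (subtopology zariski (carrier G)) \<le> krull_dim (subtopology zariski Z)"
proof -
  interpret affine_algebraic_group G by fact
  interpret F: group F by fact
  interpret S: hom_variety_setup G F f by unfold_locales (fact assms)+
  obtain \<delta> :: "'f \<Rightarrow> int" and t where \<delta>: "\<And>a b. a \<in> carrier F \<Longrightarrow> b \<in> carrier F \<Longrightarrow> \<delta> (a \<otimes>\<^bsub>F\<^esub> b) = \<delta> a + \<delta> b"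
    and t: "t \<in> carrier F" "\<delta> t = 1"
    by (rule F.hom_onto_integers[OF assms(3-5)]) (rule that)
  obtain p where p: "p \<in> Z" and max: "\<And>T. irr T \<Longrightarrow> T \<subseteq> hom_variety F G f \<Longrightarrow> p \<in> T \<Longrightarrow> T \<subseteq> Z"
    and clZ: "closedin zariski Z"
    by (rule generic_point_of_component[OF S.closedin_hom_variety assms(6)]) (rule that)
  have "Z \<subseteq> hom_variety F G f"
    using assms(6) unfolding irreducible_components_def irreducible_subset_zariski by blast
  then obtain \<phi> where \<phi>: "\<phi> \<in> hom F G" "p = S.eval_pt \<phi>" using p unfolding S.hom_variety_eq by blast
  interpret T: hom_twist G F f \<delta> t \<phi>
    by unfold_locales (use \<delta> t \<phi> in auto)
  show ?thesis
    \<comment> \<open>Each chain in the group is matched separately: its top member is the piece of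
      the group by which \<phi> is conjugated.\<close>
    unfolding krull_dim_def[of "subtopology zariski (carrier G)"]
  proof (rule Sup_least)
    fix e assume "e \<in> {enat n |n. \<exists>Z. (\<forall>j\<le>n. closedin (subtopology zariski (carrier G)) (Z j) \<and>
        irreducible_subset (subtopology zariski (carrier G)) (Z j)) \<and> (\<forall>j<n. Z j \<subset> Z (Suc j))}"
    then obtain n and X :: "nat \<Rightarrow> ('i \<Rightarrow> 'k) set" where e: "e = enat n"
      and X: "\<And>j. j \<le> n \<Longrightarrow> closedin (subtopology zariski (carrier G)) (X j)"
        "\<And>j. j \<le> n \<Longrightarrow> X j \<subseteq> carrier G \<and> irr (X j)" "\<And>j. j < n \<Longrightarrow> X j \<subset> X (Suc j)"
      unfolding irreducible_subset_zariski by blast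
    have "closedin zariski (X j) \<and> irr (X j)" if "j \<le> n" for j
      using closedin_trans_full[OF X(1)[OF that] closed_carrier] X(2)[OF that] by blast
    from chain_alg_ind[of n X, OF this X(3)] obtain y where "alg_ind (vanishing (X n)) n y" by blast
    then have "dim_ge (X n) n" using X(2)[of n] by (intro dim_geI) simp_all
    then obtain T A where T: "irr T" "T \<subseteq> hom_variety F G f" "S.eval_pt \<phi> \<in> T"
      and A: "coord_ind (vanishing T) A" "n \<le> card A"
      by (rule T.large_family) (use X(2)[of n] in simp_all)
    have "T \<subseteq> Z" using max T \<phi>(2) by blast
    then have TZ: "zero_locus (vanishing T) \<subseteq> Z" by (rule closure_minimal[OF clZ])
    obtain Y where Y: "Y (card A) = zero_locus (vanishing T)"
      "\<forall>j\<le>card A. closedin zariski (Y j) \<and> irr (Y j)" "\<forall>j<card A. Y j \<subset> Y (Suc j)"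
      using coord_ind_chain[OF irr_pf_prime[OF T(1)] A(1)] by blast
    have "Y j \<subseteq> Z" if "j \<le> card A" for j
    proof -
      have "Y j \<subseteq> Y (card A)"
        using that Y(3) by (induction rule: inc_induct) auto
      then show ?thesis using Y(1) TZ by simp
    qed
    then have "closedin (subtopology zariski Z) (Y j) \<and> irreducible_subset (subtopology zariski Z) (Y j)"
      if "j \<le> card A" for j
      using that Y(2) unfolding irreducible_subset_zariski by (auto simp: closedin_subset_topspace)
    then have "enat (card A) \<le> krull_dim (subtopology zariski Z)"
      unfolding krull_dim_def using Y(3) by (intro Sup_upper) blast
    then show "e \<le> krull_dim (subtopology zariski Z)"
      unfolding e using A(2) by (meson enat_ord_simps(1) order_trans)
  qed
qed

end
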